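(* There exists a sequence of hyperbolic rod complements in the $3$-torus, each being the complement of exactly three disjoint rods, whose volumes grow to infinity.
   Context: The $3$-torus $\mathbb{T}^3$ is the unit cube $[0,1]^3$ with opposite faces glued identically, i.e. $\mathbb{R}^3/\mathbb{Z}^3$. A rod is the projection to $\mathbb{T}^3$ of a Euclidean straight line in $\mathbb{R}^3$ with rational slope. A rod complement is the complement of finitely many disjoint rods in $\mathbb{T}^3$; it is hyperbolic if it admits a complete hyperbolic structure (then of finite volume and unique up to isometry), and its volume is the volume of this structure. *)

theory Defs
  imports "HOL-Analysis.Analysis"
begin

section \<open>The 3-torus and rods\<close>

text \<open>Points of the torus are the cosets of the integer lattice in 3-space.\<close>

definition torus_proj :: "real^3 \<Rightarrow> (real^3) set" where
  "torus_proj x = {y. \<forall>i. y $ i - x $ i \<in> \<int>}"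

definition torus3 :: "(real^3) set topology" where
  "torus3 = topology (\<lambda>U. U \<subseteq> range torus_proj \<and> open (torus_proj -` U))"

lemma openin_torus3:
  "openin torus3 U \<longleftrightarrow> U \<subseteq> range torus_proj \<and> open (torus_proj -` U)"
proof -
  have "istopology (\<lambda>U. U \<subseteq> range torus_proj \<and> open (torus_proj -` U))"
    unfolding istopology_def by (auto simp: vimage_Union)
  then show ?thesis
    by (simp add: torus3_def)
qed

lemma topspace_torus3: "topspace torus3 = range torus_proj"
proof
  show "topspace torus3 \<subseteq> range torus_proj"
    using openin_torus3 openin_topspace by blast
  have "openin torus3 (range torus_proj)"
    by (auto simp: openin_torus3 vimage_def)
  then show "range torus_proj \<subseteq> topspace torus3"
    by (rule openin_subset)
qed

lemma quotient_map_torus_proj: "quotient_map euclidean torus3 torus_proj"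
  by (auto simp: quotient_map_def topspace_torus3 openin_torus3 vimage_def)

definition rod :: "(real^3) set set \<Rightarrow> bool" where
  "rod r \<longleftrightarrow> (\<exists>p v. v \<noteq> 0 \<and> (\<forall>i. v $ i \<in> \<rat>) \<and>
     r = torus_proj ` range (\<lambda>t. p + t *\<^sub>R v))"

definition rod_complement :: "(real^3) set set set \<Rightarrow> (real^3) set topology" where
  "rod_complement R = subtopology torus3 (topspace torus3 - \<Union>R)"


section \<open>Hyperbolic 3-space: the upper half-space model\<close>

definition H3 :: "(real^3) set" where
  "H3 = {x. x $ 3 > 0}"

definition H3_dist :: "real^3 \<Rightarrow> real^3 \<Rightarrow> real" where
  "H3_dist x y = arcosh (1 + (dist x y)\<^sup>2 / (2 * x $ 3 * y $ 3))"

definition H3_volume :: "(real^3) measure" where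
  "H3_volume = density lborel (\<lambda>x. ennreal (indicator H3 x / (x $ 3) ^ 3))"


section \<open>Complete hyperbolic structures and their volumes\<close>

text \<open>A complete hyperbolic structure on a 3-manifold \<open>X\<close> is represented by its Riemannian
  distance: a metric \<open>d\<close> that induces the topology of \<open>X\<close>, is complete, is a length metric,
  and is locally isometric to hyperbolic 3-space.\<close>

definition curve_length :: "('a \<Rightarrow> 'a \<Rightarrow> real) \<Rightarrow> (real \<Rightarrow> 'a) \<Rightarrow> ennreal" where
  "curve_length d g = (SUP ts\<in>{ts. sorted ts \<and> set ts \<subseteq> {0..1}}.
     ennreal (\<Sum>i<length ts - 1. d (g (ts ! i)) (g (ts ! Suc i))))"

definition length_metric :: "'a topology \<Rightarrow> ('a \<Rightarrow> 'a \<Rightarrow> real) \<Rightarrow> bool" where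
  "length_metric X d \<longleftrightarrow> (\<forall>x\<in>topspace X. \<forall>y\<in>topspace X.
     ennreal (d x y) = (INF g\<in>{g. pathin X g \<and> g 0 = x \<and> g 1 = y}. curve_length d g))"

definition isometric_chart ::
  "'a topology \<Rightarrow> ('a \<Rightarrow> 'a \<Rightarrow> real) \<Rightarrow> 'a set \<Rightarrow> ('a \<Rightarrow> real^3) \<Rightarrow> bool" where
  "isometric_chart X d U \<phi> \<longleftrightarrow> openin X U \<and> open (\<phi> ` U) \<and> \<phi> ` U \<subseteq> H3 \<and>
     (\<forall>x\<in>U. \<forall>y\<in>U. H3_dist (\<phi> x) (\<phi> y) = d x y)"

definition complete_hyperbolic_metric :: "'a topology \<Rightarrow> ('a \<Rightarrow> 'a \<Rightarrow> real) \<Rightarrow> bool" where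
  "complete_hyperbolic_metric X d \<longleftrightarrow>
     Metric_space (topspace X) d \<and>
     Metric_space.mtopology (topspace X) d = X \<and>
     Metric_space.mcomplete (topspace X) d \<and>
     length_metric X d \<and>
     (\<forall>x\<in>topspace X. \<exists>U \<phi>. x \<in> U \<and> isometric_chart X d U \<phi>)"

text \<open>The volume measure is the Borel measure that every isometric chart carries to hyperbolic
  volume. It is unique when \<open>X\<close> is second countable, since countably many charts then cover \<open>X\<close>.\<close>

definition hyperbolic_volume_measure ::
  "'a topology \<Rightarrow> ('a \<Rightarrow> 'a \<Rightarrow> real) \<Rightarrow> 'a measure \<Rightarrow> bool" where
  "hyperbolic_volume_measure X d \<mu> \<longleftrightarrow>
     space \<mu> = topspace X \<and> sets \<mu> = sigma_sets (topspace X) {U. openin X U} \<and>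
     (\<forall>U \<phi>. isometric_chart X d U \<phi> \<longrightarrow>
        (\<forall>A\<in>sets \<mu>. A \<subseteq> U \<longrightarrow> emeasure \<mu> A = emeasure H3_volume (\<phi> ` A)))"

definition has_finite_hyperbolic_volume ::
  "'a topology \<Rightarrow> ('a \<Rightarrow> 'a \<Rightarrow> real) \<Rightarrow> real \<Rightarrow> bool" where
  "has_finite_hyperbolic_volume X d v \<longleftrightarrow>
     (\<exists>\<mu>. hyperbolic_volume_measure X d \<mu> \<and> finite_measure \<mu> \<and> measure \<mu> (topspace X) = v)"

end

theory Submission
  imports Defs
begin

text \<open>
  Scale the torus so that its three axis-parallel rods run along edges of a tiling of space by
  unit cubes, three pairwise skew edges of each cube. Reflections in the planes of the cubes preserve
  the rods, and a cube without its three edges is homeomorphic, face by face, to the right-angled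
  hyperbolic bipyramid with three ideal and two finite vertices. Since the dihedral angles are right,
  the hyperbolic metrics of the tiles fit together: around each point the tiles unfold by reflections
  in orthogonal mirrors to a neighbourhood in hyperbolic space. Folding onto a single tile does not increase
  distances, which gives completeness.

  This is the Borromean rings complement. A cyclic cover of degree \<open>n\<close> of the torus in which each
  axis direction generates the deck group is again a torus with three rods, and its rod complement consists
  of \<open>8 n\<close> bipyramids, so that the volumes are unbounded.
\<close>

section \<open>Hyperbolic space in Minkowski space\<close>

text \<open>A hyperbolic structure is given here by a distance, so it is built as the infimum of the
  lengths of broken geodesics whose pieces each lie in one tile. The local task is to show that this
  infimum is hyperbolic distance: a geodesic of the unfolded picture is cut where it crosses
  mirrors, and since the mirrors at a point are pairwise orthogonal, the reflected copies of one
  corner fill a whole neighbourhood. In Minkowski space reflections are linear, and convexity and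
  the side of a mirror are sign conditions on linear forms; this is why points of the half-space are
  carried there.

  The second obstacle is the volume. The measure must agree with every isometric chart on every
  Borel set, not only with the charts constructed. Hence an isometry between arbitrary Borel sets of
  hyperbolic space, with no smoothness assumed, has to preserve volume.

  No exact volume is computed. One box of positive volume inside the bipyramid and a lower bound for
  the number of tiles give the growth; a crude cover of the cusps gives finiteness.\<close>

definition vec4 :: "real \<Rightarrow> real \<Rightarrow> real \<Rightarrow> real \<Rightarrow> real^4" where
  "vec4 a b c d = (\<chi> i. if i = 1 then a else if i = 2 then b else if i = 3 then c else d)"

lemma vec4_nth [simp]:
  "vec4 a b c d $ 1 = a" "vec4 a b c d $ 2 = b" "vec4 a b c d $ 3 = c" "vec4 a b c d $ 4 = d"
  by (simp_all add: vec4_def)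

lemma vec4_eq_iff: "(P::real^4) = Q \<longleftrightarrow> P$1 = Q$1 \<and> P$2 = Q$2 \<and> P$3 = Q$3 \<and> P$4 = Q$4"
  by (simp add: vec_eq_iff forall_4)

lemma vec3_eq_iff: "(P::real^3) = Q \<longleftrightarrow> P$1 = Q$1 \<and> P$2 = Q$2 \<and> P$3 = Q$3"
  by (simp add: vec_eq_iff forall_3)

lemma dist_vec3: "(dist (x::real^3) y)\<^sup>2 = (x$1 - y$1)\<^sup>2 + (x$2 - y$2)\<^sup>2 + (x$3 - y$3)\<^sup>2"
  unfolding dist_norm power2_norm_eq_inner inner_vec_def sum_3 by (simp add: power2_eq_square)

text \<open>The third and fourth coordinates are null, so that the upper half-space parametrizes the
  upper sheet of the hyperboloid by rational functions.\<close>

definition lor :: "real^4 \<Rightarrow> real^4 \<Rightarrow> real" where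
  "lor P Q = P$1 * Q$1 + P$2 * Q$2 - (P$3 * Q$4 + P$4 * Q$3) / 2"

definition hyp :: "real^3 \<Rightarrow> real^4" where
  "hyp p = vec4 (p$1 / p$3) (p$2 / p$3) (1 / p$3) (((p$1)\<^sup>2 + (p$2)\<^sup>2 + (p$3)\<^sup>2) / p$3)"

definition unhyp :: "real^4 \<Rightarrow> real^3" where
  "unhyp P = vector [P$1 / P$3, P$2 / P$3, 1 / P$3]"

lemma lor_commute: "lor P Q = lor Q P"
  by (simp add: lor_def algebra_simps)

lemma lor_simps [simp]:
  "lor (P + P') Q = lor P Q + lor P' Q" "lor Q (P + P') = lor Q P + lor Q P'"
  "lor (P - P') Q = lor P Q - lor P' Q" "lor Q (P - P') = lor Q P - lor Q P'"
  "lor (a *\<^sub>R P) Q = a * lor P Q" "lor Q (a *\<^sub>R P) = a * lor Q P"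
  "lor (- P) Q = - lor P Q" "lor Q (- P) = - lor Q P" "lor 0 Q = 0" "lor Q 0 = 0"
  by (simp_all add: lor_def algebra_simps diff_divide_distrib add_divide_distrib)

lemma lor_sum: "lor (\<Sum>i\<in>I. f i) Q = (\<Sum>i\<in>I. lor (f i) Q)" "lor Q (\<Sum>i\<in>I. f i) = (\<Sum>i\<in>I. lor Q (f i))"
  by (induction I rule: infinite_finite_induct) auto

lemma lor_nondegenerate: "(\<And>Q. lor P Q = 0) \<Longrightarrow> P = 0"
  using lor_def[of P "vec4 1 0 0 0"] lor_def[of P "vec4 0 1 0 0"] lor_def[of P "vec4 0 0 1 0"]
    lor_def[of P "vec4 0 0 0 1"]
  by (simp add: vec4_eq_iff)

lemma H3_iff: "p \<in> H3 \<longleftrightarrow> p$3 > 0"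
  by (simp add: H3_def)

lemma hyp_nth: "hyp p $ 1 = p$1 / p$3" "hyp p $ 2 = p$2 / p$3" "hyp p $ 3 = 1 / p$3"
    "hyp p $ 4 = ((p$1)\<^sup>2 + (p$2)\<^sup>2 + (p$3)\<^sup>2) / p$3"
  by (simp_all add: hyp_def)

text \<open>The bridge between the two models: equalities and comparisons of distances become
  statements about a bilinear form.\<close>

lemma lor_hyp:
  assumes "p \<in> H3" "q \<in> H3"
  shows "lor (hyp p) (hyp q) = - (1 + (dist p q)\<^sup>2 / (2 * p$3 * q$3))"
  using assms unfolding H3_iff lor_def hyp_nth dist_vec3
  by (simp add: field_simps power2_eq_square)

lemma lor_hyp_self: "p \<in> H3 \<Longrightarrow> lor (hyp p) (hyp p) = - 1"
  by (simp add: lor_hyp)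

lemma lor_hyp_le: "p \<in> H3 \<Longrightarrow> q \<in> H3 \<Longrightarrow> lor (hyp p) (hyp q) \<le> - 1"
  by (simp add: lor_hyp H3_iff)

lemma H3_dist_arcosh: "p \<in> H3 \<Longrightarrow> q \<in> H3 \<Longrightarrow> H3_dist p q = arcosh (- lor (hyp p) (hyp q))"
  by (simp add: lor_hyp H3_dist_def add.commute)

lemma cosh_H3_dist: "p \<in> H3 \<Longrightarrow> q \<in> H3 \<Longrightarrow> cosh (H3_dist p q) = - lor (hyp p) (hyp q)"
  using lor_hyp_le[of p q] by (simp add: H3_dist_arcosh)

lemma H3_dist_nonneg: "p \<in> H3 \<Longrightarrow> q \<in> H3 \<Longrightarrow> H3_dist p q \<ge> 0"
  using lor_hyp_le[of p q] by (simp add: H3_dist_arcosh)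

lemma H3_dist_commute: "H3_dist p q = H3_dist q p"
  by (simp add: H3_dist_def dist_commute mult.commute mult.left_commute)

lemma H3_dist_eqI:
  assumes "p \<in> H3" "q \<in> H3" "t \<ge> 0" "lor (hyp p) (hyp q) = - cosh t"
  shows "H3_dist p q = t"
  using assms by (simp add: H3_dist_arcosh arcosh_cosh_real)

lemma H3_dist_eq_0: "p \<in> H3 \<Longrightarrow> q \<in> H3 \<Longrightarrow> H3_dist p q = 0 \<longleftrightarrow> p = q"
  by (auto simp: H3_dist_def H3_iff)

lemma H3_dist_self [simp]: "p \<in> H3 \<Longrightarrow> H3_dist p p = 0"
  by (simp add: H3_dist_eq_0)

lemma H3_dist_eq_iff:
  assumes "p \<in> H3" "q \<in> H3" "p' \<in> H3" "q' \<in> H3"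
  shows "H3_dist p q = H3_dist p' q' \<longleftrightarrow> lor (hyp p) (hyp q) = lor (hyp p') (hyp q')"
  by (metis assms cosh_H3_dist H3_dist_arcosh neg_equal_iff_equal)

lemma unhyp_hyp [simp]: "p \<in> H3 \<Longrightarrow> unhyp (hyp p) = p"
  by (simp add: unhyp_def hyp_def vec3_eq_iff H3_iff)

lemma unhyp_in_H3: "P$3 > 0 \<Longrightarrow> unhyp P \<in> H3"
  by (simp add: unhyp_def H3_iff)

lemma hyp_unhyp [simp]:
  assumes "lor P P = - 1" "P$3 > 0"
  shows "hyp (unhyp P) = P"
proof -
  have "P$1 * P$1 + P$2 * P$2 + 1 = P$3 * P$4"
    using assms(1) by (simp add: lor_def)
  then show ?thesis
    using assms(2) by (simp add: vec4_eq_iff hyp_nth unhyp_def field_simps power2_eq_square)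
qed

text \<open>Unit timelike vectors form two sheets, and the sign of a product tells whether two of
  them lie on the same one. For the image of a point under a linear isometry only products are
  known, so this is the test that the image comes from a point of \<open>H3\<close>.\<close>

lemma future_iff:
  assumes P: "lor P P = - 1" and b: "b \<in> H3"
  shows "P$3 > 0 \<longleftrightarrow> lor P (hyp b) < 0"
proof
  assume "P$3 > 0"
  then show "lor P (hyp b) < 0"
    using lor_hyp_le[OF unhyp_in_H3 b, of P] P by simp
next
  assume neg: "lor P (hyp b) < 0"
  have ne: "P$3 \<noteq> 0"
  proof
    assume "P$3 = 0"
    with P have "P$1 * P$1 + P$2 * P$2 = - 1" by (simp add: lor_def)
    then show False using zero_le_square[of "P$1"] zero_le_square[of "P$2"] by linarith
  qed
  show "P$3 > 0"
  proof (rule ccontr)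
    assume "\<not> P$3 > 0"
    with ne have "(- P)$3 > 0" by simp
    then show False
      using lor_hyp_le[OF unhyp_in_H3 b, of "- P"] P neg by simp
  qed
qed

text \<open>The form is positive definite on the complement of a timelike vector. Explicit Euclidean
  coordinates on this complement make the Cauchy-Schwarz inequality available there.\<close>

lemma orthogonal_Euclidean:
  assumes y: "y \<in> H3"
  obtains e :: "real^4 \<Rightarrow> real^3" where
    "\<And>P Q. lor P (hyp y) = 0 \<Longrightarrow> lor Q (hyp y) = 0 \<Longrightarrow> lor P Q = e P \<bullet> e Q"
proof
  fix P Q assume PQ: "lor P (hyp y) = 0" "lor Q (hyp y) = 0"
  define e where "e V = (vector [V$1 - V$3 * y$1, V$2 - V$3 * y$2, V$3 * y$3] :: real^3)" for V :: "real^4"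
  have eq: "V$4 = 2 * (V$1 * y$1 + V$2 * y$2) - V$3 * ((y$1)\<^sup>2 + (y$2)\<^sup>2 + (y$3)\<^sup>2)"
    if "lor V (hyp y) = 0" for V
    using that y by (simp add: lor_def hyp_nth H3_iff field_simps)
  show "lor P Q = (vector [P$1 - P$3 * y$1, P$2 - P$3 * y$2, P$3 * y$3] :: real^3)
     \<bullet> vector [Q$1 - Q$3 * y$1, Q$2 - Q$3 * y$2, Q$3 * y$3]"
    by (simp add: lor_def inner_vec_def sum_3 eq[OF PQ(1)] eq[OF PQ(2)])
       (simp add: field_simps power2_eq_square)
qed

text \<open>The components \<open>X\<close> and \<open>Z\<close> of the outer points orthogonal to
  the middle one have lengths \<open>sinh s\<close> and \<open>sinh t\<close>. Cauchy-Schwarz bounds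
  their product, and the addition formula for cosh turns this into the claim.\<close>

lemma H3_dist_triangle:
  assumes x: "x \<in> H3" and y: "y \<in> H3" and z: "z \<in> H3"
  shows "H3_dist x z \<le> H3_dist x y + H3_dist y z"
proof -
  obtain e :: "real^4 \<Rightarrow> real^3" where
    e: "\<And>P Q. lor P (hyp y) = 0 \<Longrightarrow> lor Q (hyp y) = 0 \<Longrightarrow> lor P Q = e P \<bullet> e Q"
    using orthogonal_Euclidean[OF y] by blast
  define s t where "s = H3_dist x y" and "t = H3_dist y z"
  have st: "s \<ge> 0" "t \<ge> 0" by (simp_all add: s_def t_def H3_dist_nonneg x y z)
  have cs: "cosh s = - lor (hyp x) (hyp y)" and ct: "cosh t = - lor (hyp z) (hyp y)"
    using cosh_H3_dist[OF x y] cosh_H3_dist[OF y z] by (simp_all add: s_def t_def lor_commute)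
  define X where "X = hyp x - cosh s *\<^sub>R hyp y"
  define Z where "Z = hyp z - cosh t *\<^sub>R hyp y"
  have X0: "lor X (hyp y) = 0" and Z0: "lor Z (hyp y) = 0"
    by (simp_all add: X_def Z_def cs ct lor_hyp_self y)
  have "lor X X = (cosh s)\<^sup>2 - 1" "lor Z Z = (cosh t)\<^sup>2 - 1"
    by (simp_all add: X_def Z_def cs ct lor_hyp_self x y z lor_commute[of "hyp y" "hyp x"]
        lor_commute[of "hyp y" "hyp z"] power2_eq_square algebra_simps)
  then have "norm (e X) = sinh s" "norm (e Z) = sinh t"
    using e[OF X0 X0] e[OF Z0 Z0] st
    by (simp_all add: norm_eq_sqrt_inner cosh_square_eq)
  then have "\<bar>lor X Z\<bar> \<le> sinh s * sinh t"
    using Cauchy_Schwarz_ineq2[of "e X" "e Z"] e[OF X0 Z0] by simp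
  moreover have "lor X Z = lor (hyp x) (hyp z) + cosh s * cosh t"
    by (simp add: X_def Z_def cs ct lor_hyp_self y lor_commute[of "hyp y" "hyp z"] algebra_simps)
  ultimately have "- lor (hyp x) (hyp z) \<le> cosh (s + t)"
    by (simp add: cosh_add)
  then have "cosh (H3_dist x z) \<le> cosh (s + t)"
    by (simp add: cosh_H3_dist x z)
  then show ?thesis
    using st H3_dist_nonneg[OF x z] by (simp add: cosh_real_nonneg_le_iff s_def t_def)
qed

text \<open>The geodesic is an arc of a hyperbola in the plane spanned by the endpoints. Its points
  are nonnegative combinations of the endpoints, the form in which convexity of tiles and sides of
  mirrors are used.\<close>

lemma H3_geodesic:
  assumes p: "p \<in> H3" and q: "q \<in> H3"
  defines "D \<equiv> H3_dist p q"
  obtains \<gamma> where "\<gamma> 0 = p" "\<gamma> D = q"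
    "\<And>s. s \<in> {0..D} \<Longrightarrow> \<gamma> s \<in> H3 \<and> (\<exists>a\<ge>0. \<exists>b\<ge>0. hyp (\<gamma> s) = a *\<^sub>R hyp p + b *\<^sub>R hyp q)"
    "\<And>s t. s \<in> {0..D} \<Longrightarrow> t \<in> {0..D} \<Longrightarrow> H3_dist (\<gamma> s) (\<gamma> t) = \<bar>s - t\<bar>"
    "continuous_on {0..D} (\<lambda>s. hyp (\<gamma> s))"
proof (cases "p = q")
  case True
  then have "D = 0" by (simp add: D_def q)
  show ?thesis
  proof (rule that[of "\<lambda>_. p"])
    show "p \<in> H3 \<and> (\<exists>a\<ge>0. \<exists>b\<ge>0. hyp p = a *\<^sub>R hyp p + b *\<^sub>R hyp q)" for s :: real
      using p by (intro conjI exI[of _ 1] exI[of _ 0]) auto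
  qed (auto simp: True \<open>D = 0\<close> q)
next
  case False
  then have D: "D > 0"
    using H3_dist_nonneg[OF p q] H3_dist_eq_0[OF p q] by (simp add: D_def)
  have cD: "lor (hyp p) (hyp q) = - cosh D"
    by (simp add: D_def cosh_H3_dist p q)
  \<comment> \<open>\<open>V\<close> is the unit tangent vector at \<open>p\<close> pointing towards
    \<open>q\<close>.\<close>
  define V where "V = (1 / sinh D) *\<^sub>R (hyp q - cosh D *\<^sub>R hyp p)"
  define P where "P s = cosh s *\<^sub>R hyp p + sinh s *\<^sub>R V" for s
  have pV: "lor (hyp p) V = 0"
    by (simp add: V_def cD lor_hyp_self p)
  have "sinh D > 0" using D by simp
  have VV: "lor V V = 1"
    using \<open>sinh D > 0\<close>
    by (simp add: V_def cD lor_hyp_self p q lor_commute[of "hyp q" "hyp p"] field_simps cosh_square_eq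
        flip: power2_eq_square)
  have PP: "lor (P s) (P t) = - cosh (s - t)" for s t
    by (simp add: P_def pV lor_commute[of V "hyp p"] VV lor_hyp_self p cosh_diff algebra_simps)
  \<comment> \<open>Over the endpoints the coefficients are visibly nonnegative for \<open>s\<close>
    between 0 and \<open>D\<close>.\<close>
  have Pab: "P s = (sinh (D - s) / sinh D) *\<^sub>R hyp p + (sinh s / sinh D) *\<^sub>R hyp q" for s
    using \<open>sinh D > 0\<close>
    by (simp add: P_def V_def vec4_eq_iff sinh_diff field_simps)
  have P3: "P s $ 3 > 0" if "s \<in> {0..D}" for s
  proof -
    have "sinh (D - s) / sinh D \<ge> 0" "sinh s / sinh D \<ge> 0"
      using that D by auto
    moreover have "sinh (D - s) / sinh D > 0 \<or> sinh s / sinh D > 0"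
      using that D by (cases "s = 0") auto
    moreover have "hyp p $ 3 > 0" "hyp q $ 3 > 0"
      using p q by (simp_all add: hyp_nth H3_iff)
    ultimately have "sinh (D - s) / sinh D * hyp p $ 3 + sinh s / sinh D * hyp q $ 3 > 0"
      by (metis add_nonneg_pos add_pos_nonneg mult_nonneg_nonneg mult_pos_pos order_less_imp_le)
    then show ?thesis
      unfolding Pab by simp
  qed
  have hP: "hyp (unhyp (P s)) = P s" "unhyp (P s) \<in> H3" if "s \<in> {0..D}" for s
    using P3[OF that] PP[of s s] by (auto simp: unhyp_in_H3)
  show ?thesis
  proof (rule that[of "\<lambda>s. unhyp (P s)"])
    show "unhyp (P 0) = p" by (simp add: P_def p)
    have "P D = hyp q" using \<open>sinh D > 0\<close> by (simp add: Pab)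
    then show "unhyp (P D) = q" by (simp add: q)
    show "unhyp (P s) \<in> H3 \<and> (\<exists>a\<ge>0. \<exists>b\<ge>0. hyp (unhyp (P s)) = a *\<^sub>R hyp p + b *\<^sub>R hyp q)"
      if "s \<in> {0..D}" for s
    proof -
      have "sinh (D - s) / sinh D \<ge> 0" "sinh s / sinh D \<ge> 0"
        using that D by auto
      then show ?thesis
        using hP[OF that] Pab[of s] by metis
    qed
    show "H3_dist (unhyp (P s)) (unhyp (P t)) = \<bar>s - t\<bar>" if "s \<in> {0..D}" "t \<in> {0..D}" for s t
      by (rule H3_dist_eqI) (use hP[OF that(1)] hP[OF that(2)] PP in auto)
    have "continuous_on {0..D} P"
      unfolding P_def by (intro continuous_intros)
    then show "continuous_on {0..D} (\<lambda>s. hyp (unhyp (P s)))"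
      by (rule continuous_on_eq) (simp add: hP)
  qed
qed

text \<open>The sign change along the geodesic forces a zero. That the two distances add up makes
  cutting a path at a mirror free of cost.\<close>

lemma H3_crossing:
  assumes p: "p \<in> H3" and q: "q \<in> H3" and n: "lor (hyp p) n * lor (hyp q) n < 0"
  obtains c where "c \<in> H3" "lor (hyp c) n = 0" "H3_dist p c + H3_dist c q = H3_dist p q"
    "\<exists>a\<ge>0. \<exists>b\<ge>0. hyp c = a *\<^sub>R hyp p + b *\<^sub>R hyp q"
proof -
  define D where "D = H3_dist p q"
  have D0: "D \<ge> 0" by (simp add: D_def H3_dist_nonneg p q)
  obtain \<gamma> where g: "\<gamma> 0 = p" "\<gamma> D = q"
    "\<And>s. s \<in> {0..D} \<Longrightarrow> \<gamma> s \<in> H3 \<and> (\<exists>a\<ge>0. \<exists>b\<ge>0. hyp (\<gamma> s) = a *\<^sub>R hyp p + b *\<^sub>R hyp q)"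
    "\<And>s t. s \<in> {0..D} \<Longrightarrow> t \<in> {0..D} \<Longrightarrow> H3_dist (\<gamma> s) (\<gamma> t) = \<bar>s - t\<bar>"
    "continuous_on {0..D} (\<lambda>s. hyp (\<gamma> s))"
    using H3_geodesic[OF p q] unfolding D_def by blast
  have cont: "continuous_on {0..D} (\<lambda>s. lor (hyp (\<gamma> s)) n)"
    unfolding lor_def by (intro continuous_intros g(5)) auto
  have "\<exists>s\<in>{0..D}. lor (hyp (\<gamma> s)) n = 0"
  proof (cases "lor (hyp p) n < 0")
    case True
    with n have "lor (hyp q) n > 0" by (simp add: mult_less_0_iff)
    then show ?thesis
      using IVT'[of "\<lambda>s. lor (hyp (\<gamma> s)) n" 0 0 D] True g D0 cont by force
  next
    case False
    with n have "lor (hyp p) n > 0" "lor (hyp q) n < 0" by (auto simp: mult_less_0_iff)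
    then show ?thesis
      using IVT2'[of "\<lambda>s. lor (hyp (\<gamma> s)) n" D 0 0] g D0 cont by force
  qed
  then obtain s where s: "s \<in> {0..D}" "lor (hyp (\<gamma> s)) n = 0" by blast
  show ?thesis
  proof (rule that[of "\<gamma> s"])
    show "H3_dist p (\<gamma> s) + H3_dist (\<gamma> s) q = H3_dist p q"
      using g(4)[of 0 s] g(4)[of s D] s D0 unfolding g(1,2) D_def[symmetric] by simp
  qed (use g(3)[OF s(1)] s in auto)
qed

text \<open>A segment whose ends lie on the same side of a mirror stays on that side, so cutting a
  segment never creates a new separating mirror.\<close>

lemma lor_combination_nonneg:
  assumes "lor P n * lor Q n \<ge> 0" "a \<ge> 0" "b \<ge> 0" "C = a *\<^sub>R P + b *\<^sub>R Q"
  shows "lor P n * lor C n \<ge> 0" "lor C n * lor Q n \<ge> 0"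
proof -
  have "lor P n * lor C n = a * (lor P n)\<^sup>2 + b * (lor P n * lor Q n)"
    "lor C n * lor Q n = a * (lor P n * lor Q n) + b * (lor Q n)\<^sup>2"
    by (simp_all add: assms(4) power2_eq_square algebra_simps)
  then show "lor P n * lor C n \<ge> 0" "lor C n * lor Q n \<ge> 0"
    using assms by simp_all
qed

section \<open>Comparison of hyperbolic and Euclidean balls\<close>

lemma H3_dist_less_iff:
  assumes "x \<in> H3" "y \<in> H3" "r \<ge> 0"
  shows "H3_dist x y < r \<longleftrightarrow> (dist x y)\<^sup>2 < 2 * x$3 * y$3 * (cosh r - 1)"
proof -
  have "H3_dist x y < r \<longleftrightarrow> 1 + (dist x y)\<^sup>2 / (2 * x$3 * y$3) < cosh r"
    using assms cosh_real_nonneg_less_iff[of "H3_dist x y" r]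
    by (simp add: H3_dist_nonneg cosh_H3_dist lor_hyp add.commute)
  also have "\<dots> \<longleftrightarrow> (dist x y)\<^sup>2 < 2 * x$3 * y$3 * (cosh r - 1)"
    using assms by (simp add: H3_iff field_simps)
  finally show ?thesis .
qed

lemma H3_dist_le_iff:
  assumes "x \<in> H3" "y \<in> H3" "r \<ge> 0"
  shows "H3_dist x y \<le> r \<longleftrightarrow> (dist x y)\<^sup>2 \<le> 2 * x$3 * y$3 * (cosh r - 1)"
proof -
  have "H3_dist x y \<le> r \<longleftrightarrow> 1 + (dist x y)\<^sup>2 / (2 * x$3 * y$3) \<le> cosh r"
    using assms cosh_real_nonneg_le_iff[of "H3_dist x y" r]
    by (simp add: H3_dist_nonneg cosh_H3_dist lor_hyp add.commute)
  also have "\<dots> \<longleftrightarrow> (dist x y)\<^sup>2 \<le> 2 * x$3 * y$3 * (cosh r - 1)"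
    using assms by (simp add: H3_iff field_simps)
  finally show ?thesis .
qed

lemma nth3_le_dist: "(y::real^3) $ i \<le> x $ i + dist x y"
  using component_le_norm_cart[of "y - x" i] by (simp add: dist_norm norm_minus_commute)

lemma H3_ball_small:
  assumes x: "x \<in> H3" and e: "\<epsilon> > 0"
  obtains r where "r > 0" "\<And>y. y \<in> H3 \<Longrightarrow> H3_dist x y < r \<Longrightarrow> dist x y < \<epsilon>"
proof -
  \<comment> \<open>\<open>C\<close> is cosh of the distance from \<open>x\<close> to the point
    vertically above it at Euclidean distance \<epsilon>, the point of the Euclidean sphere that is
    hyperbolically nearest to the centre.\<close>
  define C where "C = 1 + \<epsilon>\<^sup>2 / (2 * x$3 * (x$3 + \<epsilon>))"
  have x3: "x$3 > 0" using x by (simp add: H3_iff)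
  then have C: "C > 1" using e by (simp add: C_def)
  show ?thesis
  proof (rule that[of "arcosh C"])
    show "arcosh C > 0" using C by simp
    fix y assume y: "y \<in> H3" "H3_dist x y < arcosh C"
    define \<delta> where "\<delta> = dist x y"
    have d: "\<delta>\<^sup>2 < 2 * x$3 * y$3 * (C - 1)"
      using H3_dist_less_iff[OF x y(1), of "arcosh C"] y(2) C by (simp add: \<delta>_def)
    have "2 * x$3 * y$3 * (C - 1) = y$3 * (\<epsilon>\<^sup>2 / (x$3 + \<epsilon>))"
      using x3 e by (simp add: C_def divide_simps)
    also have "\<dots> \<le> (x$3 + \<delta>) * (\<epsilon>\<^sup>2 / (x$3 + \<epsilon>))"
      using x3 e nth3_le_dist[of y 3 x] by (intro mult_right_mono) (auto simp: \<delta>_def)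
    finally have "\<delta>\<^sup>2 < (x$3 + \<delta>) * \<epsilon>\<^sup>2 / (x$3 + \<epsilon>)"
      using d by simp
    then have *: "\<delta>\<^sup>2 * (x$3 + \<epsilon>) < (x$3 + \<delta>) * \<epsilon>\<^sup>2"
      using x3 e by (simp add: pos_less_divide_eq)
    show "dist x y < \<epsilon>"
    proof (rule ccontr)
      assume "\<not> dist x y < \<epsilon>"
      then have de: "\<delta> \<ge> \<epsilon>" by (simp add: \<delta>_def)
      have "\<epsilon>\<^sup>2 * x$3 \<le> \<delta>\<^sup>2 * x$3"
        using de e x3 by (intro mult_right_mono power_mono) auto
      moreover have "\<epsilon> * \<delta> * \<epsilon> \<le> \<epsilon> * \<delta> * \<delta>"
        using de e by (intro mult_left_mono) auto
      ultimately show False using * by (simp add: power2_eq_square algebra_simps)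
    qed
  qed
qed

lemma continuous_on_hyp: "continuous_on H3 hyp"
proof -
  have "continuous_on H3 (\<lambda>p. \<chi> i. hyp p $ i)"
  proof (rule continuous_on_vec_lambda)
    show "continuous_on H3 (\<lambda>p. hyp p $ i)" for i :: 4
      using exhaust_4[of i]
      by (elim disjE; hypsubst; simp only: hyp_nth; intro continuous_intros) (auto simp: H3_iff)
  qed
  then show ?thesis by simp
qed

lemma open_H3: "open H3"
  unfolding H3_def by (intro open_Collect_less continuous_intros)

lemma H3_ball_large:
  assumes x: "x \<in> H3" and r: "r > 0"
  obtains \<delta> where "\<delta> > 0" "\<And>y. dist x y < \<delta> \<Longrightarrow> y \<in> H3 \<and> H3_dist x y < r"
proof -
  define S where "S = {y. y$3 > 0} \<inter> {y. (dist x y)\<^sup>2 < 2 * x$3 * y$3 * (cosh r - 1)}"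
  have "open S"
    unfolding S_def by (intro open_Int open_Collect_less continuous_intros)
  moreover have "x \<in> S"
    using x r H3_dist_less_iff[OF x x, of r] by (simp add: S_def H3_iff)
  ultimately obtain \<delta> where "\<delta> > 0" "ball x \<delta> \<subseteq> S"
    using open_contains_ball by blast
  then show ?thesis
    using that[of \<delta>] x r H3_dist_less_iff[OF x, of _ r] by (auto simp: S_def H3_iff subset_iff)
qed

text \<open>Hyperbolic space is proper; completeness of the tiled space will be drawn from
  this.\<close>

lemma compact_H3_cball:
  assumes x: "x \<in> H3"
  shows "compact {y \<in> H3. H3_dist x y \<le> R}"
proof (cases "R \<ge> 0")
  case False
  then have "{y \<in> H3. H3_dist x y \<le> R} = {}"
    using H3_dist_nonneg[OF x] by force
  then show ?thesis using compact_empty by metis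
next
  case True
  define C where "C = cosh R"
  define k where "k = 2 * x$3 * (C - 1)"
  have x3: "x$3 > 0" using x by (simp add: H3_iff)
  have C: "C \<ge> 1" by (simp add: C_def cosh_real_ge_1)
  have k: "k \<ge> 0" using x3 C by (simp add: k_def)
  \<comment> \<open>The height bound, obtained by comparing third coordinates alone, places the
    right-hand set inside \<open>H3\<close>, where it is given by closed conditions on the whole
    Euclidean space.\<close>
  have eq: "{y \<in> H3. H3_dist x y \<le> R} = {y. x$3 / (2 * C) \<le> y$3 \<and> (dist x y)\<^sup>2 \<le> 2 * x$3 * y$3 * (C - 1)}"
    (is "?A = ?B")
  proof
    show "?A \<subseteq> ?B"
    proof
      fix y assume "y \<in> ?A"
      then have y: "y \<in> H3" "(dist x y)\<^sup>2 \<le> 2 * x$3 * y$3 * (C - 1)" "y$3 > 0"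
        using H3_dist_le_iff[OF x _ True] by (auto simp: C_def H3_iff)
      have "(x$3 - y$3)\<^sup>2 \<le> (dist x y)\<^sup>2" by (simp add: dist_vec3)
      with y have "(x$3 - y$3)\<^sup>2 \<le> 2 * x$3 * y$3 * (C - 1)" by linarith
      then have "(x$3)\<^sup>2 + (y$3)\<^sup>2 \<le> x$3 * (2 * y$3 * C)"
        by (simp add: power2_eq_square algebra_simps)
      then have "x$3 * x$3 \<le> x$3 * (2 * y$3 * C)"
        using zero_le_power2[of "y$3"] unfolding power2_eq_square by linarith
      then have "x$3 \<le> 2 * y$3 * C" using x3 by simp
      then show "y \<in> ?B" using y C by (simp add: field_simps)
    qed
    show "?B \<subseteq> ?A"
    proof
      fix y assume y: "y \<in> ?B"
      have "x$3 / (2 * C) > 0" using x3 C by simp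
      with y have "y \<in> H3" by (auto simp: H3_iff)
      then show "y \<in> ?A" using y H3_dist_le_iff[OF x _ True] by (auto simp: C_def)
    qed
  qed
  have "closed ?B"
    by (intro closed_Collect_conj closed_Collect_le continuous_intros)
  \<comment> \<open>The squared distance is at most \<open>k * (x$3 + dist x y)\<close>, which fails
    once the distance exceeds \<open>k + x$3\<close>.\<close>
  moreover have "?B \<subseteq> cball x (k + x$3)"
  proof
    fix y assume y: "y \<in> ?B"
    have "2 * x$3 * y$3 * (C - 1) = k * y$3" by (simp add: k_def)
    also have "\<dots> \<le> k * (x$3 + dist x y)"
      using k nth3_le_dist[of y 3 x] by (intro mult_left_mono) auto
    finally have *: "(dist x y)\<^sup>2 \<le> k * (x$3 + dist x y)" using y by simp
    show "y \<in> cball x (k + x$3)"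
    proof (rule ccontr)
      assume "y \<notin> cball x (k + x$3)"
      then have gt: "dist x y > k + x$3" by simp
      have "(k + x$3) * dist x y < dist x y * dist x y"
        using gt k x3 by (intro mult_strict_right_mono) auto
      moreover have "x$3 * k \<le> x$3 * dist x y"
        using gt x3 k by (intro mult_left_mono) auto
      ultimately show False
        using * by (simp add: power2_eq_square algebra_simps)
    qed
  qed
  ultimately show ?thesis
    unfolding eq using bounded_cball bounded_subset compact_eq_bounded_closed by blast
qed

section \<open>Isometries preserve hyperbolic volume\<close>

lemma lorentz_linear_inj:
  assumes A: "linear A" and pres: "\<And>P Q. lor (A P) (A Q) = lor P Q"
  shows "inj A"
proof -
  have "P = 0" if "A P = 0" for P
  proof (rule lor_nondegenerate)
    show "lor P Q = 0" for Q using pres[of P Q] that by simp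
  qed
  then show ?thesis using A linear_injective_0 by blast
qed

lemma linear_lor: "linear (\<lambda>P. lor P Q)" "linear (\<lambda>P. lor Q P)"
  by (simp_all add: linear_iff)

lemma lorentz_extension:
  assumes E: "E \<subseteq> H3" and \<psi>: "\<psi> ` E \<subseteq> H3"
    and iso: "\<And>x y. x \<in> E \<Longrightarrow> y \<in> E \<Longrightarrow> H3_dist (\<psi> x) (\<psi> y) = H3_dist x y"
    and span: "span (hyp ` E) = UNIV"
  obtains A where "linear A" "\<And>P Q. lor (A P) (A Q) = lor P Q" "\<And>x. x \<in> E \<Longrightarrow> A (hyp x) = hyp (\<psi> x)"
proof -
  obtain B where B: "B \<subseteq> hyp ` E" "independent B" "span B = UNIV"
    using maximal_independent_subset[of "hyp ` E"] span by (metis span_minimal subspace_span top.extremum_uniqueI)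
  define f where "f P = hyp (\<psi> (unhyp P))" for P
  obtain A where A: "linear A" "\<And>b. b \<in> B \<Longrightarrow> A b = f b"
    using linear_independent_extend[OF B(2)] by metis
  have isoL: "lor (hyp (\<psi> x)) (hyp (\<psi> y)) = lor (hyp x) (hyp y)" if "x \<in> E" "y \<in> E" for x y
    using iso[OF that] H3_dist_eq_iff[of "\<psi> x" "\<psi> y" x y] that E \<psi> by auto
  have fE: "f (hyp x) = hyp (\<psi> x)" if "x \<in> E" for x
    using that E by (auto simp: f_def)
  have BB: "lor (A b) (A b') = lor b b'" if bb: "b \<in> B" "b' \<in> B" for b b'
  proof -
    obtain y y' where "y \<in> E" "b = hyp y" "y' \<in> E" "b' = hyp y'" using bb B(1) by blast
    then show ?thesis using A(2)[OF bb(1)] A(2)[OF bb(2)] fE isoL by simp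
  qed
  have PB: "lor (A P) (A b) = lor P b" if "b \<in> B" for P b
  proof (rule linear_eq_on_span[where B = B and f = "\<lambda>P. lor (A P) (A b)" and g = "\<lambda>P. lor P b"])
    show "linear (\<lambda>P. lor (A P) (A b))"
      using linear_compose[OF A(1) linear_lor(1)[of "A b"]] by (simp add: o_def)
  qed (use BB that B linear_lor in auto)
  have PP: "lor (A P) (A Q) = lor P Q" for P Q
  proof (rule linear_eq_on_span[where B = B and f = "\<lambda>Q. lor (A P) (A Q)" and g = "\<lambda>Q. lor P Q"])
    show "linear (\<lambda>Q. lor (A P) (A Q))"
      using linear_compose[OF A(1) linear_lor(2)[of "A P"]] by (simp add: o_def)
  qed (use PB B linear_lor in auto)
  have surjA: "surj A"
    using linear_injective_imp_surjective[OF A(1) lorentz_linear_inj[OF A(1) PP]] by simp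
  have "A (hyp x) = hyp (\<psi> x)" if x: "x \<in> E" for x
  proof -
    define V where "V = A (hyp x) - hyp (\<psi> x)"
    have VB: "lor V (A b) = 0" if b: "b \<in> B" for b
    proof -
      obtain y where y: "y \<in> E" "b = hyp y" using b B(1) by auto
      have Ab: "A b = hyp (\<psi> y)" using A(2)[OF b] fE[OF y(1)] y(2) by simp
      have "lor V (A b) = lor (A (hyp x)) (A (hyp y)) - lor (hyp (\<psi> x)) (hyp (\<psi> y))"
        unfolding V_def lor_simps y(2)[symmetric] Ab by simp
      then show ?thesis using isoL[OF x y(1)] PP by simp
    qed
    have "lor V (A P) = 0" for P
    proof (rule linear_eq_on_span[where B = B and f = "\<lambda>P. lor V (A P)" and g = "\<lambda>P. 0"])
      show "linear (\<lambda>P. lor V (A P))"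
        using linear_compose[OF A(1) linear_lor(2)[of V]] by (simp add: o_def)
    qed (use VB B in \<open>auto simp: linear_iff\<close>)
    then have "V = 0"
      using surjA by (intro lor_nondegenerate) (metis surjD)
    then show ?thesis by (simp add: V_def)
  qed
  then show ?thesis using that A(1) PP by blast
qed

lemma inj_on_H3_isometry:
  assumes E: "E \<subseteq> H3" and \<psi>: "\<psi> ` E \<subseteq> H3"
    and iso: "\<And>x y. x \<in> E \<Longrightarrow> y \<in> E \<Longrightarrow> H3_dist (\<psi> x) (\<psi> y) = H3_dist x y"
  shows "inj_on \<psi> E"
proof
  fix x y assume xy: "x \<in> E" "y \<in> E" "\<psi> x = \<psi> y"
  then have "H3_dist x y = 0" using iso[OF xy(1,2)] \<psi> by auto
  then show "x = y" using xy E H3_dist_eq_0 by auto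
qed

text \<open>If the image spanned, the inverse isometry would extend to a surjective linear map
  carrying the span of the image onto the span of the original set.\<close>

lemma isometry_not_spanning:
  assumes E: "E \<subseteq> H3" and \<psi>: "\<psi> ` E \<subseteq> H3"
    and iso: "\<And>x y. x \<in> E \<Longrightarrow> y \<in> E \<Longrightarrow> H3_dist (\<psi> x) (\<psi> y) = H3_dist x y"
    and span: "span (hyp ` E) \<noteq> UNIV"
  shows "span (hyp ` \<psi> ` E) \<noteq> UNIV"
proof
  assume UN: "span (hyp ` \<psi> ` E) = UNIV"
  have inj: "inj_on \<psi> E"
    using inj_on_H3_isometry[OF E \<psi> iso] .
  define \<theta> where "\<theta> = inv_into E \<psi>"
  have \<theta>: "\<theta> (\<psi> x) = x" if "x \<in> E" for x
    using that inj by (simp add: \<theta>_def)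
  obtain A where A: "linear A" "\<And>P Q. lor (A P) (A Q) = lor P Q"
      "\<And>x. x \<in> \<psi> ` E \<Longrightarrow> A (hyp x) = hyp (\<theta> x)"
    by (rule lorentz_extension[OF \<psi> _ _ UN, of \<theta>]) (use E \<theta> iso in auto)
  have surjA: "surj A"
    using linear_injective_imp_surjective[OF A(1) lorentz_linear_inj[OF A(1,2)]] by simp
  have "hyp ` E = A ` hyp ` \<psi> ` E"
    using A(3) \<theta> by (force simp: image_image)
  then have "span (hyp ` E) = A ` UNIV"
    using linear_span_image[OF A(1)] UN by simp
  then show False using span surjA by simp
qed

section \<open>Hyperbolic volume as an integral, and its null sets\<close>

lemma emeasure_H3_volume_nn_integral:
  assumes "A \<in> sets borel"
  shows "emeasure H3_volume A = (\<integral>\<^sup>+ x. ennreal (indicator H3 x / (x $ 3) ^ 3) * indicator A x \<partial>lborel)"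
  unfolding H3_volume_def using assms open_H3 by (subst emeasure_density) auto

text \<open>The change of variables speaks of absolute integrability and the gauge integral; sets of
  infinite volume fall under the second case.\<close>

lemma emeasure_H3_volume:
  assumes "E \<in> sets borel" "E \<subseteq> H3"
  shows "emeasure H3_volume E =
    (if (\<lambda>x. 1 / (x$3)^3) absolutely_integrable_on E then ennreal (integral E (\<lambda>x. 1 / (x$3)^3)) else \<infinity>)"
proof -
  define w where "w x = indicator E x *\<^sub>R (1 / (x$3)^3)" for x :: "real^3"
  have [measurable]: "E \<in> sets borel" by fact
  have [measurable]: "w \<in> borel_measurable borel"
    unfolding w_def by measurable
  have w0: "w x \<ge> 0" for x
    using assms(2) by (auto simp: w_def indicator_def H3_def)
  have [measurable]: "H3 \<in> sets borel" using open_H3 by simp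
  have "emeasure H3_volume E = (\<integral>\<^sup>+ x. ennreal (indicator H3 x / (x $ 3) ^ 3) * indicator E x \<partial>lborel)"
    by (rule emeasure_H3_volume_nn_integral[OF assms(1)])
  also have "\<dots> = (\<integral>\<^sup>+ x. ennreal (w x) \<partial>lborel)"
    using assms(2) by (intro nn_integral_cong) (auto simp: w_def indicator_def)
  finally have eq: "emeasure H3_volume E = (\<integral>\<^sup>+ x. ennreal (w x) \<partial>lborel)" .
  have ab: "(\<lambda>x. 1 / (x$3)^3) absolutely_integrable_on E \<longleftrightarrow> integrable lborel w"
    unfolding set_integrable_def w_def[symmetric] by (subst integrable_completion) auto
  show ?thesis
  proof (cases "integrable lborel w")
    case True
    have "integral E (\<lambda>x. 1 / (x$3)^3) = integral\<^sup>L lebesgue w"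
      using set_lebesgue_integral_eq_integral(2)[of E "\<lambda>x. 1 / (x$3)^3"] True
      unfolding ab[symmetric] by (simp add: set_lebesgue_integral_def w_def[abs_def])
    also have "\<dots> = integral\<^sup>L lborel w"
      by (rule integral_completion) simp
    finally show ?thesis
      using True ab eq nn_integral_eq_integral[OF True] w0 by simp
  next
    case False
    then have "(\<integral>\<^sup>+ x. ennreal (w x) \<partial>lborel) = \<infinity>"
      using w0 by (auto simp: integrable_iff_bounded simp flip: top.not_eq_extremum)
    then show ?thesis using False ab eq by simp
  qed
qed

text \<open>A set that does not span lies in a linear hyperplane of Minkowski space, and in the
  half-space this is a Euclidean plane or sphere.\<close>

lemma H3_volume_not_spanning:
  assumes E: "E \<subseteq> H3" and span: "span (hyp ` E) \<noteq> UNIV" and [measurable]: "E \<in> sets borel"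
  shows "emeasure H3_volume E = 0"
proof -
  obtain a where a: "a \<noteq> 0" "\<And>x. x \<in> E \<Longrightarrow> a \<bullet> hyp x = 0"
    using span_not_UNIV_orthogonal[OF span] by (auto simp: span_base)
  have eq: "a$1 * x$1 + a$2 * x$2 + a$3 + a$4 * ((x$1)\<^sup>2 + (x$2)\<^sup>2 + (x$3)\<^sup>2) = 0" if "x \<in> E" for x
  proof -
    have "x$3 > 0" using that E by (auto simp: H3_def)
    moreover have "a \<bullet> hyp x = (a$1 * x$1 + a$2 * x$2 + a$3 + a$4 * ((x$1)\<^sup>2 + (x$2)\<^sup>2 + (x$3)\<^sup>2)) / x$3"
      by (simp add: inner_vec_def sum_4 hyp_nth add_divide_distrib distrib_left)
    ultimately show ?thesis using a(2)[OF that] by simp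
  qed
  have "negligible E"
  proof (cases "a$4 = 0")
    case True
    define b :: "real^3" where "b = vector [a$1, a$2, 0]"
    have "E \<subseteq> {x. b \<bullet> x = - a$3}"
      using eq True by (auto simp: b_def inner_vec_def sum_3) (smt (verit))
    moreover have "b \<noteq> 0 \<or> - a$3 \<noteq> 0"
      using a(1) True by (auto simp: b_def vec4_eq_iff vec3_eq_iff)
    ultimately show ?thesis using negligible_hyperplane negligible_subset by blast
  next
    case False
    \<comment> \<open>Centre and squared radius come from completing the square in the equation of
      the hyperplane.\<close>
    define c :: "real^3" where "c = vector [- a$1 / (2 * a$4), - a$2 / (2 * a$4), 0]"
    define \<rho> where "\<rho> = ((a$1)\<^sup>2 + (a$2)\<^sup>2) / (4 * (a$4)\<^sup>2) - a$3 / a$4"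
    have "E \<subseteq> sphere c (sqrt \<rho>)"
    proof
      fix x assume "x \<in> E"
      have "(dist c x)\<^sup>2 = \<rho>"
        using eq[OF \<open>x \<in> E\<close>] False unfolding dist_vec3
        by (simp add: c_def \<rho>_def field_simps power2_eq_square) algebra
      then show "x \<in> sphere c (sqrt \<rho>)" by (auto simp: real_sqrt_unique)
    qed
    then show ?thesis using negligible_sphere negligible_subset by blast
  qed
  then have "E \<in> null_sets lborel"
    using assms(3) by (simp add: negligible_iff_null_sets null_sets_completion_iff)
  then have "AE x in lborel. x \<notin> E"
    by (rule AE_not_in)
  then have "(\<integral>\<^sup>+ x. ennreal (indicator H3 x / (x $ 3) ^ 3) * indicator E x \<partial>lborel) = 0"
    by (subst nn_integral_0_iff_AE) (auto simp: open_H3 elim!: eventually_mono)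
  then show ?thesis
    by (simp only: emeasure_H3_volume_nn_integral[OF assms(3)])
qed

section \<open>Change of variables for Lorentz maps\<close>

lemma differentiable_hyp: "x \<in> H3 \<Longrightarrow> hyp differentiable (at x)"
proof -
  assume x: "x \<in> H3"
  have eq: "hyp = (\<lambda>x. (1 / x$3) *\<^sub>R (x$1 *\<^sub>R axis 1 1 + x$2 *\<^sub>R axis 2 1 + axis 3 1
      + ((x$1)\<^sup>2 + (x$2)\<^sup>2 + (x$3)\<^sup>2) *\<^sub>R axis 4 1))"
    by (rule ext) (simp add: vec4_eq_iff hyp_nth axis_def)
  have nth: "(\<lambda>x. x $ i) differentiable (at x)" for i
    by (intro bounded_linear_imp_differentiable bounded_linear_vec_nth)
  show ?thesis
    unfolding eq using x by (intro derivative_intros nth) (auto simp: H3_def)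
qed

lemma differentiable_unhyp: "P$3 \<noteq> 0 \<Longrightarrow> unhyp differentiable (at P)"
proof -
  assume P: "P$3 \<noteq> 0"
  have eq: "unhyp = (\<lambda>P. (1 / P$3) *\<^sub>R (P$1 *\<^sub>R axis 1 1 + P$2 *\<^sub>R axis 2 1 + axis 3 1))"
    by (rule ext) (simp add: vec3_eq_iff unhyp_def axis_def)
  have nth: "(\<lambda>x. x $ i) differentiable (at P)" for i
    by (intro bounded_linear_imp_differentiable bounded_linear_vec_nth)
  show ?thesis
    unfolding eq using P by (intro derivative_intros nth) auto
qed

text \<open>The hyperbolic metric is the Euclidean one divided by the height. Along the line through
  \<open>x\<close> in direction \<open>h\<close>, equality of distances is an exact identity between
  the squared norm of a difference quotient and a quotient of heights; the claim is its limit at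
  0.\<close>

lemma isometry_conformal:
  assumes \<psi>: "\<And>x. x \<in> H3 \<Longrightarrow> \<psi> x \<in> H3" and x: "x \<in> H3"
    and iso: "\<And>x y. x \<in> H3 \<Longrightarrow> y \<in> H3 \<Longrightarrow> H3_dist (\<psi> x) (\<psi> y) = H3_dist x y"
    and der: "(\<psi> has_derivative D) (at x)"
  shows "norm (D h) = \<psi> x $ 3 / x$3 * norm h"
proof -
  define g where "g t = x + t *\<^sub>R h" for t :: real
  have der1: "(g has_derivative (\<lambda>t. t *\<^sub>R h)) (at 0)"
    unfolding g_def by (auto intro!: derivative_eq_intros)
  have "((\<lambda>t. \<psi> (g t)) has_derivative (\<lambda>t. D (t *\<^sub>R h))) (at 0)"
    using has_derivative_compose[OF der1, of \<psi> D] der by (simp add: g_def)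
  then have "((\<lambda>t. (\<psi> (g t) - \<psi> x - t *\<^sub>R D h) /\<^sub>R norm t) \<longlongrightarrow> 0) (at 0)"
    using has_derivative_linear[OF der]
    by (simp add: has_derivative_at_within linear_cmul g_def)
  then have "((\<lambda>t. norm ((\<psi> (g t) - \<psi> x - t *\<^sub>R D h) /\<^sub>R norm t)) \<longlongrightarrow> 0) (at 0)"
    by (rule tendsto_norm_zero)
  moreover have "norm ((\<psi> (g t) - \<psi> x - t *\<^sub>R D h) /\<^sub>R norm t) = norm ((\<psi> (g t) - \<psi> x) /\<^sub>R t - D h)"
    if "t \<noteq> 0" for t
  proof -
    have "(\<psi> (g t) - \<psi> x) /\<^sub>R t - D h = (\<psi> (g t) - \<psi> x - t *\<^sub>R D h) /\<^sub>R t"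
      using that by (simp add: algebra_simps)
    then show ?thesis by simp
  qed
  ultimately have "((\<lambda>t. norm ((\<psi> (g t) - \<psi> x) /\<^sub>R t - D h)) \<longlongrightarrow> 0) (at 0)"
    by (elim Lim_transform_eventually) (auto simp: eventually_at_filter)
  then have lim: "((\<lambda>t. (\<psi> (g t) - \<psi> x) /\<^sub>R t) \<longlongrightarrow> D h) (at 0)"
    by (subst Lim_null) (rule tendsto_norm_zero_cancel)
  have cont: "isCont \<psi> x" using der has_derivative_continuous by blast
  have gc: "(g \<longlongrightarrow> x) (at 0)" unfolding g_def by (auto intro!: tendsto_eq_intros)
  have \<psi>gc: "((\<lambda>t. \<psi> (g t)) \<longlongrightarrow> \<psi> x) (at 0)"
    by (rule isCont_tendsto_compose[OF cont gc])
  have x3: "x$3 > 0" "\<psi> x $ 3 > 0" using x \<psi>[OF x] by (auto simp: H3_def)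
  have lim2: "((\<lambda>t. (norm h)\<^sup>2 * (\<psi> x $ 3 * \<psi> (g t) $ 3) / (x$3 * g t $ 3)) \<longlongrightarrow>
      (norm h)\<^sup>2 * (\<psi> x $ 3 * \<psi> x $ 3) / (x$3 * x$3)) (at 0)"
    by (intro tendsto_intros gc \<psi>gc) (use x3 in auto)
  have "\<forall>\<^sub>F t in at 0. g t \<in> H3"
    using gc open_H3 x topological_tendstoD by blast
  moreover have "\<forall>\<^sub>F t in at 0. t \<noteq> (0::real)"
    by (simp add: eventually_at_filter)
  ultimately have ev: "\<forall>\<^sub>F t in at 0. (norm ((\<psi> (g t) - \<psi> x) /\<^sub>R t))\<^sup>2
      = (norm h)\<^sup>2 * (\<psi> x $ 3 * \<psi> (g t) $ 3) / (x$3 * g t $ 3)"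
  proof eventually_elim
    case (elim t)
    have "(dist (\<psi> x) (\<psi> (g t)))\<^sup>2 / (2 * \<psi> x $ 3 * \<psi> (g t) $ 3) = (dist x (g t))\<^sup>2 / (2 * x$3 * g t $ 3)"
      using iso[OF x elim(1)] H3_dist_eq_iff[OF \<psi>[OF x] \<psi>[OF elim(1)] x elim(1)]
        lor_hyp[OF \<psi>[OF x] \<psi>[OF elim(1)]] lor_hyp[OF x elim(1)] by simp
    moreover have pos: "g t $ 3 > 0" "\<psi> (g t) $ 3 > 0" using elim \<psi> by (auto simp: H3_def)
    moreover have "(dist x (g t))\<^sup>2 = t\<^sup>2 * (norm h)\<^sup>2" by (simp add: g_def dist_norm power_mult_distrib)
    ultimately have "(dist (\<psi> x) (\<psi> (g t)))\<^sup>2 = t\<^sup>2 * ((norm h)\<^sup>2 * (\<psi> x $ 3 * \<psi> (g t) $ 3) / (x$3 * g t $ 3))"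
      using x3 by (simp add: field_simps)
    moreover have "norm ((\<psi> (g t) - \<psi> x) /\<^sub>R t) = dist (\<psi> x) (\<psi> (g t)) / \<bar>t\<bar>"
      by (simp add: dist_norm norm_minus_commute divide_inverse mult.commute)
    ultimately show ?case
      using elim by (simp add: power_divide)
  qed
  have "(norm (D h))\<^sup>2 = (norm h)\<^sup>2 * (\<psi> x $ 3 * \<psi> x $ 3) / (x$3 * x$3)"
  proof (rule tendsto_unique[OF _ _ lim2])
    show "((\<lambda>t. (norm h)\<^sup>2 * (\<psi> x $ 3 * \<psi> (g t) $ 3) / (x$3 * g t $ 3)) \<longlongrightarrow> (norm (D h))\<^sup>2) (at 0)"
      using Lim_transform_eventually[OF tendsto_power[OF tendsto_norm[OF lim]] ev] .
  qed auto
  then have "(norm (D h))\<^sup>2 = (\<psi> x $ 3 / x$3 * norm h)\<^sup>2"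
    by (simp add: power2_eq_square)
  then show ?thesis using x3 by (simp add: power2_eq_iff_nonneg)
qed

lemma det_conformal:
  fixes D :: "real^3 \<Rightarrow> real^3"
  assumes D: "linear D" and c: "c > 0" and conf: "\<And>h. norm (D h) = c * norm h"
  shows "\<bar>det (matrix D)\<bar> = c ^ 3"
proof -
  define f where "f h = (1 / c) *\<^sub>R D h" for h
  have lf: "linear f" unfolding f_def using D by (simp add: linear_compose_scale_right)
  have of: "orthogonal_transformation f"
    unfolding orthogonal_transformation using lf conf c by (auto simp: f_def)
  have "D = (*\<^sub>R) c \<circ> f" using c by (auto simp: f_def)
  then have "matrix D = matrix ((*\<^sub>R) c) ** matrix f"
    using matrix_compose[OF lf, of "(*\<^sub>R) c"] by (simp add: linear_scale_self)
  then have "\<bar>det (matrix D)\<bar> = \<bar>c ^ 3\<bar> * \<bar>det (matrix f)\<bar>"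
    by (simp only: det_mul det_matrix_scaleR) (simp add: abs_mult)
  moreover have "\<bar>det (matrix f)\<bar> = 1"
    using det_orthogonal_matrix[of "matrix f"] of orthogonal_transformation_matrix by fastforce
  ultimately show ?thesis using c by simp
qed

text \<open>The Jacobian determinant is the cube of the ratio of heights and cancels against the
  density.\<close>

lemma H3_volume_lorentz:
  assumes A: "linear A" and pres: "\<And>P Q. lor (A P) (A Q) = lor P Q"
    and fut: "e \<in> H3" "A (hyp e) $ 3 > 0"
    and E: "E \<in> sets borel" "E \<subseteq> H3" and E': "(\<lambda>x. unhyp (A (hyp x))) ` E \<in> sets borel"
  shows "emeasure H3_volume ((\<lambda>x. unhyp (A (hyp x))) ` E) = emeasure H3_volume E"
proof -
  define \<psi> where "\<psi> x = unhyp (A (hyp x))" for x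
  \<comment> \<open>Products are preserved, so the single point \<open>e\<close> sent to the upper
    sheet decides the sheet for all points.\<close>
  have A3: "A (hyp x) $ 3 > 0" if "x \<in> H3" for x
  proof -
    have 1: "lor (A (hyp x)) (A (hyp x)) = - 1" "lor (A (hyp e)) (A (hyp e)) = - 1"
      using that fut(1) by (simp_all add: pres lor_hyp_self)
    have "lor (A (hyp x)) (hyp (unhyp (A (hyp e)))) < 0"
      using hyp_unhyp[OF 1(2) fut(2)] lor_hyp_le[OF that fut(1)] by (simp add: pres)
    then show ?thesis
      using future_iff[OF 1(1) unhyp_in_H3[OF fut(2)]] by simp
  qed
  have hyp\<psi>: "hyp (\<psi> x) = A (hyp x)" if "x \<in> H3" for x
    unfolding \<psi>_def using A3[OF that] that by (simp add: pres lor_hyp_self)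
  have \<psi>H: "\<psi> x \<in> H3" if "x \<in> H3" for x
    using A3[OF that] by (simp add: \<psi>_def unhyp_in_H3)
  have iso: "H3_dist (\<psi> x) (\<psi> y) = H3_dist x y" if "x \<in> H3" "y \<in> H3" for x y
    using that \<psi>H hyp\<psi> pres by (simp add: H3_dist_eq_iff)
  have inj: "inj_on \<psi> E"
    by (rule inj_on_H3_isometry[OF E(2)]) (use iso \<psi>H E(2) in auto)
  have diff: "\<psi> differentiable (at x)" if "x \<in> H3" for x
  proof -
    have "(\<lambda>x. A (hyp x)) differentiable (at x)"
      using differentiable_compose[of A hyp x UNIV] differentiable_hyp[OF that]
        linear_imp_differentiable[OF A] by simp
    moreover have "unhyp differentiable (at (A (hyp x)))"
      using differentiable_unhyp A3[OF that] by simp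
    ultimately show ?thesis
      unfolding \<psi>_def[abs_def] by (rule differentiable_compose[of unhyp "\<lambda>x. A (hyp x)" x UNIV, rotated])
  qed
  define D where "D x = frechet_derivative \<psi> (at x)" for x
  have D: "(\<psi> has_derivative D x) (at x)" if "x \<in> H3" for x
    using diff[OF that] by (simp add: D_def frechet_derivative_works)
  have det: "\<bar>det (matrix (D x))\<bar> = (\<psi> x $ 3 / x$3) ^ 3" if "x \<in> H3" for x
  proof (rule det_conformal)
    show "linear (D x)" using D[OF that] has_derivative_linear by blast
    show "\<psi> x $ 3 / x$3 > 0" using that \<psi>H by (simp add: H3_def)
    show "norm (D x h) = \<psi> x $ 3 / x$3 * norm h" for h
      using isometry_conformal[OF \<psi>H that iso D[OF that]] .
  qed
  define w where "w x = 1 / (x$3)^3" for x :: "real^3"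
  \<comment> \<open>The density with values in \<open>real^1\<close>, because the change of
    variables takes vector-valued integrands.\<close>
  define f where "f x = (vec (w x) :: real^1)" for x
  have cv: "\<bar>det (matrix (D x))\<bar> *\<^sub>R f (\<psi> x) = f x" if "x \<in> E" for x
  proof -
    have "x$3 > 0" "\<psi> x $ 3 > 0" using that E(2) \<psi>H by (auto simp: H3_def)
    moreover have "x \<in> H3" using that E(2) by blast
    ultimately show ?thesis by (simp add: det f_def w_def vec_eq_iff power_divide)
  qed
  have ch: "(f absolutely_integrable_on E \<and> integral E f = b) \<longleftrightarrow>
      (f absolutely_integrable_on \<psi> ` E \<and> integral (\<psi> ` E) f = b)" for b
  proof -
    have "(\<lambda>x. \<bar>det (matrix (D x))\<bar> *\<^sub>R f (\<psi> x)) absolutely_integrable_on E \<longleftrightarrow> f absolutely_integrable_on E"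
      using cv unfolding set_integrable_def by (intro Bochner_Integration.integrable_cong) (auto simp: indicator_def)
    moreover have "integral E (\<lambda>x. \<bar>det (matrix (D x))\<bar> *\<^sub>R f (\<psi> x)) = integral E f"
      by (intro Henstock_Kurzweil_Integration.integral_cong) (simp add: cv)
    moreover have "(\<lambda>x. \<bar>det (matrix (D x))\<bar> *\<^sub>R f (\<psi> x)) absolutely_integrable_on E \<and>
        integral E (\<lambda>x. \<bar>det (matrix (D x))\<bar> *\<^sub>R f (\<psi> x)) = b
        \<longleftrightarrow> f absolutely_integrable_on \<psi> ` E \<and> integral (\<psi> ` E) f = b"
    proof (rule has_absolute_integral_change_of_variables[OF _ _ inj])
      show "E \<in> sets lebesgue" using E(1) by simp
      show "(\<psi> has_derivative D x) (at x within E)" if "x \<in> E" for x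
        using D that E(2) by (meson has_derivative_at_withinI subset_iff)
    qed
    ultimately show ?thesis by simp
  qed
  have f1: "f absolutely_integrable_on S \<longleftrightarrow> w absolutely_integrable_on S"
    "f absolutely_integrable_on S \<Longrightarrow> integral S f = vec (integral S w)" for S
  proof -
    show *: "f absolutely_integrable_on S \<longleftrightarrow> w absolutely_integrable_on S"
      unfolding f_def absolutely_integrable_on_1_iff by simp
    assume "f absolutely_integrable_on S"
    then have "f integrable_on S" using absolutely_integrable_on_def by blast
    then show "integral S f = vec (integral S w)"
      by (simp add: integral_on_1_eq f_def)
  qed
  have "\<psi> ` E \<subseteq> H3" using \<psi>H E(2) by blast
  moreover have "\<psi> ` E \<in> sets borel" using E' by (simp add: \<psi>_def)
  moreover have "w absolutely_integrable_on E \<longleftrightarrow> w absolutely_integrable_on \<psi> ` E"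
    using ch f1 by metis
  moreover have "w absolutely_integrable_on E \<Longrightarrow> integral E w = integral (\<psi> ` E) w"
    using ch f1 by (metis vec_component)
  ultimately show ?thesis
    using E unfolding \<psi>_def[symmetric] by (simp add: emeasure_H3_volume w_def[symmetric])
qed

text \<open>The map is known on a Borel set only. Either the set spans Minkowski space, and the map
  is the restriction of a Lorentz map, or both the set and its image have measure zero.\<close>

theorem H3_volume_isometry:
  assumes E: "E \<in> sets borel" "E \<subseteq> H3" and E': "\<psi> ` E \<in> sets borel" "\<psi> ` E \<subseteq> H3"
    and iso: "\<And>x y. x \<in> E \<Longrightarrow> y \<in> E \<Longrightarrow> H3_dist (\<psi> x) (\<psi> y) = H3_dist x y"
  shows "emeasure H3_volume (\<psi> ` E) = emeasure H3_volume E"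
proof (cases "span (hyp ` E) = UNIV")
  case False
  then show ?thesis
    using H3_volume_not_spanning[OF E(2) False E(1)]
      H3_volume_not_spanning[OF E'(2) isometry_not_spanning[OF E(2) E'(2) iso False] E'(1)] by simp
next
  case True
  obtain A where A: "linear A" "\<And>P Q. lor (A P) (A Q) = lor P Q" "\<And>x. x \<in> E \<Longrightarrow> A (hyp x) = hyp (\<psi> x)"
    using lorentz_extension[OF E(2) E'(2) iso True] by blast
  have "E \<noteq> {}" using True by (metis UNIV_not_singleton image_empty span_empty)
  then obtain e where e: "e \<in> E" by blast
  have "unhyp (A (hyp x)) = \<psi> x" if "x \<in> E" for x
    using A(3)[OF that] E'(2) that by auto
  then have eq: "(\<lambda>x. unhyp (A (hyp x))) ` E = \<psi> ` E"
    by (intro image_cong) auto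
  have "\<psi> e \<in> H3" using E'(2) e by blast
  then have "A (hyp e) $ 3 > 0"
    unfolding A(3)[OF e] by (simp add: hyp_nth H3_def)
  then show ?thesis
    using H3_volume_lorentz[OF A(1,2), of e E] e E E' eq by auto
qed

section \<open>Spaces tiled by copies of a convex body\<close>

locale tiled =
  fixes X :: "'a topology" and \<T> :: "'a set set" and dev :: "'a \<Rightarrow> real^3"
begin

text \<open>A broken geodesic with its length. Every piece stays in one tile and is measured through
  \<open>dev\<close>, so that no distance on the space is presupposed.\<close>

inductive chain :: "'a \<Rightarrow> 'a \<Rightarrow> real \<Rightarrow> bool" where
  refl: "x \<in> topspace X \<Longrightarrow> chain x x 0"
| step: "chain x y c \<Longrightarrow> T \<in> \<T> \<Longrightarrow> y \<in> T \<Longrightarrow> z \<in> T \<Longrightarrow> chain x z (c + H3_dist (dev y) (dev z))"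

text \<open>The value 0 off the space makes nonnegativity and symmetry hold for all arguments, as
  \<open>Metric_space\<close> demands.\<close>

definition dst :: "'a \<Rightarrow> 'a \<Rightarrow> real" where
  "dst x y = (if x \<in> topspace X \<and> y \<in> topspace X then Inf {c. chain x y c} else 0)"

text \<open>The union of the balls around \<open>p\<close> taken separately in each tile at
  \<open>p\<close>; for small radii it will turn out to be the metric ball.\<close>

definition star :: "'a \<Rightarrow> real \<Rightarrow> 'a set" where
  "star p \<rho> = {y. \<exists>T\<in>\<T>. p \<in> T \<and> y \<in> T \<and> H3_dist (dev p) (dev y) < \<rho>}"

text \<open>The vectors in \<open>N\<close> are the normals of the mirrors through \<open>\<phi> p\<close>: points on the same side of
  all of them lie in a common tile.\<close>

definition unfolding_at :: "'a \<Rightarrow> real \<Rightarrow> ('a \<Rightarrow> real^3) \<Rightarrow> (real^4) set \<Rightarrow> bool" where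
  "unfolding_at p r \<phi> N \<longleftrightarrow> r > 0 \<and>
     (\<forall>\<rho>. 0 < \<rho> \<and> \<rho> \<le> r \<longrightarrow> openin X (star p \<rho>)) \<and>
     (\<forall>y\<in>star p r. \<forall>T\<in>\<T>. y \<in> T \<longrightarrow> p \<in> T) \<and>
     (\<forall>y\<in>star p r. \<phi> y \<in> H3) \<and>
     (\<forall>T\<in>\<T>. \<forall>x\<in>T \<inter> star p r. \<forall>y\<in>T \<inter> star p r. H3_dist (\<phi> x) (\<phi> y) = H3_dist (dev x) (dev y)) \<and>
     (\<forall>c\<in>H3. H3_dist (\<phi> p) c < r \<longrightarrow> c \<in> \<phi> ` star p r) \<and>
     finite N \<and>
     (\<forall>x\<in>star p r. \<forall>y\<in>star p r. (\<forall>n\<in>N. lor (hyp (\<phi> x)) n * lor (hyp (\<phi> y)) n \<ge> 0) \<longrightarrow>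
        (\<exists>T\<in>\<T>. x \<in> T \<and> y \<in> T))"

end

text \<open>That \<open>dev\<close> is a single map on the space encodes the gluing: a point on a
  common face has the same position in every tile that contains it. Convexity of \<open>B\<close> is
  phrased by nonnegative combinations, which is what \<open>H3_geodesic\<close> supplies.\<close>

locale tiling = tiled X \<T> dev
  for X :: "'a topology" and \<T> :: "'a set set" and dev :: "'a \<Rightarrow> real^3" +
  fixes B :: "(real^3) set"
  assumes finite_tiles: "finite \<T>" and cover: "\<Union>\<T> = topspace X"
    and B_H3: "B \<subseteq> H3" and closedin_B: "closedin (top_of_set H3) B"
    and convex_B: "\<And>p q c a b. \<lbrakk>p \<in> B; q \<in> B; c \<in> H3; a \<ge> 0; b \<ge> 0; hyp c = a *\<^sub>R hyp p + b *\<^sub>R hyp q\<rbrakk> \<Longrightarrow> c \<in> B"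
    and bij_dev: "\<And>T. T \<in> \<T> \<Longrightarrow> bij_betw dev T B"
    and continuous_sec: "\<And>T. T \<in> \<T> \<Longrightarrow> continuous_map (top_of_set B) X (inv_into T dev)"
    and connected_tiles: "\<And>T T'. \<lbrakk>T \<in> \<T>; T' \<in> \<T>\<rbrakk> \<Longrightarrow>
      (T, T') \<in> {(S, S'). S \<in> \<T> \<and> S' \<in> \<T> \<and> S \<inter> S' \<noteq> {}}\<^sup>*"
    and unfoldable: "\<And>p. p \<in> topspace X \<Longrightarrow> \<exists>r \<phi> N. unfolding_at p r \<phi> N"
begin

section \<open>The chain metric\<close>

lemma tile_subset: "T \<in> \<T> \<Longrightarrow> T \<subseteq> topspace X"
  using cover by blast

lemma dev_in_B: "x \<in> topspace X \<Longrightarrow> dev x \<in> B"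
  using cover bij_dev bij_betwE by (metis UnionE)

lemma dev_in_H3: "x \<in> topspace X \<Longrightarrow> dev x \<in> H3"
  using dev_in_B B_H3 by blast

lemma sec: assumes "T \<in> \<T>" "b \<in> B"
  shows "inv_into T dev b \<in> T" "dev (inv_into T dev b) = b"
  using bij_dev[OF assms(1)] assms(2)
  by (auto simp: bij_betw_def intro: inv_into_into f_inv_into_f)

lemma sec_dev: "T \<in> \<T> \<Longrightarrow> x \<in> T \<Longrightarrow> inv_into T dev (dev x) = x"
  by (rule bij_betw_inv_into_left[OF bij_dev])

lemma chain_topspace: "chain x y c \<Longrightarrow> x \<in> topspace X \<and> y \<in> topspace X"
  by (induction rule: chain.induct) (use tile_subset in auto)

text \<open>Developed into \<open>B\<close>, a chain is a broken geodesic of the same length in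
  hyperbolic space. This bounds \<open>dst\<close> from below and, with one-step chains, makes it
  exact inside a tile.\<close>

lemma chain_ge: "chain x y c \<Longrightarrow> H3_dist (dev x) (dev y) \<le> c"
proof (induction rule: chain.induct)
  case (refl x)
  then show ?case using dev_in_H3 by simp
next
  case (step x y c T z)
  then have "x \<in> topspace X" "y \<in> topspace X" "z \<in> topspace X"
    using chain_topspace tile_subset by blast+
  then have "H3_dist (dev x) (dev z) \<le> H3_dist (dev x) (dev y) + H3_dist (dev y) (dev z)"
    using dev_in_H3 H3_dist_triangle by blast
  then show ?case using step.IH by simp
qed

lemma chain_nonneg: "chain x y c \<Longrightarrow> c \<ge> 0"
  using chain_ge chain_topspace H3_dist_nonneg dev_in_H3 by (meson order_trans)

lemma chain_tile: "T \<in> \<T> \<Longrightarrow> x \<in> T \<Longrightarrow> y \<in> T \<Longrightarrow> chain x y (H3_dist (dev x) (dev y))"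
  using chain.step[OF chain.refl[of x], of T y] tile_subset by auto

lemma chain_trans: "chain y z e \<Longrightarrow> chain x y c \<Longrightarrow> chain x z (c + e)"
proof (induction rule: chain.induct)
  case (step y y' e T z)
  then show ?case using chain.step[of x y' "c + e" T z] by (simp add: add.assoc)
qed simp

lemma chain_sym: "chain x y c \<Longrightarrow> chain y x c"
proof (induction rule: chain.induct)
  case (step x y c T z)
  then show ?case
    using chain_trans[OF step.IH chain_tile[of T z y]]
    by (simp add: H3_dist_commute[of "dev z"] add.commute)
qed (simp add: chain.refl)

text \<open>Adjacent tiles share a point, and through it a chain reaches every point of the next
  tile.\<close>

lemma chain_exists:
  assumes "x \<in> topspace X" "y \<in> topspace X"
  shows "\<exists>c. chain x y c"
proof -
  obtain T T' where T: "T \<in> \<T>" "x \<in> T" "T' \<in> \<T>" "y \<in> T'"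
    using assms cover by blast
  have "\<forall>z\<in>T'. \<exists>c. chain x z c"
    using connected_tiles[OF T(1,3)]
  proof (induction rule: rtrancl_induct)
    case base
    then show ?case using chain_tile T by blast
  next
    case (step S S')
    then obtain w where w: "w \<in> S" "w \<in> S'" "S' \<in> \<T>" by auto
    then obtain c where "chain x w c" using step.IH by blast
    then show ?case using w chain.step by blast
  qed
  then show ?thesis using T by blast
qed

lemma dst_le: "chain x y c \<Longrightarrow> dst x y \<le> c"
  unfolding dst_def using chain_topspace chain_nonneg
  by (auto intro!: cInf_lower bdd_belowI[of _ 0])

lemma dst_ge:
  assumes "x \<in> topspace X" "y \<in> topspace X" "\<And>c. chain x y c \<Longrightarrow> b \<le> c"
  shows "b \<le> dst x y"
  unfolding dst_def using assms chain_exists[OF assms(1,2)] by (auto intro!: cInf_greatest)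

lemma dst_approx:
  assumes "x \<in> topspace X" "y \<in> topspace X" "dst x y < b"
  obtains c where "chain x y c" "c < b"
  using dst_ge[OF assms(1,2), of b] assms(3) by force

lemma dst_ge_dev: "x \<in> topspace X \<Longrightarrow> y \<in> topspace X \<Longrightarrow> H3_dist (dev x) (dev y) \<le> dst x y"
  using dst_ge chain_ge by blast

lemma dst_tile: "T \<in> \<T> \<Longrightarrow> x \<in> T \<Longrightarrow> y \<in> T \<Longrightarrow> dst x y = H3_dist (dev x) (dev y)"
  using dst_le[OF chain_tile] dst_ge_dev tile_subset by (meson order_antisym subsetD)

lemma dst_nonneg: "0 \<le> dst x y"
  using dst_ge[of x y 0] chain_nonneg by (cases "x \<in> topspace X \<and> y \<in> topspace X") (auto simp: dst_def)

lemma dst_commute: "dst x y = dst y x"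
proof -
  have "{c. chain x y c} = {c. chain y x c}" using chain_sym by blast
  then show ?thesis by (auto simp: dst_def)
qed

lemma dst_triangle:
  assumes "x \<in> topspace X" "y \<in> topspace X" "z \<in> topspace X"
  shows "dst x z \<le> dst x y + dst y z"
proof (rule field_le_epsilon)
  fix e :: real assume "e > 0"
  obtain c where c: "chain x y c" "c < dst x y + e / 2"
    using dst_approx[OF assms(1,2), of "dst x y + e / 2"] \<open>e > 0\<close> by auto
  obtain c' where c': "chain y z c'" "c' < dst y z + e / 2"
    using dst_approx[OF assms(2,3), of "dst y z + e / 2"] \<open>e > 0\<close> by auto
  show "dst x z \<le> dst x y + dst y z + e"
    using dst_le[OF chain_trans[OF c'(1) c(1)]] c c' by simp
qed

section \<open>Local geometry of the chain metric in an unfolded star\<close>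

context
  fixes p r \<phi> N
  assumes p: "p \<in> topspace X" and unf: "unfolding_at p r \<phi> N"
begin

lemma unf_r: "r > 0"
  using unf by (simp add: unfolding_at_def)

lemma unf_open: "0 < \<rho> \<Longrightarrow> \<rho> \<le> r \<Longrightarrow> openin X (star p \<rho>)"
  using unf by (simp add: unfolding_at_def)

lemma unf_tile: "y \<in> star p r \<Longrightarrow> T \<in> \<T> \<Longrightarrow> y \<in> T \<Longrightarrow> p \<in> T"
  using unf by (simp add: unfolding_at_def)

lemma unf_H3: "y \<in> star p r \<Longrightarrow> \<phi> y \<in> H3"
  using unf by (simp add: unfolding_at_def)

lemma unf_iso: "T \<in> \<T> \<Longrightarrow> x \<in> T \<Longrightarrow> y \<in> T \<Longrightarrow> x \<in> star p r \<Longrightarrow> y \<in> star p r \<Longrightarrow>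
    H3_dist (\<phi> x) (\<phi> y) = H3_dist (dev x) (dev y)"
  using unf by (simp add: unfolding_at_def)

lemma unf_onto: "c \<in> H3 \<Longrightarrow> H3_dist (\<phi> p) c < r \<Longrightarrow> c \<in> \<phi> ` star p r"
  using unf by (simp add: unfolding_at_def)

lemma unf_common_tile:
  "x \<in> star p r \<Longrightarrow> y \<in> star p r \<Longrightarrow> (\<And>n. n \<in> N \<Longrightarrow> lor (hyp (\<phi> x)) n * lor (hyp (\<phi> y)) n \<ge> 0) \<Longrightarrow>
    \<exists>T\<in>\<T>. x \<in> T \<and> y \<in> T"
  using unf by (simp add: unfolding_at_def)

lemma unf_finite: "finite N"
  using unf by (simp add: unfolding_at_def)

lemma star_mono: "\<rho> \<le> \<rho>' \<Longrightarrow> star p \<rho> \<subseteq> star p \<rho>'"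
  unfolding star_def by force

lemma star_topspace: "star p \<rho> \<subseteq> topspace X"
  unfolding star_def using tile_subset by blast

lemma p_in_star: "\<rho> > 0 \<Longrightarrow> p \<in> star p \<rho>"
  unfolding star_def using p cover dev_in_H3[OF p] by auto

lemma unf_dist_center:
  assumes "y \<in> star p r"
  shows "H3_dist (\<phi> p) (\<phi> y) = H3_dist (dev p) (dev y)"
proof -
  obtain T where "T \<in> \<T>" "p \<in> T" "y \<in> T" using assms by (auto simp: star_def)
  then show ?thesis using unf_iso[of T p y] p_in_star[OF unf_r] assms by simp
qed

lemma star_iff: "\<rho> \<le> r \<Longrightarrow> y \<in> star p \<rho> \<longleftrightarrow> y \<in> star p r \<and> H3_dist (\<phi> p) (\<phi> y) < \<rho>"
proof (cases "y \<in> star p r")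
  case True
  then show ?thesis unfolding unf_dist_center[OF True] by (auto simp: star_def)
qed (use star_mono[of \<rho> r] in auto)

text \<open>A chain that starts in the star unfolds until it first leaves the star, and leaving costs
  at least the distance to the boundary.\<close>

lemma chain_exit:
  assumes x: "x \<in> star p r" and ch: "chain x y c"
  shows "(y \<in> star p r \<and> H3_dist (\<phi> x) (\<phi> y) \<le> c) \<or> r - H3_dist (\<phi> p) (\<phi> x) \<le> c"
  using ch x
proof (induction rule: chain.induct)
  case (refl x)
  then show ?case using unf_H3 by simp
next
  case (step x y c T z)
  have zT: "H3_dist (dev y) (dev z) \<ge> 0"
    using step.hyps chain_topspace tile_subset by (meson H3_dist_nonneg dev_in_H3 subsetD)
  consider "y \<in> star p r" "H3_dist (\<phi> x) (\<phi> y) \<le> c" | "r - H3_dist (\<phi> p) (\<phi> x) \<le> c"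
    using step by blast
  then show ?case
  proof cases
    case 1
    have pT: "p \<in> T" using unf_tile[OF 1(1)] step.hyps by blast
    have H: "\<phi> x \<in> H3" "\<phi> y \<in> H3" "\<phi> p \<in> H3" "dev p \<in> H3" "dev y \<in> H3" "dev z \<in> H3"
      using unf_H3 1(1) step p_in_star[OF unf_r] dev_in_H3 p tile_subset[OF step.hyps(2)] by blast+
    show ?thesis
    proof (cases "H3_dist (dev p) (dev z) < r")
      case True
      then have z: "z \<in> star p r" using pT step.hyps by (auto simp: star_def)
      have "H3_dist (\<phi> y) (\<phi> z) = H3_dist (dev y) (dev z)"
        using unf_iso[OF step.hyps(2-4) 1(1) z] .
      moreover have "H3_dist (\<phi> x) (\<phi> z) \<le> H3_dist (\<phi> x) (\<phi> y) + H3_dist (\<phi> y) (\<phi> z)"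
        using H3_dist_triangle H unf_H3[OF z] by blast
      ultimately show ?thesis using z 1 by simp
    next
      case False
      have "H3_dist (dev p) (dev z) \<le> H3_dist (dev p) (dev y) + H3_dist (dev y) (dev z)"
        using H3_dist_triangle H by blast
      moreover have "H3_dist (dev p) (dev y) = H3_dist (\<phi> p) (\<phi> y)"
        using unf_dist_center[OF 1(1)] by simp
      moreover have "H3_dist (\<phi> p) (\<phi> y) \<le> H3_dist (\<phi> p) (\<phi> x) + H3_dist (\<phi> x) (\<phi> y)"
        using H3_dist_triangle H by blast
      ultimately show ?thesis using False 1 by simp
    qed
  qed (use zT in simp)
qed

text \<open>Induction on the number of mirrors that separate the unfolded points. Without any, the
  two points share a tile. Otherwise the geodesic is cut on a separating mirror: this mirror
  separates neither half, and no new one appears.\<close>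

lemma star_chain:
  assumes "x \<in> star p r" "y \<in> star p r" "H3_dist (\<phi> p) (\<phi> x) + H3_dist (\<phi> x) (\<phi> y) < r"
  shows "chain x y (H3_dist (\<phi> x) (\<phi> y))"
  using assms
proof (induction "card {n \<in> N. lor (hyp (\<phi> x)) n * lor (hyp (\<phi> y)) n < 0}" arbitrary: x y rule: less_induct)
  case less
  show ?case
  proof (cases "\<exists>n\<in>N. lor (hyp (\<phi> x)) n * lor (hyp (\<phi> y)) n < 0")
    case False
    then obtain T where "T \<in> \<T>" "x \<in> T" "y \<in> T"
      using unf_common_tile[OF less.prems(1,2)] by (meson not_le)
    then show ?thesis
      using chain_tile unf_iso less.prems by metis
  next
    case True
    then obtain n where n: "n \<in> N" "lor (hyp (\<phi> x)) n * lor (hyp (\<phi> y)) n < 0" by blast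
    have H: "\<phi> x \<in> H3" "\<phi> y \<in> H3" "\<phi> p \<in> H3"
      using unf_H3 less.prems p_in_star[OF unf_r] by blast+
    obtain w a b where w: "w \<in> H3" "lor (hyp w) n = 0"
      "H3_dist (\<phi> x) w + H3_dist w (\<phi> y) = H3_dist (\<phi> x) (\<phi> y)"
      and ab: "a \<ge> 0" "b \<ge> 0" "hyp w = a *\<^sub>R hyp (\<phi> x) + b *\<^sub>R hyp (\<phi> y)"
      using H3_crossing[OF H(1,2) n(2)] by metis
    have pw: "H3_dist (\<phi> p) w \<le> H3_dist (\<phi> p) (\<phi> x) + H3_dist (\<phi> x) w"
      using H3_dist_triangle H w by blast
    have wn: "H3_dist w (\<phi> y) \<ge> 0" using H3_dist_nonneg H w by blast
    \<comment> \<open>The bound on the sum of distances keeps the cut point inside the unfolded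
      ball, where it has a preimage.\<close>
    have "H3_dist (\<phi> p) w < r" using pw wn w(3) less.prems(3) by linarith
    then obtain z where z: "z \<in> star p r" "w = \<phi> z" using unf_onto[OF w(1)] by blast
    let ?neg = "\<lambda>u v. {n \<in> N. lor (hyp (\<phi> u)) n * lor (hyp (\<phi> v)) n < 0}"
    have sub: "?neg x z \<subset> ?neg x y" "?neg z y \<subset> ?neg x y"
    proof -
      have "\<not> lor (hyp (\<phi> x)) m * lor (hyp (\<phi> z)) m < 0" "\<not> lor (hyp (\<phi> z)) m * lor (hyp (\<phi> y)) m < 0"
        if "\<not> lor (hyp (\<phi> x)) m * lor (hyp (\<phi> y)) m < 0" for m
        using lor_combination_nonneg[OF _ ab, of m] that unfolding z(2) by (simp_all add: not_less)
      then have "?neg x z \<subseteq> ?neg x y" "?neg z y \<subseteq> ?neg x y" by blast+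
      moreover have "n \<in> ?neg x y" "n \<notin> ?neg x z" "n \<notin> ?neg z y" using n w(2) z(2) by simp_all
      ultimately show "?neg x z \<subset> ?neg x y" "?neg z y \<subset> ?neg x y" by blast+
    qed
    have fin: "finite (?neg x y)" using unf_finite by simp
    have "chain x z (H3_dist (\<phi> x) (\<phi> z))"
      by (rule less.hyps[OF psubset_card_mono[OF fin sub(1)] less.prems(1) z(1)])
        (use wn w(3) less.prems(3) z(2) in auto)
    moreover have "chain z y (H3_dist (\<phi> z) (\<phi> y))"
      by (rule less.hyps[OF psubset_card_mono[OF fin sub(2)] z(1) less.prems(2)])
        (use pw w(3) less.prems(3) z(2) in auto)
    ultimately show ?thesis
      using chain_trans w(3) z(2) by metis
  qed
qed

text \<open>With radius \<open>r / 3\<close>, two points are less than \<open>2 * r / 3\<close>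
  apart, so the sum of distances required by \<open>star_chain\<close> stays below \<open>r\<close>;
  and a chain leaving the star costs more than \<open>r - r / 3\<close>, which is no
  shortcut.\<close>

lemma unf_isometry:
  assumes x: "x \<in> star p (r / 3)" and y: "y \<in> star p (r / 3)"
  shows "H3_dist (\<phi> x) (\<phi> y) = dst x y"
proof (rule antisym)
  have r: "r > 0" by (rule unf_r)
  have xr: "x \<in> star p r" "H3_dist (\<phi> p) (\<phi> x) < r / 3" and yr: "y \<in> star p r" "H3_dist (\<phi> p) (\<phi> y) < r / 3"
    using star_iff[of "r / 3"] x y r by auto
  have H: "\<phi> x \<in> H3" "\<phi> y \<in> H3" "\<phi> p \<in> H3"
    using unf_H3 xr yr p_in_star[OF r] by blast+
  have t: "H3_dist (\<phi> x) (\<phi> y) < 2 * r / 3"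
    using H3_dist_triangle[OF H(1,3,2)] xr yr H3_dist_commute[of "\<phi> x" "\<phi> p"] by simp
  show "dst x y \<le> H3_dist (\<phi> x) (\<phi> y)"
    by (rule dst_le[OF star_chain[OF xr(1) yr(1)]]) (use xr t in simp)
  show "H3_dist (\<phi> x) (\<phi> y) \<le> dst x y"
  proof (rule dst_ge)
    show "H3_dist (\<phi> x) (\<phi> y) \<le> c" if "chain x y c" for c
      using chain_exit[OF xr(1) that] t xr by auto
  qed (use xr yr star_topspace in auto)
qed

text \<open>A chain from the centre that leaves the star costs at least \<open>r\<close>, so small
  metric balls are stars.\<close>

lemma dst_less_iff_star:
  assumes \<rho>: "\<rho> \<le> r" and y: "y \<in> topspace X"
  shows "dst p y < \<rho> \<longleftrightarrow> y \<in> star p \<rho>"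
proof
  assume "dst p y < \<rho>"
  then obtain c where c: "chain p y c" "c < \<rho>" using dst_approx[OF p y] by blast
  have "\<phi> p \<in> H3" using unf_H3 p_in_star[OF unf_r] by blast
  then have "y \<in> star p r \<and> H3_dist (\<phi> p) (\<phi> y) \<le> c"
    using chain_exit[OF p_in_star[OF unf_r] c(1)] c(2) \<rho> by auto
  then show "y \<in> star p \<rho>" using star_iff[OF \<rho>] c(2) by auto
next
  assume "y \<in> star p \<rho>"
  then show "dst p y < \<rho>" using dst_tile by (auto simp: star_def)
qed

lemma unf_chart: "isometric_chart X dst (star p (r / 3)) \<phi>"
  unfolding isometric_chart_def
proof (intro conjI ballI)
  have r: "r > 0" by (rule unf_r)
  show "openin X (star p (r / 3))" using unf_open r by simp
  have sub: "star p (r / 3) \<subseteq> star p r" using star_mono r by simp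
  show H: "\<phi> ` star p (r / 3) \<subseteq> H3" using unf_H3 sub by blast
  have p3: "\<phi> p \<in> H3" using unf_H3 p_in_star[OF r] by blast
  show "open (\<phi> ` star p (r / 3))"
    unfolding open_dist
  proof
    fix c assume "c \<in> \<phi> ` star p (r / 3)"
    then have c: "c \<in> H3" "H3_dist (\<phi> p) c < r / 3" using star_iff[of "r / 3"] H r by auto
    obtain \<delta> where \<delta>: "\<delta> > 0" "\<And>y. dist c y < \<delta> \<Longrightarrow> y \<in> H3 \<and> H3_dist c y < r / 3 - H3_dist (\<phi> p) c"
      using H3_ball_large[OF c(1), of "r / 3 - H3_dist (\<phi> p) c"] c by auto
    have "y \<in> \<phi> ` star p (r / 3)" if "dist y c < \<delta>" for y
    proof -
      have y: "y \<in> H3" "H3_dist c y < r / 3 - H3_dist (\<phi> p) c" using \<delta>(2) that dist_commute by metis+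
      have "H3_dist (\<phi> p) y < r / 3" using H3_dist_triangle[OF p3 c(1) y(1)] y(2) by simp
      then show ?thesis using unf_onto[OF y(1)] star_iff[of "r / 3"] r by auto
    qed
    then show "\<exists>e>0. \<forall>y. dist y c < e \<longrightarrow> y \<in> \<phi> ` star p (r / 3)" using \<delta>(1) by blast
  qed
qed (use unf_isometry in auto)

end

section \<open>Metric axioms, topology and completeness\<close>

lemma Metric_space_dst: "Metric_space (topspace X) dst"
proof
  fix x y assume xy: "x \<in> topspace X" "y \<in> topspace X"
  show "dst x y = 0 \<longleftrightarrow> x = y"
  proof
    assume 0: "dst x y = 0"
    obtain r \<phi> N where u: "unfolding_at x r \<phi> N" using unfoldable[OF xy(1)] by blast
    \<comment> \<open>Distance zero puts \<open>y\<close> into a common tile with \<open>x\<close>,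
      where the distance is exact and \<open>dev\<close> is injective.\<close>
    have "y \<in> star x r" using dst_less_iff_star[OF xy(1) u order.refl xy(2)] 0 unf_r[OF xy(1) u] by simp
    then obtain T where T: "T \<in> \<T>" "x \<in> T" "y \<in> T" by (auto simp: star_def)
    then have "dev x = dev y" using 0 dst_tile dev_in_H3 xy H3_dist_eq_0 by metis
    then show "x = y" using T sec_dev by metis
  next
    assume "x = y"
    then show "dst x y = 0"
      using dst_le[OF chain.refl] xy dst_nonneg by (simp add: order_antisym)
  qed
qed (auto simp: dst_nonneg dst_commute dst_triangle)

sublocale M: Metric_space "topspace X" dst
  by (rule Metric_space_dst)

lemma sec_open:
  assumes U: "openin X U" and T: "T \<in> \<T>" and x: "x \<in> T" "x \<in> U"
  obtains \<rho> where "\<rho> > 0" "\<And>y. y \<in> T \<Longrightarrow> H3_dist (dev x) (dev y) < \<rho> \<Longrightarrow> y \<in> U"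
proof -
  have "openin (top_of_set B) {b \<in> B. inv_into T dev b \<in> U}"
    using openin_continuous_map_preimage[OF continuous_sec[OF T] U] by simp
  moreover have "dev x \<in> {b \<in> B. inv_into T dev b \<in> U}"
    using sec_dev[OF T x(1)] x dev_in_B tile_subset[OF T] by auto
  ultimately obtain e where e: "e > 0" "\<And>b. b \<in> B \<Longrightarrow> dist b (dev x) < e \<Longrightarrow> inv_into T dev b \<in> U"
    unfolding openin_euclidean_subtopology_iff by blast
  have "dev x \<in> H3" using dev_in_H3 x tile_subset[OF T] by blast
  then obtain \<rho> where \<rho>: "\<rho> > 0" "\<And>b. b \<in> H3 \<Longrightarrow> H3_dist (dev x) b < \<rho> \<Longrightarrow> dist (dev x) b < e"
    using H3_ball_small[OF _ e(1)] by metis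
  show ?thesis
  proof (rule that[OF \<rho>(1)])
    fix y assume y: "y \<in> T" "H3_dist (dev x) (dev y) < \<rho>"
    have "y \<in> topspace X" using y(1) tile_subset[OF T] by blast
    then have "inv_into T dev (dev y) \<in> U"
      using e(2)[OF dev_in_B] \<rho>(2)[OF dev_in_H3 y(2)] dist_commute by metis
    then show "y \<in> U" using sec_dev[OF T y(1)] by simp
  qed
qed

text \<open>One direction holds because small balls are stars and stars are open. The other uses
  continuity of the sections of the finitely many tiles at a point, with the least of their
  radii.\<close>

lemma mtopology_dst: "M.mtopology = X"
  unfolding topology_eq
proof (intro allI iffI)
  fix U assume "openin M.mtopology U"
  then have U: "U \<subseteq> topspace X" "\<And>x. x \<in> U \<Longrightarrow> \<exists>r>0. M.mball x r \<subseteq> U"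
    by (auto simp: M.openin_mtopology)
  have "\<exists>V. openin X V \<and> x \<in> V \<and> V \<subseteq> U" if x: "x \<in> U" for x
  proof -
    obtain \<rho> where \<rho>: "\<rho> > 0" "M.mball x \<rho> \<subseteq> U" using U(2)[OF x] by blast
    have xX: "x \<in> topspace X" using x U(1) by blast
    obtain r \<phi> N where u: "unfolding_at x r \<phi> N" using unfoldable[OF xX] by blast
    have r: "r > 0" using unf_r[OF xX u] .
    have "star x (min \<rho> r) \<subseteq> M.mball x \<rho>"
      using dst_less_iff_star[OF xX u, of "min \<rho> r"] star_topspace[OF xX u] xX
      by (force simp: M.in_mball)
    then show ?thesis
      using unf_open[OF xX u, of "min \<rho> r"] p_in_star[OF xX u, of "min \<rho> r"] \<rho> r by (metis min.cobounded2 min_less_iff_conj order_trans)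
  qed
  then show "openin X U" by (subst openin_subopen) blast
next
  fix U assume U: "openin X U"
  show "openin M.mtopology U"
    unfolding M.openin_mtopology
  proof (intro conjI allI impI)
    show "U \<subseteq> topspace X" using U openin_subset by blast
    fix x assume x: "x \<in> U"
    then have xX: "x \<in> topspace X" using U openin_subset by blast
    obtain r \<phi> N where u: "unfolding_at x r \<phi> N" using unfoldable[OF xX] by blast
    have "\<forall>T\<in>{T\<in>\<T>. x \<in> T}. \<exists>\<rho>>0. \<forall>y\<in>T. H3_dist (dev x) (dev y) < \<rho> \<longrightarrow> y \<in> U"
    proof
      fix T assume "T \<in> {T\<in>\<T>. x \<in> T}"
      then show "\<exists>\<rho>>0. \<forall>y\<in>T. H3_dist (dev x) (dev y) < \<rho> \<longrightarrow> y \<in> U"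
        using sec_open[OF U, of T x] x by (metis (no_types, lifting) mem_Collect_eq)
    qed
    then obtain f where f: "\<And>T. T \<in> \<T> \<Longrightarrow> x \<in> T \<Longrightarrow> f T > 0"
      "\<And>T y. T \<in> \<T> \<Longrightarrow> x \<in> T \<Longrightarrow> y \<in> T \<Longrightarrow> H3_dist (dev x) (dev y) < f T \<Longrightarrow> y \<in> U"
      by (subst (asm) bchoice_iff) auto
    define \<rho> where "\<rho> = Min (insert r (f ` {T\<in>\<T>. x \<in> T}))"
    have fin: "finite (insert r (f ` {T\<in>\<T>. x \<in> T}))" using finite_tiles by simp
    have "\<rho> > 0" unfolding \<rho>_def using fin f(1) unf_r[OF xX u] by (subst Min_gr_iff) auto
    moreover have "M.mball x \<rho> \<subseteq> U"
    proof
      fix y assume "y \<in> M.mball x \<rho>"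
      then have y: "y \<in> topspace X" "dst x y < \<rho>" by auto
      have "\<rho> \<le> r" unfolding \<rho>_def using fin by simp
      then have "y \<in> star x \<rho>" using dst_less_iff_star[OF xX u _ y(1)] y(2) by blast
      then obtain T where T: "T \<in> \<T>" "x \<in> T" "y \<in> T" "H3_dist (dev x) (dev y) < \<rho>"
        by (auto simp: star_def)
      have "\<rho> \<le> f T" unfolding \<rho>_def using fin T by simp
      then show "y \<in> U" using f(2)[OF T(1-3)] T(4) by simp
    qed
    ultimately show "\<exists>r>0. M.mball x r \<subseteq> U" by blast
  qed
qed

text \<open>One of the finitely many tiles contains infinitely many terms. Their developed images
  stay in a compact hyperbolic ball and accumulate at a point of \<open>B\<close>, since
  \<open>B\<close> is closed in \<open>H3\<close>; the section of that tile carries this point back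
  to the limit.\<close>

lemma mcomplete_dst: "M.mcomplete"
  unfolding M.mcomplete_def
proof (intro allI impI)
  fix \<sigma> assume \<sigma>: "M.MCauchy \<sigma>"
  then have \<sigma>X: "\<And>n. \<sigma> n \<in> topspace X"
    and cau: "\<And>\<epsilon>. \<epsilon> > 0 \<Longrightarrow> \<exists>N. \<forall>n n'. N \<le> n \<longrightarrow> N \<le> n' \<longrightarrow> dst (\<sigma> n) (\<sigma> n') < \<epsilon>"
    by (auto simp: M.MCauchy_def)
  obtain N where N: "\<And>n. n \<ge> N \<Longrightarrow> dst (\<sigma> N) (\<sigma> n) < 1" using cau[of 1] by auto
  have "\<exists>T\<in>\<T>. \<exists>\<^sub>\<infinity>n. \<sigma> n \<in> T"
  proof (rule ccontr)
    assume "\<not> ?thesis"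
    then have "\<forall>\<^sub>\<infinity>n. \<forall>T\<in>\<T>. \<sigma> n \<notin> T"
      using finite_tiles by (auto simp: cofinite_eq_sequentially frequently_def intro!: eventually_ball_finite)
    then obtain n where "\<forall>T\<in>\<T>. \<sigma> n \<notin> T" unfolding cofinite_eq_sequentially eventually_sequentially by blast
    then show False using \<sigma>X[of n] cover by blast
  qed
  then obtain T where T: "T \<in> \<T>" "infinite {n. \<sigma> n \<in> T}" by (auto simp: INFM_iff_infinite)
  define S where "S = {n. \<sigma> n \<in> T \<and> n \<ge> N}"
  have "infinite S"
  proof
    assume "finite S"
    moreover have "{n. \<sigma> n \<in> T} \<subseteq> S \<union> {..<N}" by (auto simp: S_def)
    ultimately show False using T(2) by (meson finite_Un finite_lessThan finite_subset)
  qed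
  then obtain s :: "nat \<Rightarrow> nat" where s: "strict_mono s" "\<And>n. s n \<in> S"
    using infinite_enumerate by blast
  define K where "K = {y \<in> H3. H3_dist (dev (\<sigma> N)) y \<le> 1}"
  have "compact K" unfolding K_def by (rule compact_H3_cball) (simp add: dev_in_H3 \<sigma>X)
  moreover have "\<forall>n. dev (\<sigma> (s n)) \<in> K"
  proof
    fix n
    have "H3_dist (dev (\<sigma> N)) (dev (\<sigma> (s n))) \<le> dst (\<sigma> N) (\<sigma> (s n))" using dst_ge_dev \<sigma>X by blast
    then show "dev (\<sigma> (s n)) \<in> K" using N[of "s n"] s(2)[of n] \<sigma>X dev_in_H3 by (auto simp: K_def S_def)
  qed
  ultimately obtain b t where b: "b \<in> K" "strict_mono (t :: nat \<Rightarrow> nat)" "(\<lambda>n. dev (\<sigma> (s (t n)))) \<longlonglongrightarrow> b"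
    using seq_compactE[OF compact_imp_seq_compact, of K "\<lambda>n. dev (\<sigma> (s n))"] unfolding o_def by metis
  have bH: "b \<in> H3" using b(1) by (simp add: K_def)
  obtain C where C: "closed C" "B = C \<inter> H3" using closedin_B by (auto simp: closedin_closed)
  have "b \<in> C"
    using closed_sequentially[OF C(1) _ b(3)] C(2) dev_in_B \<sigma>X by blast
  then have bB: "b \<in> B" using C(2) bH by blast
  define x where "x = inv_into T dev b"
  have x: "x \<in> T" "dev x = b" using sec[OF T(1) bB] by (auto simp: x_def)
  then have xX: "x \<in> topspace X" using tile_subset[OF T(1)] by blast
  show "\<exists>x. limitin M.mtopology \<sigma> x sequentially"
    unfolding M.limit_metric_sequentially
  proof (intro exI[of _ x] conjI allI impI xX)
    fix \<epsilon> :: real assume \<epsilon>: "\<epsilon> > 0"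
    obtain N' where N': "\<And>n n'. N' \<le> n \<Longrightarrow> N' \<le> n' \<Longrightarrow> dst (\<sigma> n) (\<sigma> n') < \<epsilon> / 2" using cau[of "\<epsilon> / 2"] \<epsilon> by auto
    obtain \<delta> where \<delta>: "\<delta> > 0" "\<And>y. dist b y < \<delta> \<Longrightarrow> y \<in> H3 \<and> H3_dist b y < \<epsilon> / 2"
      using H3_ball_large[OF bH, of "\<epsilon> / 2"] \<epsilon> by auto
    obtain M where M: "\<And>n. n \<ge> M \<Longrightarrow> dist (dev (\<sigma> (s (t n)))) b < \<delta>"
      using b(3) \<delta>(1) unfolding lim_sequentially by blast
    define k where "k = s (t (max M N'))"
    have k: "k \<ge> N'" using seq_suble[OF s(1)] seq_suble[OF b(2)] unfolding k_def
      by (meson max.cobounded2 order_trans)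
    have "\<sigma> k \<in> T" using s(2) by (auto simp: k_def S_def)
    moreover have "H3_dist b (dev (\<sigma> k)) < \<epsilon> / 2"
      using \<delta>(2) M[of "max M N'"] by (simp add: k_def dist_commute)
    ultimately have xk: "dst (\<sigma> k) x < \<epsilon> / 2" using dst_tile[OF T(1) _ x(1)] x(2) H3_dist_commute[of b] by simp
    show "\<exists>N. \<forall>n\<ge>N. \<sigma> n \<in> topspace X \<and> dst (\<sigma> n) x < \<epsilon>"
    proof (intro exI[of _ N'] allI impI conjI \<sigma>X)
      fix n assume "n \<ge> N'"
      then show "dst (\<sigma> n) x < \<epsilon>"
        using N'[of n k] k xk dst_triangle[OF \<sigma>X \<sigma>X xX, of n k] by simp
    qed
  qed
qed

section \<open>Chains as curves, and the length metric\<close>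

lemma chain_path:
  assumes "chain x y c"
  shows "\<exists>\<gamma>. \<gamma> 0 = x \<and> \<gamma> c = y \<and> (\<forall>s\<in>{0..c}. \<gamma> s \<in> topspace X) \<and>
    (\<forall>s\<in>{0..c}. \<forall>t\<in>{0..c}. dst (\<gamma> s) (\<gamma> t) \<le> \<bar>s - t\<bar>)"
  using assms
proof (induction rule: chain.induct)
  case (refl x)
  then show ?case by (intro exI[of _ "\<lambda>_. x"]) auto
next
  case (step x y c T z)
  then obtain \<gamma> where \<gamma>: "\<gamma> 0 = x" "\<gamma> c = y" "\<And>s. s \<in> {0..c} \<Longrightarrow> \<gamma> s \<in> topspace X"
    "\<And>s t. s \<in> {0..c} \<Longrightarrow> t \<in> {0..c} \<Longrightarrow> dst (\<gamma> s) (\<gamma> t) \<le> \<bar>s - t\<bar>" by blast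
  have c: "c \<ge> 0" using chain_nonneg step.hyps(1) .
  have yz: "y \<in> topspace X" "z \<in> topspace X" using step.hyps tile_subset by blast+
  define D where "D = H3_dist (dev y) (dev z)"
  have D: "D \<ge> 0" unfolding D_def using H3_dist_nonneg yz dev_in_H3 by blast
  obtain \<eta> where \<eta>: "\<eta> 0 = dev y" "\<eta> D = dev z"
    "\<And>s. s \<in> {0..D} \<Longrightarrow> \<eta> s \<in> H3 \<and> (\<exists>a\<ge>0. \<exists>b\<ge>0. hyp (\<eta> s) = a *\<^sub>R hyp (dev y) + b *\<^sub>R hyp (dev z))"
    "\<And>s t. s \<in> {0..D} \<Longrightarrow> t \<in> {0..D} \<Longrightarrow> H3_dist (\<eta> s) (\<eta> t) = \<bar>s - t\<bar>"
    "continuous_on {0..D} (\<lambda>s. hyp (\<eta> s))"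
  proof (rule H3_geodesic[OF dev_in_H3[OF yz(1)] dev_in_H3[OF yz(2)], folded D_def])
    fix \<gamma> assume "\<gamma> 0 = dev y" "\<gamma> D = dev z"
      "\<And>s. s \<in> {0..D} \<Longrightarrow> \<gamma> s \<in> H3 \<and> (\<exists>a\<ge>0. \<exists>b\<ge>0. hyp (\<gamma> s) = a *\<^sub>R hyp (dev y) + b *\<^sub>R hyp (dev z))"
      "\<And>s t. s \<in> {0..D} \<Longrightarrow> t \<in> {0..D} \<Longrightarrow> H3_dist (\<gamma> s) (\<gamma> t) = \<bar>s - t\<bar>"
      "continuous_on {0..D} (\<lambda>s. hyp (\<gamma> s))"
    then show thesis by (rule that[of \<gamma>])
  qed
  have \<eta>B: "\<eta> s \<in> B" if "s \<in> {0..D}" for s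
    using \<eta>(3)[OF that] convex_B dev_in_B yz by blast
  define \<theta> where "\<theta> s = inv_into T dev (\<eta> s)" for s
  have \<theta>: "\<theta> 0 = y" "\<theta> D = z" by (simp_all add: \<theta>_def \<eta> sec_dev step.hyps)
  have \<theta>T: "\<theta> s \<in> T" "dev (\<theta> s) = \<eta> s" if "s \<in> {0..D}" for s
    using sec[OF step.hyps(2) \<eta>B[OF that]] by (simp_all add: \<theta>_def)
  have \<theta>d: "dst (\<theta> s) (\<theta> t) = \<bar>s - t\<bar>" if "s \<in> {0..D}" "t \<in> {0..D}" for s t
    using dst_tile[OF step.hyps(2) \<theta>T(1)[OF that(1)] \<theta>T(1)[OF that(2)]] \<theta>T(2) \<eta>(4) that by simp
  \<comment> \<open>The geodesic of the last tile is appended at time \<open>c\<close>; times on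
    both sides of the junction are compared through \<open>y\<close>.\<close>
  define \<kappa> where "\<kappa> s = (if s \<le> c then \<gamma> s else \<theta> (s - c))" for s
  have \<kappa>X: "\<kappa> s \<in> topspace X" if "s \<in> {0..c + D}" for s
    using that \<gamma>(3)[of s] \<theta>T(1)[of "s - c"] tile_subset[OF step.hyps(2)] by (auto simp: \<kappa>_def)
  have le: "dst (\<kappa> s) (\<kappa> t) \<le> t - s" if "s \<in> {0..c + D}" "t \<in> {0..c + D}" "s \<le> t" for s t
  proof -
    consider "t \<le> c" | "c < s" | "s \<le> c" "c < t" by linarith
    then show ?thesis
    proof cases
      case 1 then show ?thesis using \<gamma>(4)[of s t] that by (simp add: \<kappa>_def)
    next
      case 2 then show ?thesis using \<theta>d[of "s - c" "t - c"] that by (simp add: \<kappa>_def)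
    next
      case 3
      have "dst (\<gamma> s) (\<theta> (t - c)) \<le> dst (\<gamma> s) y + dst y (\<theta> (t - c))"
        using dst_triangle \<kappa>X[OF that(1)] \<kappa>X[OF that(2)] yz(1) 3 by (simp add: \<kappa>_def)
      moreover have "dst (\<gamma> s) y \<le> c - s" using \<gamma>(4)[of s c] \<gamma>(2) that 3 by simp
      moreover have "dst y (\<theta> (t - c)) = t - c" using \<theta>d[of 0 "t - c"] \<theta>(1) that 3 D by simp
      ultimately show ?thesis using 3 by (simp add: \<kappa>_def)
    qed
  qed
  have "dst (\<kappa> s) (\<kappa> t) \<le> \<bar>s - t\<bar>" if "s \<in> {0..c + D}" "t \<in> {0..c + D}" for s t
  proof (cases "s \<le> t")
    case False
    have "dst (\<kappa> s) (\<kappa> t) = dst (\<kappa> t) (\<kappa> s)" by (rule dst_commute)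
    then show ?thesis using le[of t s] that False by simp
  qed (use le[of s t] that in simp)
  moreover have "\<kappa> 0 = x" using \<gamma>(1) c by (simp add: \<kappa>_def)
  moreover have "\<kappa> (c + D) = z" using \<gamma>(2) \<theta> D by (cases "D = 0") (auto simp: \<kappa>_def)
  ultimately show ?case using \<kappa>X unfolding D_def[symmetric] by blast
qed

lemma curve_length_Lipschitz:
  assumes c: "c \<ge> 0" and lip: "\<And>s t. s \<in> {0..1} \<Longrightarrow> t \<in> {0..1} \<Longrightarrow> d (g s) (g t) \<le> c * \<bar>s - t\<bar>"
  shows "curve_length d g \<le> ennreal c"
  unfolding curve_length_def
proof (rule SUP_least)
  fix ts :: "real list" assume "ts \<in> {ts. sorted ts \<and> set ts \<subseteq> {0..1}}"
  then have ts: "sorted ts" "set ts \<subseteq> {0..1}" by auto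
  have in01: "ts ! i \<in> {0..1}" if "i < length ts" for i using ts(2) that by (meson nth_mem subsetD)
  have "(\<Sum>i<length ts - 1. d (g (ts ! i)) (g (ts ! Suc i))) \<le> (\<Sum>i<length ts - 1. c * ts ! Suc i - c * ts ! i)"
  proof (rule sum_mono)
    fix i assume "i \<in> {..<length ts - 1}"
    then have i: "i < length ts" "Suc i < length ts" by auto
    have "ts ! i \<le> ts ! Suc i" using ts(1) i sorted_nth_mono by (metis Suc_n_not_le_n nat_le_linear)
    then show "d (g (ts ! i)) (g (ts ! Suc i)) \<le> c * ts ! Suc i - c * ts ! i"
      using lip[OF in01[OF i(1)] in01[OF i(2)]] by (simp add: right_diff_distrib abs_if split: if_splits)
  qed
  also have "\<dots> = c * ts ! (length ts - 1) - c * ts ! 0"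
    by (rule sum_lessThan_telescope)
  also have "\<dots> \<le> c"
  proof (cases "ts = []")
    case False
    then have "ts ! (length ts - 1) \<le> 1" "ts ! 0 \<ge> 0" using in01[of "length ts - 1"] in01[of 0] by auto
    then have "c * ts ! (length ts - 1) \<le> c * 1" "c * ts ! 0 \<ge> 0"
      using mult_left_mono[OF _ c, of "ts ! (length ts - 1)" 1] mult_nonneg_nonneg[OF c, of "ts ! 0"] by blast+
    then show ?thesis by simp
  qed (use c in simp)
  finally show "ennreal (\<Sum>i<length ts - 1. d (g (ts ! i)) (g (ts ! Suc i))) \<le> ennreal c"
    by (rule ennreal_leI)
qed

lemma length_metric_dst: "length_metric X dst"
  unfolding length_metric_def
proof (intro ballI antisym)
  fix x y assume xy: "x \<in> topspace X" "y \<in> topspace X"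
  let ?G = "{g. pathin X g \<and> g 0 = x \<and> g 1 = y}"
  show "ennreal (dst x y) \<le> (INF g\<in>?G. curve_length dst g)"
  proof (rule INF_greatest)
    fix g assume "g \<in> ?G"
    \<comment> \<open>The partition consisting of the two endpoints already gives the lower
      bound.\<close>
    then have "ennreal (dst x y) = ennreal (\<Sum>i<length [0, 1::real] - 1. dst (g ([0, 1] ! i)) (g ([0, 1] ! Suc i)))"
      by simp
    also have "\<dots> \<le> curve_length dst g"
      unfolding curve_length_def by (rule SUP_upper) auto
    finally show "ennreal (dst x y) \<le> curve_length dst g" .
  qed
  show "(INF g\<in>?G. curve_length dst g) \<le> ennreal (dst x y)"
  proof (rule ennreal_le_epsilon)
    fix e :: real assume "e > 0"
    then obtain c where c: "chain x y c" "c < dst x y + e" using dst_approx[OF xy, of "dst x y + e"] by auto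
    have c0: "c \<ge> 0" using chain_nonneg c(1) .
    obtain \<gamma> where \<gamma>: "\<gamma> 0 = x" "\<gamma> c = y" "\<And>s. s \<in> {0..c} \<Longrightarrow> \<gamma> s \<in> topspace X"
      "\<And>s t. s \<in> {0..c} \<Longrightarrow> t \<in> {0..c} \<Longrightarrow> dst (\<gamma> s) (\<gamma> t) \<le> \<bar>s - t\<bar>"
      using chain_path[OF c(1)] by blast
    define g where "g s = \<gamma> (c * s)" for s
    have cs: "c * s \<in> {0..c}" if "s \<in> {0..1}" for s
      using that c0 mult_left_mono[of s 1 c] by auto
    have gX: "g s \<in> topspace X" if "s \<in> {0..1}" for s using \<gamma>(3)[OF cs[OF that]] by (simp add: g_def)
    have lip: "dst (g s) (g t) \<le> c * \<bar>s - t\<bar>" if "s \<in> {0..1}" "t \<in> {0..1}" for s t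
    proof -
      have "\<bar>c * s - c * t\<bar> = c * \<bar>s - t\<bar>" using c0 by (simp add: abs_mult flip: right_diff_distrib)
      then show ?thesis using \<gamma>(4)[OF cs[OF that(1)] cs[OF that(2)]] by (simp add: g_def)
    qed
    have "pathin X g"
      unfolding pathin_def continuous_map
    proof (intro conjI allI impI)
      show "g ` topspace (top_of_set {0..1}) \<subseteq> topspace X" using gX by auto
      fix U assume "openin X U"
      then have U: "\<And>x. x \<in> U \<Longrightarrow> \<exists>r>0. M.mball x r \<subseteq> U"
        using mtopology_dst M.openin_mtopology by metis
      have "\<exists>e>0. \<forall>t\<in>{0..1}. dist t s < e \<longrightarrow> t \<in> {x \<in> {0..1}. g x \<in> U}"
        if s: "s \<in> {x \<in> {0..1}. g x \<in> U}" for s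
      proof -
        obtain \<rho> where \<rho>: "\<rho> > 0" "M.mball (g s) \<rho> \<subseteq> U" using U s by blast
        \<comment> \<open>Dividing by \<open>c + 1\<close> includes the constant path, for which
          \<open>c\<close> is 0.\<close>
        have "g t \<in> U" if t: "t \<in> {0..1}" "dist t s < \<rho> / (c + 1)" for t
        proof -
          have "dst (g s) (g t) \<le> c * \<bar>s - t\<bar>" using lip s t by simp
          also have "\<dots> \<le> (c + 1) * \<bar>s - t\<bar>" by (simp add: mult_right_mono)
          also have "\<dots> < \<rho>" using t(2) c0 by (simp add: dist_real_def field_simps abs_minus_commute)
          finally have "dst (g s) (g t) < \<rho>" .
          then show ?thesis using \<rho>(2) gX s t by (auto simp: subset_iff)
        qed
        then show ?thesis using \<rho>(1) c0 by (intro exI[of _ "\<rho> / (c + 1)"]) auto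
      qed
      then show "openin (top_of_set {0..1}) {x \<in> topspace (top_of_set {0..1}). g x \<in> U}"
        unfolding openin_euclidean_subtopology_iff by auto
    qed
    then have "(INF g\<in>?G. curve_length dst g) \<le> curve_length dst g"
      by (intro INF_lower) (simp add: g_def \<gamma>)
    also have "\<dots> \<le> ennreal c" by (rule curve_length_Lipschitz) (use c0 lip in auto)
    also have "\<dots> \<le> ennreal (dst x y + e)" using c(2) by (intro ennreal_leI) simp
    also have "\<dots> = ennreal (dst x y) + ennreal e" using dst_nonneg \<open>e > 0\<close> by simp
    finally show "(INF g\<in>?G. curve_length dst g) \<le> ennreal (dst x y) + ennreal e" .
  qed
qed

theorem complete_hyperbolic_metric_dst: "complete_hyperbolic_metric X dst"
  unfolding complete_hyperbolic_metric_def
proof (intro conjI ballI)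
  fix p assume p: "p \<in> topspace X"
  then obtain r \<phi> N where u: "unfolding_at p r \<phi> N" using unfoldable by blast
  then show "\<exists>U \<phi>. p \<in> U \<and> isometric_chart X dst U \<phi>"
    using unf_chart[OF p u] p_in_star[OF p u, of "r / 3"] unf_r[OF p u] by force
qed (rule Metric_space_dst mtopology_dst mcomplete_dst length_metric_dst)+

end

section \<open>The volume of a tiled space\<close>

context tiling
begin

definition borelX :: "'a measure" where
  "borelX = sigma (topspace X) {U. openin X U}"

lemma space_borelX [simp]: "space borelX = topspace X"
  by (simp add: borelX_def space_measure_of_conv)

lemma sets_borelX: "sets borelX = sigma_sets (topspace X) {U. openin X U}"
  unfolding borelX_def by (rule sets_measure_of) (auto dest: openin_subset)

lemma open_in_borelX: "openin X U \<Longrightarrow> U \<in> sets borelX"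
  by (simp add: sets_borelX)

text \<open>A tile that meets the unfolded star of a point contains the point, so a point outside a
  tile has a star disjoint from it.\<close>

lemma closedin_tile:
  assumes T: "T \<in> \<T>"
  shows "closedin X T"
proof -
  have "\<exists>V. openin X V \<and> y \<in> V \<and> V \<subseteq> topspace X - T" if y: "y \<in> topspace X - T" for y
  proof -
    have yX: "y \<in> topspace X" using y by blast
    obtain r \<phi> N where u: "unfolding_at y r \<phi> N" using unfoldable[OF yX] by blast
    show ?thesis
    proof (intro exI conjI)
      show "openin X (star y r)" using unf_open[OF yX u] unf_r[OF yX u] by simp
      show "y \<in> star y r" using p_in_star[OF yX u] unf_r[OF yX u] by simp
      show "star y r \<subseteq> topspace X - T"
        using star_topspace[OF yX u] unf_tile[OF yX u _ T] y by blast
    qed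
  qed
  then have "openin X (topspace X - T)" by (subst openin_subopen) blast
  then show ?thesis using tile_subset[OF T] by (simp add: closedin_def)
qed

lemma tile_in_borelX: "T \<in> \<T> \<Longrightarrow> T \<in> sets borelX"
proof -
  assume T: "T \<in> \<T>"
  then have "openin X (topspace X - T)" using closedin_tile by (simp add: closedin_def)
  then have "space borelX - (topspace X - T) \<in> sets borelX"
    using open_in_borelX by blast
  moreover have "topspace X - (topspace X - T) = T" using tile_subset[OF T] by blast
  ultimately show ?thesis by simp
qed

lemma B_borel: "B \<in> sets borel"
proof -
  obtain C where C: "closed C" "B = C \<inter> H3" using closedin_B by (auto simp: closedin_closed)
  then show ?thesis using open_H3 by simp
qed

text \<open>Images under \<open>dev\<close> and under charts are Borel because they are preimages
  under the inverse maps; \<open>f\<close> stands for such an inverse, defined on \<open>B\<close>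
  or on the image of a chart.\<close>

lemma measurable_of_openin:
  assumes S: "S \<in> sets borel" and f: "\<And>s. s \<in> S \<Longrightarrow> f s \<in> topspace X"
    and op: "\<And>U. openin X U \<Longrightarrow> {s \<in> S. f s \<in> U} \<in> sets borel" and A: "A \<in> sets borelX"
  shows "{s \<in> S. f s \<in> A} \<in> sets borel"
proof -
  have "f \<in> measurable (restrict_space borel S) borelX"
    unfolding borelX_def
  proof (rule measurable_measure_of)
    show "f \<in> space (restrict_space borel S) \<rightarrow> topspace X" using f by (auto simp: space_restrict_space)
    fix U assume "U \<in> {U. openin X U}"
    then have "{s \<in> S. f s \<in> U} \<in> sets borel" using op by simp
    moreover have "f -` U \<inter> space (restrict_space borel S) = S \<inter> {s \<in> S. f s \<in> U}"
      by (auto simp: space_restrict_space)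
    ultimately show "f -` U \<inter> space (restrict_space borel S) \<in> sets (restrict_space borel S)"
      by (auto simp: sets_restrict_space)
  qed (auto dest: openin_subset)
  then have "f -` A \<inter> space (restrict_space borel S) \<in> sets (restrict_space borel S)"
    using A by (rule measurable_sets)
  moreover have "f -` A \<inter> space (restrict_space borel S) = {s \<in> S. f s \<in> A}"
    by (auto simp: space_restrict_space)
  ultimately show ?thesis using S by (auto simp: sets_restrict_space)
qed

lemma dev_image_borel:
  assumes T: "T \<in> \<T>" and A: "A \<in> sets borelX" "A \<subseteq> T"
  shows "dev ` A \<in> sets borel"
proof -
  have "{b \<in> B. inv_into T dev b \<in> A} \<in> sets borel"
  proof (rule measurable_of_openin[OF B_borel _ _ A(1)])
    show "inv_into T dev b \<in> topspace X" if "b \<in> B" for b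
      using sec(1)[OF T that] tile_subset[OF T] by blast
    fix U assume "openin X U"
    then have "openin (top_of_set B) {b \<in> B. inv_into T dev b \<in> U}"
      using openin_continuous_map_preimage[OF continuous_sec[OF T]] by force
    then show "{b \<in> B. inv_into T dev b \<in> U} \<in> sets borel"
      using B_borel by (auto simp: openin_open)
  qed
  moreover have "{b \<in> B. inv_into T dev b \<in> A} = dev ` A"
  proof
    show "{b \<in> B. inv_into T dev b \<in> A} \<subseteq> dev ` A" using sec(2)[OF T] by force
    show "dev ` A \<subseteq> {b \<in> B. inv_into T dev b \<in> A}"
      using A(2) sec_dev[OF T] dev_in_B tile_subset[OF T] by auto
  qed
  ultimately show ?thesis by simp
qed

lemma chart_image_borel:
  assumes ch: "isometric_chart X dst U \<phi>" and A: "A \<in> sets borelX" "A \<subseteq> U"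
  shows "\<phi> ` A \<in> sets borel" "inj_on \<phi> U"
proof -
  have U: "openin X U" "open (\<phi> ` U)" "\<phi> ` U \<subseteq> H3"
    and iso: "\<And>x y. x \<in> U \<Longrightarrow> y \<in> U \<Longrightarrow> H3_dist (\<phi> x) (\<phi> y) = dst x y"
    using ch by (auto simp: isometric_chart_def)
  have UX: "U \<subseteq> topspace X" using U(1) openin_subset by blast
  show inj: "inj_on \<phi> U"
  proof
    fix x y assume xy: "x \<in> U" "y \<in> U" "\<phi> x = \<phi> y"
    then have "dst x y = 0" using iso[OF xy(1,2)] U(3) by auto
    then show "x = y" using M.zero xy UX by blast
  qed
  have im: "{c \<in> \<phi> ` U. inv_into U \<phi> c \<in> W} = \<phi> ` (U \<inter> W)" for W
    using inj by (auto simp: image_iff)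
  have "{c \<in> \<phi> ` U. inv_into U \<phi> c \<in> A} \<in> sets borel"
  proof (rule measurable_of_openin[OF _ _ _ A(1)])
    show "inv_into U \<phi> c \<in> topspace X" if "c \<in> \<phi> ` U" for c
      using that UX by (meson inv_into_into subsetD)
    fix W assume W: "openin X W"
    have "open (\<phi> ` (U \<inter> W))"
      unfolding open_dist
    proof
      fix c assume "c \<in> \<phi> ` (U \<inter> W)"
      then obtain x where x: "x \<in> U" "x \<in> W" "c = \<phi> x" by blast
      have "openin M.mtopology W" using W mtopology_dst by simp
      then obtain \<rho> where \<rho>: "\<rho> > 0" "M.mball x \<rho> \<subseteq> W" using x(2) by (auto simp: M.openin_mtopology)
      obtain e where e: "e > 0" "\<And>y. dist y c < e \<Longrightarrow> y \<in> \<phi> ` U"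
        using U(2) x unfolding open_dist by blast
      obtain \<delta> where \<delta>: "\<delta> > 0" "\<And>y. dist c y < \<delta> \<Longrightarrow> y \<in> H3 \<and> H3_dist c y < \<rho>"
        using H3_ball_large[of c \<rho>] U(3) x \<rho>(1) by blast
      have "y \<in> \<phi> ` (U \<inter> W)" if y: "dist y c < min e \<delta>" for y
      proof -
        obtain z where z: "z \<in> U" "y = \<phi> z" using e(2)[of y] y by auto
        have "dst x z < \<rho>" using \<delta>(2)[of y] y iso[OF x(1) z(1)] by (simp add: dist_commute x z)
        then have "z \<in> W" using \<rho>(2) UX x(1) z(1) by (auto simp: subset_iff)
        then show ?thesis using z by blast
      qed
      then show "\<exists>e>0. \<forall>y. dist y c < e \<longrightarrow> y \<in> \<phi> ` (U \<inter> W)"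
        using e(1) \<delta>(1) by (intro exI[of _ "min e \<delta>"]) auto
    qed
    then show "{c \<in> \<phi> ` U. inv_into U \<phi> c \<in> W} \<in> sets borel" unfolding im by simp
  qed (use U(2) in simp)
  moreover have "U \<inter> A = A" using A(2) by blast
  ultimately show "\<phi> ` A \<in> sets borel" unfolding im by simp
qed

text \<open>The measure adds up hyperbolic volumes of developed pieces, one piece for each tile. An
  arbitrary chart agrees with it since, on each piece, chart and developing map differ by an
  isometry between Borel sets.\<close>

theorem finite_volume:
  assumes fin: "emeasure H3_volume B < \<infinity>"
    and B0: "B0 \<in> sets borel" "B0 \<subseteq> B"
    and interior: "\<And>T T' x. T \<in> \<T> \<Longrightarrow> T' \<in> \<T> \<Longrightarrow> x \<in> T \<Longrightarrow> x \<in> T' \<Longrightarrow> dev x \<in> B0 \<Longrightarrow> T = T'"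
  shows "\<exists>v. has_finite_hyperbolic_volume X dst v \<and> card \<T> * measure H3_volume B0 \<le> v"
proof -
  obtain e where e: "bij_betw e {0..<card \<T>} \<T>"
    using ex_bij_betw_nat_finite[OF finite_tiles] by blast
  define m where "m = card \<T>"
  have eT: "e i \<in> \<T>" if "i < m" for i using e that by (auto simp: bij_betw_def m_def)
  have e_inj: "i = j" if "i < m" "j < m" "e i = e j" for i j
    using e that by (auto simp: bij_betw_def m_def inj_on_def)
  \<comment> \<open>Points on common faces go to the first tile that contains them. The pieces
    become disjoint, and faces need not be shown to be null.\<close>
  define P where "P i = e i - (\<Union>j<i. e j)" for i
  have P_sub: "P i \<subseteq> e i" for i by (auto simp: P_def)
  have P_sets: "P i \<in> sets borelX" if "i < m" for i
    unfolding P_def using that eT tile_in_borelX by (intro sets.Diff sets.finite_UN) auto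
  have P_disj: "x \<in> P i \<Longrightarrow> x \<in> P j \<Longrightarrow> i = j" for x i j
    by (metis DiffD1 DiffD2 P_def UN_I lessThan_iff linorder_neqE_nat)
  have P_cover: "(\<Union>i<m. P i) = topspace X"
  proof
    show "(\<Union>i<m. P i) \<subseteq> topspace X" using P_sub eT tile_subset by blast
    show "topspace X \<subseteq> (\<Union>i<m. P i)"
    proof
      fix x assume "x \<in> topspace X"
      then obtain T where "T \<in> \<T>" "x \<in> T" using cover by blast
      then obtain i where i: "i < m" "x \<in> e i"
        using e unfolding bij_betw_def m_def by (metis atLeastLessThan_iff imageE)
      define k where "k = (LEAST i. x \<in> e i)"
      have "x \<in> e k" "k \<le> i" using i(2) unfolding k_def by (auto intro: LeastI Least_le)
      moreover have "x \<notin> e j" if "j < k" for j using that not_less_Least unfolding k_def by blast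
      ultimately show "x \<in> (\<Union>i<m. P i)" using i(1) by (auto simp: P_def)
    qed
  qed
  have dev_inj: "inj_on dev (e i)" if "i < m" for i using bij_dev[OF eT[OF that]] by (simp add: bij_betw_def)
  define \<nu> where "\<nu> A = (\<Sum>i<m. emeasure H3_volume (dev ` (A \<inter> P i)))" for A
  have sets_vol: "sets H3_volume = sets borel" by (simp add: H3_volume_def)
  have dev_sets: "dev ` (A \<inter> P i) \<in> sets borel" if "A \<in> sets borelX" "i < m" for A i
    using that P_sets P_sub by (intro dev_image_borel[OF eT[OF that(2)]]) auto
  define \<mu> where "\<mu> = measure_of (topspace X) {U. openin X U} \<nu>"
  have sets_\<mu>: "sets \<mu> = sets borelX" by (simp add: \<mu>_def borelX_def sets_measure_of_conv)
  have space_\<mu>: "space \<mu> = topspace X" by (simp add: \<mu>_def space_measure_of_conv)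
  have em: "emeasure \<mu> A = \<nu> A" if "A \<in> sets borelX" for A
  proof (rule emeasure_measure_of[OF \<mu>_def])
    show "positive (sets \<mu>) \<nu>" by (simp add: positive_def \<nu>_def)
    show "countably_additive (sets \<mu>) \<nu>"
      unfolding countably_additive_def sets_\<mu>
    proof (intro allI impI)
      fix F :: "nat \<Rightarrow> 'a set" assume F: "range F \<subseteq> sets borelX" "disjoint_family F"
      have "(\<Sum>n. \<nu> (F n)) = (\<Sum>i<m. \<Sum>n. emeasure H3_volume (dev ` (F n \<inter> P i)))"
        unfolding \<nu>_def by (rule suminf_sum) simp
      also have "\<dots> = (\<Sum>i<m. emeasure H3_volume (dev ` ((\<Union>n. F n) \<inter> P i)))"
      proof (rule sum.cong[OF HOL.refl])
        fix i assume "i \<in> {..<m}"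
        then have i: "i < m" by simp
        have "(\<Sum>n. emeasure H3_volume (dev ` (F n \<inter> P i))) = emeasure H3_volume (\<Union>n. dev ` (F n \<inter> P i))"
        proof (rule suminf_emeasure)
          show "range (\<lambda>n. dev ` (F n \<inter> P i)) \<subseteq> sets H3_volume"
            unfolding sets_vol using F(1) dev_sets[OF _ i] by blast
          show "disjoint_family (\<lambda>n. dev ` (F n \<inter> P i))"
            unfolding disjoint_family_on_def
          proof (intro ballI impI)
            fix a b :: nat assume "a \<noteq> b"
            then have "F a \<inter> F b = {}" using F(2) by (auto simp: disjoint_family_on_def)
            moreover have "dev ` (F a \<inter> P i) \<inter> dev ` (F b \<inter> P i) = dev ` ((F a \<inter> P i) \<inter> (F b \<inter> P i))"
              using inj_on_image_Int[OF dev_inj[OF i], of "F a \<inter> P i" "F b \<inter> P i"] P_sub[of i] by blast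
            ultimately show "dev ` (F a \<inter> P i) \<inter> dev ` (F b \<inter> P i) = {}" by auto
          qed
        qed
        also have "(\<Union>n. dev ` (F n \<inter> P i)) = dev ` ((\<Union>n. F n) \<inter> P i)" by auto
        finally show "(\<Sum>n. emeasure H3_volume (dev ` (F n \<inter> P i))) = emeasure H3_volume (dev ` ((\<Union>n. F n) \<inter> P i))" .
      qed
      finally show "(\<Sum>n. \<nu> (F n)) = \<nu> (\<Union> (range F))" by (simp add: \<nu>_def)
    qed
    show "A \<in> sets \<mu>" using that sets_\<mu> by simp
  qed (auto dest: openin_subset)
  have hv: "hyperbolic_volume_measure X dst \<mu>"
    unfolding hyperbolic_volume_measure_def
  proof (intro conjI allI impI ballI)
    show "space \<mu> = topspace X" by (rule space_\<mu>)
    show "sets \<mu> = sigma_sets (topspace X) {U. openin X U}" by (simp add: sets_\<mu> sets_borelX)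
    fix U \<phi> A assume ch: "isometric_chart X dst U \<phi>" and "A \<in> sets \<mu>" and AU: "A \<subseteq> U"
    then have A: "A \<in> sets borelX" using sets_\<mu> by simp
    have U: "\<phi> ` U \<subseteq> H3" and iso: "\<And>x y. x \<in> U \<Longrightarrow> y \<in> U \<Longrightarrow> H3_dist (\<phi> x) (\<phi> y) = dst x y"
      using ch by (auto simp: isometric_chart_def)
    have UX: "U \<subseteq> topspace X" using ch openin_subset by (auto simp: isometric_chart_def)
    have img: "\<phi> ` (A \<inter> P i) \<in> sets borel" if "i < m" for i
      using chart_image_borel(1)[OF ch, of "A \<inter> P i"] A AU P_sets[OF that] by blast
    have "\<nu> A = (\<Sum>i<m. emeasure H3_volume (\<phi> ` (A \<inter> P i)))"
      unfolding \<nu>_def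
    proof (rule sum.cong[OF HOL.refl])
      fix i assume "i \<in> {..<m}"
      then have i: "i < m" by simp
      \<comment> \<open>The comparison of the chart with the developing map; it is isometric on the
        developed piece because \<open>dst\<close> is exact inside a tile.\<close>
      define \<psi> where "\<psi> = \<phi> \<circ> inv_into (e i) dev"
      have \<psi>: "\<psi> (dev x) = \<phi> x" if "x \<in> e i" for x
        using sec_dev[OF eT[OF i] that] by (simp add: \<psi>_def)
      have im: "\<psi> ` (dev ` (A \<inter> P i)) = \<phi> ` (A \<inter> P i)"
        unfolding image_image by (intro image_cong HOL.refl \<psi>) (use P_sub in auto)
      have "emeasure H3_volume (\<psi> ` (dev ` (A \<inter> P i))) = emeasure H3_volume (dev ` (A \<inter> P i))"
      proof (rule H3_volume_isometry)
        show "dev ` (A \<inter> P i) \<in> sets borel" using dev_sets[OF A i] .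
        show "dev ` (A \<inter> P i) \<subseteq> H3" using dev_in_H3 AU UX by blast
        show "\<psi> ` (dev ` (A \<inter> P i)) \<in> sets borel" unfolding im using img[OF i] .
        show "\<psi> ` (dev ` (A \<inter> P i)) \<subseteq> H3" unfolding im using U AU by blast
        fix b b' assume "b \<in> dev ` (A \<inter> P i)" "b' \<in> dev ` (A \<inter> P i)"
        then obtain x x' where x: "x \<in> A" "x \<in> e i" "b = dev x" "x' \<in> A" "x' \<in> e i" "b' = dev x'"
          using P_sub by blast
        have "H3_dist (\<phi> x) (\<phi> x') = dst x x'" using iso x AU by blast
        then show "H3_dist (\<psi> b) (\<psi> b') = H3_dist b b'"
          using \<psi> dst_tile[OF eT[OF i]] x by simp
      qed
      then show "emeasure H3_volume (dev ` (A \<inter> P i)) = emeasure H3_volume (\<phi> ` (A \<inter> P i))"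
        unfolding im by simp
    qed
    also have "\<dots> = emeasure H3_volume (\<Union>i<m. \<phi> ` (A \<inter> P i))"
    proof (rule sum_emeasure)
      show "(\<lambda>i. \<phi> ` (A \<inter> P i)) ` {..<m} \<subseteq> sets H3_volume" unfolding sets_vol using img by blast
      show "disjoint_family_on (\<lambda>i. \<phi> ` (A \<inter> P i)) {..<m}"
        unfolding disjoint_family_on_def
      proof (intro ballI impI equals0I)
        fix i j c assume "i \<noteq> j" "c \<in> \<phi> ` (A \<inter> P i) \<inter> \<phi> ` (A \<inter> P j)"
        then show False
          using P_disj chart_image_borel(2)[OF ch A AU] AU by (auto dest!: inj_onD)
      qed
    qed simp
    also have "(\<Union>i<m. \<phi> ` (A \<inter> P i)) = \<phi> ` (A \<inter> (\<Union>i<m. P i))" by blast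
    also have "A \<inter> (\<Union>i<m. P i) = A" using P_cover AU UX by blast
    finally show "emeasure \<mu> A = emeasure H3_volume (\<phi> ` A)" using em[OF A] by simp
  qed
  have top: "topspace X \<in> sets borelX" using sets.top[of borelX] by simp
  have each: "emeasure H3_volume (dev ` (topspace X \<inter> P i)) \<le> emeasure H3_volume B" if "i < m" for i
    using dev_in_B B_borel by (intro emeasure_mono) (auto simp: sets_vol)
  have fin\<nu>: "\<nu> (topspace X) < \<infinity>"
  proof -
    have "emeasure H3_volume (dev ` (topspace X \<inter> P i)) < top" if "i < m" for i
      using le_less_trans[OF each[OF that] fin] by simp
    then show ?thesis unfolding \<nu>_def by simp
  qed
  have low: "emeasure H3_volume B0 \<le> emeasure H3_volume (dev ` (topspace X \<inter> P i))" if i: "i < m" for i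
  proof (rule emeasure_mono)
    show "B0 \<subseteq> dev ` (topspace X \<inter> P i)"
    proof
      fix b assume b: "b \<in> B0"
      define x where "x = inv_into (e i) dev b"
      have x: "x \<in> e i" "dev x = b" using sec[OF eT[OF i], of b] b B0(2) by (auto simp: x_def)
      \<comment> \<open>A point over \<open>B0\<close> lies in a single tile, so every piece keeps a
        full copy of \<open>B0\<close>.\<close>
      have "x \<notin> e j" if "j < i" for j
        using interior[OF eT[OF i] eT[of j] x(1)] e_inj[of i j] that i x(2) b by auto
      then have "x \<in> P i" using x(1) by (simp add: P_def)
      moreover have "x \<in> topspace X" using x(1) tile_subset[OF eT[OF i]] by blast
      ultimately show "b \<in> dev ` (topspace X \<inter> P i)" using x(2) by blast
    qed
    show "dev ` (topspace X \<inter> P i) \<in> sets H3_volume" using dev_sets[OF top i] sets_vol by simp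
  qed
  have fm: "finite_measure \<mu>"
    by (rule finite_measureI) (use fin\<nu> em[OF top] space_\<mu> in auto)
  have B0fin: "emeasure H3_volume B0 \<noteq> \<infinity>"
    using emeasure_mono[OF B0(2), of H3_volume] B_borel fin by (auto simp: sets_vol top_unique)
  have "of_nat m * emeasure H3_volume B0 \<le> \<nu> (topspace X)"
    unfolding \<nu>_def using sum_mono[of "{..<m}" "\<lambda>_. emeasure H3_volume B0"] low by simp
  then have "ennreal (m * measure H3_volume B0) \<le> ennreal (measure \<mu> (topspace X))"
    using em[OF top] B0fin finite_measure.emeasure_eq_measure[OF fm]
    by (simp add: emeasure_eq_ennreal_measure ennreal_mult ennreal_of_nat_eq_real_of_nat)
  then have "m * measure H3_volume B0 \<le> measure \<mu> (topspace X)"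
    by (simp add: ennreal_le_iff)
  then show ?thesis
    unfolding has_finite_hyperbolic_volume_def m_def using hv fm by blast
qed

end

section \<open>The right-angled triangular bipyramid\<close>

text \<open>The faces \<open>(i, False)\<close> meet at one apex and the faces \<open>(i, True)\<close> at the other. Under the
  homeomorphism below they become the faces where the \<open>i\<close>-th coordinate of the unit cube is
  \<open>0\<close> and \<open>1\<close>, and the three ideal vertices become three pairwise skew edges.\<close>

definition wall :: "3 \<Rightarrow> bool \<Rightarrow> real^4" where
  "wall i e =
    (if i = 1 then if e then vec4 (- 1) 0 0 (- 2) else vec4 1 0 0 0
     else if i = 2 then if e then vec4 (- 1) 0 (- 1) 0 else vec4 0 (- 1) 0 (- 2)
     else if e then vec4 0 1 0 0 else vec4 0 (- 1) (- 1) 0)"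

definition bipyramid :: "(real^3) set" where
  "bipyramid = {p \<in> H3. \<forall>i e. lor (hyp p) (wall i e) \<ge> 0}"

definition ideal_edge :: "real^3 \<Rightarrow> bool" where
  "ideal_edge u \<longleftrightarrow> u$2 = 0 \<and> u$3 = 1 \<or> u$3 = 0 \<and> u$1 = 1 \<or> u$1 = 0 \<and> u$2 = 1"

definition cube :: "(real^3) set" where
  "cube = {u. (\<forall>i. 0 \<le> u$i \<and> u$i \<le> 1) \<and> \<not> ideal_edge u}"

text \<open>The product with a unit normal is sinh of the signed distance to the wall. Each
  coordinate weighs two opposite walls against each other, so that it is 0 on one and 1 on the
  other.\<close>

definition to_cube :: "real^3 \<Rightarrow> real^3" where
  "to_cube p = (\<chi> i. lor (hyp p) (wall i False) / (lor (hyp p) (wall i False) + lor (hyp p) (wall i True)))"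

text \<open>Found by solving \<open>to_cube p = u\<close>: the first coordinate is unchanged,
  \<open>y\<close> is the second, and \<open>2 * E / D\<close> is the squared Euclidean norm of
  \<open>p\<close>, which yields the height.\<close>

definition of_cube :: "real^3 \<Rightarrow> real^3" where
  "of_cube u = (let D = 1 - u$3 * (1 - u$2); E = 1 - u$2 * (1 - u$1); y = (1 - u$3) * E / D in
     vector [u$1, y, sqrt (2 * E / D - (u$1)\<^sup>2 - y\<^sup>2)])"

lemma lor_wall:
  assumes "p \<in> H3"
  defines "q \<equiv> (p$1)\<^sup>2 + (p$2)\<^sup>2 + (p$3)\<^sup>2"
  shows "lor (hyp p) (wall 1 False) = p$1 / p$3" "lor (hyp p) (wall 1 True) = (1 - p$1) / p$3"
    "lor (hyp p) (wall 2 False) = (1 - p$2) / p$3" "lor (hyp p) (wall 2 True) = (q - 2 * p$1) / (2 * p$3)"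
    "lor (hyp p) (wall 3 False) = (q - 2 * p$2) / (2 * p$3)" "lor (hyp p) (wall 3 True) = p$2 / p$3"
  by (simp_all add: lor_def hyp_nth wall_def q_def diff_divide_distrib)

lemma lor_wall_self: "lor (wall i e) (wall i e) = 1"
  by (simp add: lor_def wall_def)

text \<open>The excluded combination, \<open>e\<close> false and \<open>f\<close> true, is the pair
  of walls whose cube faces meet in an ideal edge. These walls are tangent at an ideal vertex; all
  other adjacent walls are perpendicular.\<close>

lemma lor_wall_orthogonal:
  assumes "e \<or> \<not> f"
  shows "lor (wall 1 e) (wall 2 f) = 0" "lor (wall 2 e) (wall 3 f) = 0" "lor (wall 3 e) (wall 1 f) = 0"
  using assms by (cases e; cases f; simp add: lor_def wall_def)+

text \<open>In coordinates, the vertical prism over the unit square, outside the unit hemispheres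
  centred at (1,0,0) and (0,1,0). The ideal vertices are infinity, (0,0,0) and (1,1,0); the two
  apexes are (0,1,1) and (1,0,1).\<close>

lemma bipyramid_iff:
  "p \<in> bipyramid \<longleftrightarrow> p$3 > 0 \<and> 0 \<le> p$1 \<and> p$1 \<le> 1 \<and> 0 \<le> p$2 \<and> p$2 \<le> 1 \<and>
     2 * p$1 \<le> (p$1)\<^sup>2 + (p$2)\<^sup>2 + (p$3)\<^sup>2 \<and> 2 * p$2 \<le> (p$1)\<^sup>2 + (p$2)\<^sup>2 + (p$3)\<^sup>2"
proof (cases "p \<in> H3")
  case True
  then show ?thesis
    by (auto simp: bipyramid_def forall_3 all_bool_eq lor_wall H3_iff zero_le_divide_iff)
qed (auto simp: bipyramid_def H3_iff)

lemma bipyramid_H3: "bipyramid \<subseteq> H3"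
  by (auto simp: bipyramid_def)

lemma closedin_bipyramid: "closedin (top_of_set H3) bipyramid"
proof -
  define C :: "(real^3) set" where "C = {p. 0 \<le> p$1 \<and> p$1 \<le> 1 \<and> 0 \<le> p$2 \<and> p$2 \<le> 1 \<and>
     2 * p$1 \<le> (p$1)\<^sup>2 + (p$2)\<^sup>2 + (p$3)\<^sup>2 \<and> 2 * p$2 \<le> (p$1)\<^sup>2 + (p$2)\<^sup>2 + (p$3)\<^sup>2}"
  have "closed C"
    unfolding C_def by (intro closed_Collect_conj closed_Collect_le continuous_intros)
  moreover have "bipyramid = H3 \<inter> C"
    by (auto simp: bipyramid_iff C_def H3_iff)
  ultimately show ?thesis by (auto simp: closedin_closed)
qed

lemma convex_bipyramid:
  assumes "p \<in> bipyramid" "q \<in> bipyramid" "c \<in> H3" "a \<ge> 0" "b \<ge> 0" "hyp c = a *\<^sub>R hyp p + b *\<^sub>R hyp q"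
  shows "c \<in> bipyramid"
  using assms by (simp add: bipyramid_def)

text \<open>Opposite walls have no common point in the bipyramid, so the denominators of
  \<open>to_cube\<close> do not vanish.\<close>

lemma wall_sum_pos:
  assumes p: "p \<in> bipyramid"
  shows "lor (hyp p) (wall i False) + lor (hyp p) (wall i True) > 0"
proof -
  have b: "p$3 > 0" "0 \<le> p$1" "p$1 \<le> 1" "0 \<le> p$2" "p$2 \<le> 1" and H: "p \<in> H3"
    and q: "2 * p$1 \<le> (p$1)\<^sup>2 + (p$2)\<^sup>2 + (p$3)\<^sup>2" "2 * p$2 \<le> (p$1)\<^sup>2 + (p$2)\<^sup>2 + (p$3)\<^sup>2"
    using p by (auto simp: bipyramid_iff H3_iff)
  consider "i = 1" | "i = 2" | "i = 3" using exhaust_3 by blast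
  then show ?thesis
  proof cases
    case 1
    then show ?thesis using b by (simp add: lor_wall[OF H] flip: add_divide_distrib)
  next
    case 2
    have "2 * (1 - p$2) + ((p$1)\<^sup>2 + (p$2)\<^sup>2 + (p$3)\<^sup>2 - 2 * p$1) > 0"
    proof (cases "p$2 < 1")
      case False
      then have "p$2 = 1" using b by simp
      then have "2 * (1 - p$2) + ((p$1)\<^sup>2 + (p$2)\<^sup>2 + (p$3)\<^sup>2 - 2 * p$1) = (1 - p$1)\<^sup>2 + (p$3)\<^sup>2"
        by (simp add: power2_eq_square algebra_simps)
      moreover have "(1 - p$1)\<^sup>2 + (p$3)\<^sup>2 > 0" using b by (simp add: add_nonneg_pos)
      ultimately show ?thesis by simp
    qed (use q in simp)
    moreover have "lor (hyp p) (wall 2 False) + lor (hyp p) (wall 2 True) =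
        (2 * (1 - p$2) + ((p$1)\<^sup>2 + (p$2)\<^sup>2 + (p$3)\<^sup>2 - 2 * p$1)) / (2 * p$3)"
      using b by (simp add: lor_wall[OF H] field_simps)
    ultimately show ?thesis using b 2 by simp
  next
    case 3
    have "(p$1)\<^sup>2 + (p$2)\<^sup>2 + (p$3)\<^sup>2 > 0" using b by (simp add: add_nonneg_pos)
    moreover have "lor (hyp p) (wall 3 False) + lor (hyp p) (wall 3 True) =
        ((p$1)\<^sup>2 + (p$2)\<^sup>2 + (p$3)\<^sup>2) / (2 * p$3)"
      using b by (simp add: lor_wall[OF H] field_simps)
    ultimately show ?thesis using b 3 by simp
  qed
qed

lemma to_cube_eq_iff:
  assumes p: "p \<in> bipyramid"
  shows "to_cube p $ i = 0 \<longleftrightarrow> lor (hyp p) (wall i False) = 0"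
    "to_cube p $ i = 1 \<longleftrightarrow> lor (hyp p) (wall i True) = 0"
    "0 \<le> to_cube p $ i" "to_cube p $ i \<le> 1"
proof -
  have "lor (hyp p) (wall i False) \<ge> 0" "lor (hyp p) (wall i True) \<ge> 0" using p by (auto simp: bipyramid_def)
  then show "to_cube p $ i = 0 \<longleftrightarrow> lor (hyp p) (wall i False) = 0"
    "to_cube p $ i = 1 \<longleftrightarrow> lor (hyp p) (wall i True) = 0"
    "0 \<le> to_cube p $ i" "to_cube p $ i \<le> 1"
    using wall_sum_pos[OF p, of i] by (auto simp: to_cube_def)
qed

text \<open>The two walls belonging to an ideal edge touch only at an ideal vertex: a common point
  would have height 0 or, for the vertex at infinity, satisfy contradictory equations.\<close>

lemma to_cube_in_cube:
  assumes p: "p \<in> bipyramid"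
  shows "to_cube p \<in> cube"
proof -
  have b: "p$3 > 0" "0 \<le> p$1" "p$1 \<le> 1" "0 \<le> p$2" "p$2 \<le> 1" and H: "p \<in> H3"
    using p by (auto simp: bipyramid_iff H3_iff)
  have "\<not> ideal_edge (to_cube p)"
  proof
    assume "ideal_edge (to_cube p)"
    then consider "p$2 = 1" "p$2 = 0" | "(p$1)\<^sup>2 + (p$2)\<^sup>2 + (p$3)\<^sup>2 = 2 * p$2" "p$1 = 1"
      | "p$1 = 0" "(p$1)\<^sup>2 + (p$2)\<^sup>2 + (p$3)\<^sup>2 = 2 * p$1"
      unfolding ideal_edge_def to_cube_eq_iff[OF p] lor_wall[OF H] using b by auto
    then show False
    proof cases
      case 2
      then have "(1 - p$2)\<^sup>2 + (p$3)\<^sup>2 = 0" by (simp add: power2_eq_square algebra_simps)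
      then show False using b by (simp add: add_nonneg_eq_0_iff)
    next
      case 3
      then show False using b by (simp add: add_nonneg_eq_0_iff)
    qed simp
  qed
  then show ?thesis using to_cube_eq_iff[OF p] by (simp add: cube_def)
qed

lemma of_to_cube:
  assumes p: "p \<in> bipyramid"
  shows "of_cube (to_cube p) = p"
proof -
  define x y z q where "x = p$1" and "y = p$2" and "z = p$3" and "q = x\<^sup>2 + y\<^sup>2 + z\<^sup>2"
  have H: "p \<in> H3" using p bipyramid_H3 by blast
  have b: "z > 0" "0 \<le> x" "x \<le> 1" "0 \<le> y" "y \<le> 1"
    using p by (auto simp: bipyramid_iff x_def y_def z_def)
  define S where "S = 2 - 2 * y + q - 2 * x"
  have S: "S > 0"
  proof -
    have "lor (hyp p) (wall 2 False) + lor (hyp p) (wall 2 True) = S / (2 * z)"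
      using b unfolding lor_wall[OF H] S_def q_def x_def y_def z_def by (simp add: field_simps)
    then show ?thesis using wall_sum_pos[OF p, of 2] b by (simp add: zero_less_divide_iff)
  qed
  \<comment> \<open>This sum of squares is the factor \<open>q - 2 * x * y\<close> common to
    \<open>D\<close> and \<open>E\<close>, which cancels in \<open>E / D\<close>.\<close>
  have "(x - y)\<^sup>2 + z\<^sup>2 > 0" using b by (simp add: add_nonneg_pos)
  then have qxy: "q - 2 * x * y > 0" by (simp add: q_def power2_eq_square algebra_simps)
  have q: "q > 0" using b by (simp add: q_def add_nonneg_pos)
  have c: "to_cube p $ 1 = x" "to_cube p $ 2 = (2 - 2 * y) / S" "to_cube p $ 3 = 1 - 2 * y / q"
    using b S q unfolding to_cube_def S_def
    by (simp_all add: lor_wall[OF H] x_def[symmetric] y_def[symmetric] z_def[symmetric] q_def[symmetric] divide_simps)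
       (simp_all add: algebra_simps)
  define D E where "D = 1 - to_cube p $ 3 * (1 - to_cube p $ 2)" and "E = 1 - to_cube p $ 2 * (1 - to_cube p $ 1)"
  have E: "E = (q - 2 * x * y) / S"
    using S by (simp add: E_def c divide_simps) (simp add: S_def algebra_simps)
  have D: "D = 2 * (q - 2 * x * y) / (q * S)"
    using S q by (simp add: D_def c divide_simps) (simp add: S_def algebra_simps)
  have ED: "E / D = q / 2" using S q qxy by (simp add: E D divide_simps)
  have y': "(1 - to_cube p $ 3) * E / D = y"
  proof -
    have "(1 - to_cube p $ 3) * E / D = 2 * y / q * (E / D)" by (simp add: c)
    then show ?thesis using q by (simp only: ED) simp
  qed
  have "2 * E / D = 2 * (E / D)" by simp
  also have "\<dots> = q" unfolding ED by simp
  finally have EDq: "2 * E / D = q" .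
  have "of_cube (to_cube p) = vector [x, y, sqrt (q - x\<^sup>2 - y\<^sup>2)]"
    unfolding of_cube_def Let_def D_def[symmetric] E_def[symmetric] y' EDq by (simp add: c)
  also have "q - x\<^sup>2 - y\<^sup>2 = z\<^sup>2" by (simp add: q_def)
  also have "vector [x, y, sqrt (z\<^sup>2)] = p" using b by (simp add: vec3_eq_iff x_def y_def z_def)
  finally show ?thesis .
qed

section \<open>The inverse homeomorphism on the cube\<close>

context
  fixes u :: "real^3" and X Y Z D E F y z :: real
  assumes u: "u \<in> cube"
  defines "X \<equiv> u$1" and "Y \<equiv> u$2" and "Z \<equiv> u$3"
  defines "D \<equiv> 1 - Z * (1 - Y)" and "E \<equiv> 1 - Y * (1 - X)" and "F \<equiv> 1 - X * (1 - Z)"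
  defines "y \<equiv> (1 - Z) * E / D"
  defines "z \<equiv> sqrt (2 * E / D - X\<^sup>2 - y\<^sup>2)"
begin

lemma cube_bounds: "0 \<le> X" "X \<le> 1" "0 \<le> Y" "Y \<le> 1" "0 \<le> Z" "Z \<le> 1"
  using u by (simp_all add: cube_def X_def Y_def Z_def)

lemma cube_pos_aux:
  assumes "0 \<le> (a::real)" "a \<le> 1" "0 \<le> b" "b \<le> 1" "\<not> (a = 1 \<and> b = 0)"
  shows "1 - a * (1 - b) > 0" "1 - a * (1 - b) \<le> 1"
proof -
  have "a * (1 - b) \<le> a" using assms mult_left_mono[of "1 - b" 1 a] by simp
  moreover have "a * (1 - b) \<le> 1 - b" using assms mult_right_mono[of a 1 "1 - b"] by simp
  moreover have "a < 1 \<or> 1 - b < 1" using assms by auto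
  ultimately show "1 - a * (1 - b) > 0" by linarith
  show "1 - a * (1 - b) \<le> 1" using assms by simp
qed

text \<open>Within the closed unit cube each of \<open>D\<close>, \<open>E\<close> and
  \<open>F\<close> vanishes on one ideal edge only, and \<open>cube\<close> omits these
  edges.\<close>

lemma cube_DEF: "D > 0" "D \<le> 1" "E > 0" "E \<le> 1" "F > 0"
proof -
  have "\<not> (Z = 1 \<and> Y = 0)" "\<not> (Y = 1 \<and> X = 0)" "\<not> (X = 1 \<and> Z = 0)"
    using u by (auto simp: cube_def ideal_edge_def X_def Y_def Z_def)
  then show "D > 0" "D \<le> 1" "E > 0" "E \<le> 1" "F > 0"
    using cube_pos_aux[of Z Y] cube_pos_aux[of Y X] cube_pos_aux[of X Z] cube_bounds
    unfolding D_def E_def F_def by blast+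
qed

text \<open>The left sides are \<open>D\<close> times \<open>1 - y\<close> and \<open>D\<close>
  times half the squared norm minus \<open>X\<close>; the right sides show that these two wall
  inequalities hold.\<close>

lemma cube_identities: "D - (1 - Z) * E = Y * F" "E - X * D = (1 - Y) * F"
  by (simp_all add: D_def E_def F_def algebra_simps)

text \<open>Multiplied by \<open>D\<^sup>2\<close>, the squared height splits into the expressions
  \<open>A\<close> and \<open>B\<close>, each a sum of nonnegative products. The cases for
  \<open>X\<close> and \<open>Z\<close> find one product that is positive.\<close>

lemma cube_z_pos: "2 * E / D - X\<^sup>2 - y\<^sup>2 > 0"
proof -
  note b = cube_bounds and p = cube_DEF
  have 1: "D * (E - X * D) \<ge> 0" "E * (D - (1 - Z) * E) \<ge> 0" "X * (1 - X) * (D * D) \<ge> 0" "Z * (1 - Z) * (E * E) \<ge> 0"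
    unfolding cube_identities using b p by simp_all
  have A: "E * D - (X * D)\<^sup>2 = D * (E - X * D) + X * (1 - X) * (D * D)"
    by (simp add: power2_eq_square algebra_simps)
  have B: "E * D - ((1 - Z) * E)\<^sup>2 = E * (D - (1 - Z) * E) + Z * (1 - Z) * (E * E)"
    by (simp add: power2_eq_square algebra_simps)
  have "(E * D - (X * D)\<^sup>2) + (E * D - ((1 - Z) * E)\<^sup>2) > 0"
  proof (cases "X = 0 \<or> X = 1")
    case False
    then have "X * (1 - X) * (D * D) > 0" using b p by simp
    then show ?thesis using A B 1 by linarith
  next
    case True
    show ?thesis
    proof (cases "X = 0")
      case True
      then have "D * (E - X * D) > 0" using p by simp
      then show ?thesis using A B 1 by linarith
    next
      case False
      with \<open>X = 0 \<or> X = 1\<close> have X: "X = 1" by simp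
      then have "Z > 0" using u b by (auto simp: cube_def ideal_edge_def X_def Z_def less_le)
      show ?thesis
      proof (cases "Z = 1")
        case True
        then have "E * (D - (1 - Z) * E) > 0" using p by simp
        then show ?thesis using A B 1 by linarith
      next
        case False
        then have "Z * (1 - Z) * (E * E) > 0" using \<open>Z > 0\<close> b p by simp
        then show ?thesis using A B 1 by linarith
      qed
    qed
  qed
  moreover have "2 * E / D - X\<^sup>2 - y\<^sup>2 = ((E * D - (X * D)\<^sup>2) + (E * D - ((1 - Z) * E)\<^sup>2)) / D\<^sup>2"
    using p(1) by (simp add: y_def power2_eq_square divide_simps) (simp add: algebra_simps)
  ultimately show ?thesis using p(1) by simp
qed

lemma of_cube_nth: "of_cube u $ 1 = X" "of_cube u $ 2 = y" "of_cube u $ 3 = z"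
  by (simp_all add: of_cube_def Let_def X_def Y_def Z_def D_def E_def y_def z_def)

lemma of_cube_q: "(of_cube u $ 1)\<^sup>2 + (of_cube u $ 2)\<^sup>2 + (of_cube u $ 3)\<^sup>2 = 2 * E / D"
  using cube_z_pos unfolding of_cube_nth by (simp add: z_def)

lemma of_cube_in_bipyramid: "of_cube u \<in> bipyramid"
proof -
  note b = cube_bounds and p = cube_DEF
  have "y \<ge> 0" using b p by (simp add: y_def)
  moreover have "y \<le> 1"
  proof -
    have "(1 - Z) * E \<le> D" using cube_identities(1) mult_nonneg_nonneg[OF b(3), of F] p by linarith
    then show ?thesis using p by (simp add: y_def)
  qed
  moreover have "2 * X \<le> 2 * E / D"
  proof -
    have "X * D \<le> E" using cube_identities(2) mult_nonneg_nonneg[of "1 - Y" F] b p by linarith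
    then show ?thesis using p by (simp add: field_simps)
  qed
  moreover have "2 * y \<le> 2 * E / D"
    using b p by (simp add: y_def divide_right_mono mult_left_le_one_le)
  moreover have "z > 0" using cube_z_pos by (simp add: z_def)
  ultimately show ?thesis
    using b unfolding bipyramid_iff of_cube_q by (simp add: of_cube_nth)
qed

lemma to_of_cube: "to_cube (of_cube u) = u"
proof -
  note b = cube_bounds and p = cube_DEF
  have H: "of_cube u \<in> H3" using of_cube_in_bipyramid bipyramid_H3 by blast
  have z: "z > 0" using cube_z_pos by (simp add: z_def)
  have sq: "X\<^sup>2 + y\<^sup>2 + z\<^sup>2 = 2 * E / D" using of_cube_q by (simp add: of_cube_nth)
  have y1: "1 - y = Y * F / D" and x1: "2 * E / D - 2 * X = 2 * (1 - Y) * F / D"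
    using p cube_identities by (simp_all add: y_def field_simps)
  have y2: "2 * E / D - 2 * y = 2 * E / D * Z"
    using p by (simp add: y_def field_simps)
  have "to_cube (of_cube u) $ 1 = X"
    using z by (simp add: to_cube_def lor_wall[OF H] of_cube_nth flip: add_divide_distrib)
  moreover have "to_cube (of_cube u) $ 2 = Y"
  proof -
    have "to_cube (of_cube u) $ 2 = (Y * F / D / z) / (Y * F / D / z + 2 * (1 - Y) * F / D / (2 * z))"
      unfolding to_cube_def vec_lambda_beta lor_wall[OF H] of_cube_nth sq y1 x1 ..
    also have "\<dots> = Y" using z p by (simp add: divide_simps) (simp add: algebra_simps)
    finally show ?thesis .
  qed
  moreover have "to_cube (of_cube u) $ 3 = Z"
  proof -
    have "to_cube (of_cube u) $ 3 = (2 * E / D * Z / (2 * z)) / (2 * E / D * Z / (2 * z) + y / z)"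
      unfolding to_cube_def vec_lambda_beta lor_wall[OF H] of_cube_nth sq y2 ..
    also have "\<dots> = Z" using z p by (simp add: y_def divide_simps) (simp add: algebra_simps)
    finally show ?thesis .
  qed
  ultimately show ?thesis by (simp add: vec3_eq_iff X_def Y_def Z_def)
qed

end

lemma continuous_on_of_cube: "continuous_on cube of_cube"
proof -
  have D: "1 - u$3 * (1 - u$2) \<noteq> 0" if "u \<in> cube" for u
    using cube_DEF(1)[OF that] by simp
  have "continuous_on cube (\<lambda>u. \<chi> i. of_cube u $ i)"
  proof (rule continuous_on_vec_lambda)
    fix i :: 3
    show "continuous_on cube (\<lambda>u. of_cube u $ i)"
      using exhaust_3[of i] D
      by (elim disjE; hypsubst; simp only: of_cube_def Let_def vector_3; intro continuous_intros) auto
  qed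
  then show ?thesis by simp
qed

lemma continuous_on_to_cube: "continuous_on bipyramid to_cube"
  unfolding to_cube_def
proof (rule continuous_on_vec_lambda)
  fix i :: 3
  have h: "continuous_on bipyramid hyp" using continuous_on_hyp bipyramid_H3 continuous_on_subset by blast
  have l: "continuous_on bipyramid (\<lambda>p. lor (hyp p) w)" for w
    unfolding lor_def by (intro continuous_intros h) auto
  show "continuous_on bipyramid (\<lambda>p. lor (hyp p) (wall i False) / (lor (hyp p) (wall i False) + lor (hyp p) (wall i True)))"
    using wall_sum_pos[of _ i] by (intro continuous_intros l) force
qed

text \<open>Below height 1/2 only the ends at the ideal vertices (0,0,0) and (1,1,0) remain, and
  there the hemispheres bound the horizontal offset by the square of the height.\<close>

lemma bipyramid_cusps:
  assumes p: "p \<in> bipyramid" and z: "p$3 < 1 / 2"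
  shows "p$1 \<le> (p$3)\<^sup>2 \<and> p$2 \<le> (p$3)\<^sup>2 \<or> 1 - p$1 \<le> (p$3)\<^sup>2 \<and> 1 - p$2 \<le> (p$3)\<^sup>2"
proof -
  \<comment> \<open>By the symmetry exchanging the first two coordinates one hemisphere suffices;
    \<open>w\<close> stands for the squared height.\<close>
  have aux: "x \<le> w \<and> y \<le> w \<or> 1 - x \<le> w \<and> 1 - y \<le> w"
    if h: "0 \<le> y" "y \<le> x" "x \<le> 1" "2 * x \<le> x\<^sup>2 + y\<^sup>2 + w" "w < 1 / 2" for x y w :: real
  proof -
    have w: "w \<ge> 1 - (1 - x)\<^sup>2 - y\<^sup>2" using h by (simp add: power2_eq_square algebra_simps)
    show ?thesis
    proof (cases "y \<ge> 1 / 2")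
      case True
      have "(1 - x)\<^sup>2 \<le> (1 - y)\<^sup>2" using h by (intro power_mono) auto
      moreover have "(2 * y - 1) * (1 - y) \<ge> 0" using True h by simp
      ultimately have "1 - y \<le> w" using w by (simp add: power2_eq_square algebra_simps)
      then show ?thesis using h by simp
    next
      case False
      show ?thesis
      proof (cases "x \<le> 1 / 2")
        case True
        have "y\<^sup>2 \<le> x\<^sup>2" using h by (intro power_mono) auto
        moreover have "(1 - 2 * x) * x \<ge> 0" using True h by simp
        ultimately have "x \<le> w" using w by (simp add: power2_eq_square algebra_simps)
        then show ?thesis using h by simp
      next
        case xF: False
        have "(1 - x)\<^sup>2 \<le> (1/2)\<^sup>2" "y\<^sup>2 \<le> (1/2)\<^sup>2" using h xF False by (intro power_mono; simp)+
        then show ?thesis using w h by (simp add: power2_eq_square)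
      qed
    qed
  qed
  have "(p$3)\<^sup>2 < (1/2)\<^sup>2" using p z unfolding bipyramid_iff by (intro power_strict_mono) auto
  then have w: "(p$3)\<^sup>2 < 1 / 2" by (simp add: power2_eq_square)
  show ?thesis
  proof (cases "p$2 \<le> p$1")
    case True
    then show ?thesis using aux[of "p$2" "p$1" "(p$3)\<^sup>2"] p w by (simp add: bipyramid_iff)
  next
    case False
    then have "p$2 \<le> (p$3)\<^sup>2 \<and> p$1 \<le> (p$3)\<^sup>2 \<or> 1 - p$2 \<le> (p$3)\<^sup>2 \<and> 1 - p$1 \<le> (p$3)\<^sup>2"
      using p w by (intro aux) (auto simp: bipyramid_iff)
    then show ?thesis by blast
  qed
qed

section \<open>Finite volume of the bipyramid\<close>

lemma cbox_vec3: "x \<in> cbox a b \<longleftrightarrow> (a::real^3)$1 \<le> x$1 \<and> x$1 \<le> b$1 \<and> a$2 \<le> x$2 \<and> x$2 \<le> b$2 \<and> a$3 \<le> x$3 \<and> x$3 \<le> b$3"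
  by (auto simp: mem_box_cart forall_3)

lemma emeasure_lborel_cbox_vec3:
  assumes "(a::real^3)$1 \<le> b$1" "a$2 \<le> b$2" "a$3 \<le> b$3"
  shows "emeasure lborel (cbox a b) = ennreal ((b$1 - a$1) * (b$2 - a$2) * (b$3 - a$3))"
proof -
  have ne: "cbox a b \<noteq> {}" using assms cbox_vec3[of a a b] by auto
  have "measure lborel (cbox a b) = (b$1 - a$1) * (b$2 - a$2) * (b$3 - a$3)"
    unfolding content_cbox_cart[OF ne] UNIV_3 by (simp add: mult.assoc)
  moreover have "emeasure lborel (cbox a b) \<noteq> \<infinity>"
    using emeasure_lborel_cbox_finite[of a b] by (simp add: less_top)
  ultimately show ?thesis using emeasure_eq_ennreal_measure[of lborel "cbox a b"] by simp
qed

lemma H3_volume_cbox_le: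
  assumes "a$1 \<le> b$1" "a$2 \<le> b$2" "a$3 \<le> b$3" and a: "a$3 > 0"
  shows "emeasure H3_volume (cbox a b) \<le> ennreal ((b$1 - a$1) * (b$2 - a$2) * (b$3 - a$3) / (a$3)^3)"
proof -
  have "emeasure H3_volume (cbox a b) \<le> (\<integral>\<^sup>+ x. ennreal (1 / (a$3)^3) * indicator (cbox a b) x \<partial>lborel)"
    unfolding emeasure_H3_volume_nn_integral[OF borel_closed[OF closed_cbox]]
  proof (rule nn_integral_mono)
    fix x
    show "ennreal (indicator H3 x / (x $ 3) ^ 3) * indicator (cbox a b) x \<le> ennreal (1 / (a$3)^3) * indicator (cbox a b) x"
    proof (cases "x \<in> cbox a b")
      case True
      then have x: "a$3 \<le> x$3" "x \<in> H3" using a by (auto simp: cbox_vec3 H3_iff)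
      have "1 / (x$3)^3 \<le> 1 / (a$3)^3"
        using x a by (intro divide_left_mono power_mono) auto
      then show ?thesis using True x by (simp add: ennreal_leI)
    qed simp
  qed
  also have "\<dots> = ennreal (1 / (a$3)^3) * emeasure lborel (cbox a b)"
    by (rule nn_integral_cmult_indicator) simp
  also have "\<dots> = ennreal ((b$1 - a$1) * (b$2 - a$2) * (b$3 - a$3) / (a$3)^3)"
    using a assms by (simp add: emeasure_lborel_cbox_vec3 flip: ennreal_mult)
  finally show ?thesis .
qed

lemma H3_volume_cbox_pos:
  assumes "a$1 < b$1" "a$2 < b$2" "a$3 < b$3" and a: "a$3 > 0"
  shows "emeasure H3_volume (cbox a b) > 0"
proof -
  have "0 < ennreal (1 / (b$3)^3) * emeasure lborel (cbox a b)"
    using a assms by (simp add: emeasure_lborel_cbox_vec3 ennreal_zero_less_mult_iff)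
  also have "\<dots> = (\<integral>\<^sup>+ x. ennreal (1 / (b$3)^3) * indicator (cbox a b) x \<partial>lborel)"
    by (rule nn_integral_cmult_indicator[symmetric]) simp
  also have "\<dots> \<le> emeasure H3_volume (cbox a b)"
    unfolding emeasure_H3_volume_nn_integral[OF borel_closed[OF closed_cbox]]
  proof (rule nn_integral_mono)
    fix x
    show "ennreal (1 / (b$3)^3) * indicator (cbox a b) x \<le> ennreal (indicator H3 x / (x $ 3) ^ 3) * indicator (cbox a b) x"
    proof (cases "x \<in> cbox a b")
      case True
      then have x: "a$3 \<le> x$3" "x$3 \<le> b$3" "x \<in> H3" using a by (auto simp: cbox_vec3 H3_iff)
      have "1 / (b$3)^3 \<le> 1 / (x$3)^3"
        using x a by (intro divide_left_mono power_mono) auto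
      then show ?thesis using True x by (simp add: ennreal_leI)
    qed simp
  qed
  finally show ?thesis .
qed

lemma dyadic_above:
  assumes "(1::real) / 2 \<le> z"
  obtains k :: nat where "2 ^ k / 2 \<le> z" "z \<le> 2 ^ k"
proof -
  have ex: "\<exists>k. z \<le> 2 ^ k" using real_arch_pow[of 2 z] by (auto intro: less_imp_le)
  define k where "k = (LEAST k. z \<le> 2 ^ k)"
  have k: "z \<le> 2 ^ k" using LeastI_ex[OF ex] by (simp add: k_def)
  moreover have "2 ^ k / 2 \<le> z"
  proof (cases k)
    case (Suc j)
    then have "\<not> z \<le> 2 ^ j" using not_less_Least[of j "\<lambda>k. z \<le> 2 ^ k"] by (simp add: k_def)
    then show ?thesis using Suc by simp
  qed (use assms in simp)
  ultimately show ?thesis using that by blast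
qed

lemma dyadic_below:
  assumes "(0::real) < z" "z \<le> 1"
  obtains k :: nat where "(1 / 2) ^ k / 2 \<le> z" "z \<le> (1 / 2) ^ k"
proof -
  have ex: "\<exists>k. (1 / 2) ^ k / 2 \<le> z"
  proof -
    obtain k where "(1 / 2) ^ k < 2 * z" using real_arch_pow_inv[of "2 * z" "1 / 2"] assms by auto
    then show ?thesis by (intro exI[of _ k]) simp
  qed
  define k where "k = (LEAST k. (1 / 2) ^ k / 2 \<le> z)"
  have k: "(1 / 2) ^ k / 2 \<le> z" using LeastI_ex[OF ex] by (simp add: k_def)
  moreover have "z \<le> (1 / 2) ^ k"
  proof (cases k)
    case (Suc j)
    then have "\<not> (1 / 2) ^ j / 2 \<le> z" using not_less_Least[of j "\<lambda>k. (1 / 2) ^ k / 2 \<le> z"] by (simp add: k_def)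
    then show ?thesis using Suc by simp
  qed (use assms in simp)
  ultimately show ?thesis using that by blast
qed

text \<open>Each of the three cusps is covered by boxes whose volumes decay geometrically.\<close>

lemma finite_volume_bipyramid: "emeasure H3_volume bipyramid < \<infinity>"
proof -
  define v where "v a b c = (vector [a, b, c] :: real^3)" for a b c :: real
  have v [simp]: "v a b c $ 1 = a" "v a b c $ 2 = b" "v a b c $ 3 = c" for a b c
    by (simp_all add: v_def)
  \<comment> \<open>One dyadic layer for each ideal vertex. At infinity the base is the unit square;
    at the other two, height \<open>(1/2) ^ k\<close> leaves a square of side
    \<open>(1/4) ^ k\<close>. Each box has volume at most \<open>4 * (1/4) ^ k\<close>, whence the
    constant 12 below.\<close>
  define C where "C k =
    cbox (v 0 0 (2 ^ k / 2)) (v 1 1 (2 ^ k)) \<union>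
    cbox (v 0 0 ((1/2) ^ k / 2)) (v ((1/4) ^ k) ((1/4) ^ k) ((1/2) ^ k)) \<union>
    cbox (v (1 - (1/4) ^ k) (1 - (1/4) ^ k) ((1/2) ^ k / 2)) (v 1 1 ((1/2) ^ k))" for k :: nat
  have "bipyramid \<subseteq> (\<Union>k. C k)"
  proof
    fix p assume p: "p \<in> bipyramid"
    then have b: "p$3 > 0" "0 \<le> p$1" "p$1 \<le> 1" "0 \<le> p$2" "p$2 \<le> 1" by (auto simp: bipyramid_iff)
    show "p \<in> (\<Union>k. C k)"
    proof (cases "p$3 < 1 / 2")
      case False
      then obtain k :: nat where "2 ^ k / 2 \<le> p$3" "p$3 \<le> 2 ^ k" using dyadic_above[of "p$3"] by auto
      then have "p \<in> C k" using b by (simp add: C_def cbox_vec3)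
      then show ?thesis by blast
    next
      case True
      then obtain k :: nat where k: "(1 / 2) ^ k / 2 \<le> p$3" "p$3 \<le> (1 / 2) ^ k"
        using dyadic_below[of "p$3"] b by auto
      have "(p$3)\<^sup>2 \<le> ((1 / 2) ^ k)\<^sup>2" using k b by (intro power_mono) auto
      also have "\<dots> = (1 / 4) ^ k" by (simp add: power2_eq_square flip: power_mult_distrib)
      finally have "p \<in> C k"
        using bipyramid_cusps[OF p True] b k by (auto simp: C_def cbox_vec3)
      then show ?thesis by blast
    qed
  qed
  then have "emeasure H3_volume bipyramid \<le> emeasure H3_volume (\<Union>k. C k)"
    by (intro emeasure_mono) (auto simp: C_def H3_volume_def)
  also have "\<dots> \<le> (\<Sum>k. emeasure H3_volume (C k))"
    by (rule emeasure_subadditive_countably) (auto simp: C_def H3_volume_def)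
  also have "\<dots> \<le> (\<Sum>k. ennreal (12 * (1/4) ^ k))"
  proof (rule suminf_le)
    fix k :: nat
    have e: "(2::real) ^ k * 2 ^ k = 4 ^ k" "(1/2::real) ^ k * (1/2) ^ k = (1/4) ^ k" by (simp_all flip: power_mult_distrib)
    have 1: "emeasure H3_volume (cbox (v 0 0 (2 ^ k / 2)) (v 1 1 (2 ^ k))) \<le> ennreal (4 * (1/4) ^ k)"
    proof -
      have "(1 - 0) * (1 - 0) * (2 ^ k - 2 ^ k / 2) / (2 ^ k / 2) ^ 3 = 4 / ((2::real) ^ k * 2 ^ k)"
        by (simp add: power3_eq_cube divide_simps)
      also have "\<dots> = 4 * (1/4) ^ k" unfolding e by (simp add: power_divide)
      finally show ?thesis using H3_volume_cbox_le[of "v 0 0 (2 ^ k / 2)" "v 1 1 (2 ^ k)"] by simp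
    qed
    have s: "(1/4) ^ k * (1/4) ^ k * ((1/2) ^ k - (1/2) ^ k / 2) / ((1/2) ^ k / 2) ^ 3 = 4 * (1/4 :: real) ^ k"
      unfolding e(2)[symmetric] by (simp add: power3_eq_cube divide_simps)
    have 2: "emeasure H3_volume (cbox (v 0 0 ((1/2) ^ k / 2)) (v ((1/4) ^ k) ((1/4) ^ k) ((1/2) ^ k))) \<le> ennreal (4 * (1/4) ^ k)"
      using H3_volume_cbox_le[of "v 0 0 ((1/2) ^ k / 2)" "v ((1/4) ^ k) ((1/4) ^ k) ((1/2) ^ k)"] s by simp
    have 3: "emeasure H3_volume (cbox (v (1 - (1/4) ^ k) (1 - (1/4) ^ k) ((1/2) ^ k / 2)) (v 1 1 ((1/2) ^ k))) \<le> ennreal (4 * (1/4) ^ k)"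
      using H3_volume_cbox_le[of "v (1 - (1/4) ^ k) (1 - (1/4) ^ k) ((1/2) ^ k / 2)" "v 1 1 ((1/2) ^ k)"] s by simp
    have "emeasure H3_volume (C k) \<le> ennreal (4 * (1/4) ^ k) + ennreal (4 * (1/4) ^ k) + ennreal (4 * (1/4) ^ k)"
      unfolding C_def
      by (intro order_trans[OF emeasure_subadditive] add_mono 1 2 3) (auto simp: H3_volume_def)
    also have "\<dots> = ennreal (12 * (1/4) ^ k)" by (simp flip: ennreal_plus)
    finally show "emeasure H3_volume (C k) \<le> ennreal (12 * (1/4) ^ k)" .
  qed auto
  also have "\<dots> = ennreal (\<Sum>k. 12 * (1/4) ^ k)"
    by (rule suminf_ennreal2) (auto intro!: summable_mult summable_geometric)
  finally show ?thesis by (simp add: le_less_trans)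
qed

text \<open>A box above both hemispheres and away from the vertical walls. Its positive volume is
  the amount that every tile is sure to contribute.\<close>

definition core :: "(real^3) set" where
  "core = cbox (vector [1/4, 1/4, 2]) (vector [3/4, 3/4, 3])"

lemma core_interior:
  assumes "p \<in> core"
  shows "p \<in> bipyramid" "0 < to_cube p $ i" "to_cube p $ i < 1"
proof -
  have p: "1/4 \<le> p$1" "p$1 \<le> 3/4" "1/4 \<le> p$2" "p$2 \<le> 3/4" "2 \<le> p$3"
    using assms by (auto simp: core_def cbox_vec3)
  have "4 \<le> (p$3)\<^sup>2" using power_mono[of 2 "p$3" 2] p by simp
  then have q: "(p$1)\<^sup>2 + (p$2)\<^sup>2 + (p$3)\<^sup>2 \<ge> 4"
    using zero_le_power2[of "p$1"] zero_le_power2[of "p$2"] by linarith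
  show b: "p \<in> bipyramid" using p q by (simp add: bipyramid_iff)
  have H: "p \<in> H3" using b bipyramid_H3 by blast
  have "to_cube p $ i \<noteq> 0" "to_cube p $ i \<noteq> 1"
    using exhaust_3[of i] p q unfolding to_cube_eq_iff[OF b] by (auto simp: lor_wall[OF H])
  then show "0 < to_cube p $ i" "to_cube p $ i < 1"
    using to_cube_eq_iff(3,4)[OF b, of i] by auto
qed

lemma core_borel: "core \<in> sets borel"
  by (simp add: core_def)

lemma core_volume: "measure H3_volume core > 0"
proof -
  have "emeasure H3_volume core > 0"
    unfolding core_def by (rule H3_volume_cbox_pos) simp_all
  moreover have "emeasure H3_volume core \<le> emeasure H3_volume bipyramid"
  proof (rule emeasure_mono)
    obtain C where C: "closed C" "bipyramid = C \<inter> H3" using closedin_bipyramid by (auto simp: closedin_closed)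
    have "C \<inter> H3 \<in> sets borel" by (intro sets.Int borel_closed borel_open open_H3 C)
    then show "bipyramid \<in> sets H3_volume" using C by (simp add: H3_volume_def)
  qed (use core_interior in auto)
  ultimately show ?thesis
    using finite_volume_bipyramid by (simp add: measure_def enn2real_positive_iff)
qed

section \<open>Folding space onto the unit cube\<close>

text \<open>The triangle wave, that is, the distance to the nearest even integer; in the
  trigonometric form periodicity, evenness and continuity are immediate.\<close>

definition fold1 :: "real \<Rightarrow> real" where
  "fold1 t = arccos (cos (pi * t)) / pi"

lemma fold1_bounds: "0 \<le> fold1 t" "fold1 t \<le> 1"
  by (simp_all add: fold1_def arccos_lbound arccos_ubound divide_le_eq)

lemma fold1_add_even: "fold1 (t + 2 * of_int k) = fold1 t"
proof -
  have "pi * (t + 2 * of_int k) = pi * t + 2 * pi * of_int k" by (simp add: algebra_simps)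
  then show ?thesis by (simp add: fold1_def cos_add)
qed

lemma fold1_minus: "fold1 (- t) = fold1 t"
  by (simp add: fold1_def)

lemma fold1_id: "0 \<le> t \<Longrightarrow> t \<le> 1 \<Longrightarrow> fold1 t = t"
  by (simp add: fold1_def arccos_cos mult_left_le)

lemma fold1_on:
  assumes "of_int k \<le> t" "t \<le> of_int k + 1"
  shows "fold1 t = (if even k then t - of_int k else of_int k + 1 - t)"
proof (cases "even k")
  case True
  then obtain j where j: "k = 2 * j" by blast
  then show ?thesis using fold1_add_even[of "t - of_int k" j] fold1_id[of "t - of_int k"] assms by simp
next
  case False
  then obtain j where j: "k + 1 = 2 * j" by (metis dvd_def even_plus_one_iff)
  then have "(of_int k :: real) + 1 = 2 * of_int j" by (metis of_int_1 of_int_add of_int_mult of_int_numeral)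
  then have "fold1 t = fold1 (- (of_int k + 1 - t))" using fold1_add_even[of "- (of_int k + 1 - t)" j] by simp
  then show ?thesis using False fold1_id[of "of_int k + 1 - t"] assms by (simp only: fold1_minus) simp
qed

lemma continuous_on_fold1: "continuous_on A fold1"
  unfolding fold1_def by (intro continuous_intros) auto

text \<open>The inverse of \<open>fold1\<close> on the interval from \<open>k\<close> to
  \<open>k + 1\<close>.\<close>

definition unfold1 :: "int \<Rightarrow> real \<Rightarrow> real" where
  "unfold1 k w = (if even k then of_int k + w else of_int k + 1 - w)"

lemma unfold1_bounds: "0 \<le> w \<Longrightarrow> w \<le> 1 \<Longrightarrow> of_int k \<le> unfold1 k w \<and> unfold1 k w \<le> of_int k + 1"
  by (simp add: unfold1_def)

lemma fold1_unfold1: "0 \<le> w \<Longrightarrow> w \<le> 1 \<Longrightarrow> fold1 (unfold1 k w) = w"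
  using unfold1_bounds[of w k] fold1_on[of k "unfold1 k w"] by (simp add: unfold1_def)

lemma unfold1_fold1: "of_int k \<le> t \<Longrightarrow> t \<le> of_int k + 1 \<Longrightarrow> unfold1 k (fold1 t) = t"
  by (simp add: unfold1_def fold1_on)

lemma abs_unfold1: "\<bar>unfold1 k w - unfold1 k w'\<bar> = \<bar>w - w'\<bar>"
  by (simp add: unfold1_def abs_minus_commute)

definition fld :: "real^3 \<Rightarrow> real^3" where
  "fld u = (\<chi> i. fold1 (u$i))"

definition unfld :: "(3 \<Rightarrow> int) \<Rightarrow> real^3 \<Rightarrow> real^3" where
  "unfld k w = (\<chi> i. unfold1 (k i) (w$i))"

definition box_at :: "(3 \<Rightarrow> int) \<Rightarrow> (real^3) set" where
  "box_at k = {u. \<forall>i. of_int (k i) \<le> u$i \<and> u$i \<le> of_int (k i) + 1}"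

definition good :: "real^3 \<Rightarrow> bool" where
  "good u \<longleftrightarrow> \<not> ideal_edge (fld u)"

lemma good_iff: "good u \<longleftrightarrow> fld u \<in> cube"
  using fold1_bounds by (simp add: good_def cube_def fld_def)

lemma unfld_in_box: "w \<in> cube \<Longrightarrow> unfld k w \<in> box_at k"
  by (simp add: cube_def box_at_def unfld_def unfold1_bounds)

lemma fld_unfld: "w \<in> cube \<Longrightarrow> fld (unfld k w) = w"
  by (simp add: cube_def fld_def unfld_def fold1_unfold1 vec_eq_iff)

lemma unfld_fld: "u \<in> box_at k \<Longrightarrow> unfld k (fld u) = u"
  by (simp add: box_at_def fld_def unfld_def unfold1_fold1 vec_eq_iff)

lemma good_unfld: "w \<in> cube \<Longrightarrow> good (unfld k w)"
  by (simp add: good_iff fld_unfld)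

lemma abs_fld: "u \<in> box_at k \<Longrightarrow> v \<in> box_at k \<Longrightarrow> \<bar>fld u $ i - fld v $ i\<bar> = \<bar>u$i - v$i\<bar>"
  using abs_unfold1[of "k i" "fld u $ i" "fld v $ i"] unfld_fld[of u k] unfld_fld[of v k]
  by (simp add: unfld_def vec_eq_iff)

lemma continuous_on_fld: "continuous_on A fld"
  unfolding fld_def
  by (intro continuous_on_vec_lambda continuous_on_compose2[OF continuous_on_fold1[of UNIV]] continuous_intros) auto

lemma continuous_on_unfld: "continuous_on A (unfld k)"
  unfolding unfld_def
proof (rule continuous_on_vec_lambda)
  show "continuous_on A (\<lambda>w. unfold1 (k i) (w$i))" for i
    by (cases "even (k i)") (simp_all add: unfold1_def continuous_intros)
qed

lemma open_good: "open {u. good u}"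
proof -
  have "closed {w :: real^3. ideal_edge w}"
    unfolding ideal_edge_def
    by (intro closed_Collect_disj closed_Collect_conj closed_Collect_eq continuous_intros)
  then have "closed (fld -` {w. ideal_edge w})"
    using continuous_closed_vimage continuous_on_fld[of UNIV] continuous_on_eq_continuous_at by blast
  moreover have "{u. good u} = - (fld -` {w. ideal_edge w})" by (auto simp: good_def)
  ultimately show ?thesis by auto
qed

lemma fld_add_even: "fld (u + (\<chi> i. 2 * of_int (j i))) = fld u"
  by (simp add: fld_def fold1_add_even)

lemma box_add_even: "u + (\<chi> i. 2 * of_int (j i)) \<in> box_at (\<lambda>i. k i + 2 * j i) \<longleftrightarrow> u \<in> box_at k"
  by (simp add: box_at_def algebra_simps)

section \<open>The torus and its three rods\<close>

text \<open>\<open>cov n\<close> is the projection of space to the quotient by the index \<open>8 n\<close> sublattice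
  \<open>{2 (a, b, c) | a + b + c \<equiv> 0 (mod n)}\<close> of the unit lattice, followed by an isomorphism of this
  quotient with the standard torus. Each of the three edge directions generates the cyclic
  quotient group of order \<open>n\<close>, so that the lines in that direction form a single rod.\<close>

definition lin :: "nat \<Rightarrow> real^3 \<Rightarrow> real^3" where
  "lin n u = vector [u$1 / 2, (u$1 + u$2) / 2, (u$1 + u$2 + u$3) / (2 * real n)]"

definition cov :: "nat \<Rightarrow> real^3 \<Rightarrow> (real^3) set" where
  "cov n u = torus_proj (lin n u)"

definition latt :: "nat \<Rightarrow> (3 \<Rightarrow> int) \<Rightarrow> bool" where
  "latt n j \<longleftrightarrow> int n dvd j 1 + j 2 + j 3"

definition rod_line :: "3 \<Rightarrow> real \<Rightarrow> real^3" where
  "rod_line i t = (if i = 1 then vector [t, 0, 1] else if i = 2 then vector [1, t, 0] else vector [0, 1, t])"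

definition rods :: "nat \<Rightarrow> (real^3) set set set" where
  "rods n = range (\<lambda>i. cov n ` range (rod_line i))"

section \<open>Fibres of the covering and the rods\<close>

lemma torus_proj_eq_iff: "torus_proj x = torus_proj y \<longleftrightarrow> (\<forall>i. x$i - y$i \<in> \<int>)"
proof
  assume eq: "torus_proj x = torus_proj y"
  have "x \<in> torus_proj x" by (simp add: torus_proj_def)
  then show "\<forall>i. x$i - y$i \<in> \<int>" unfolding eq by (simp add: torus_proj_def)
next
  assume d: "\<forall>i. x$i - y$i \<in> \<int>"
  have "z$i - x$i \<in> \<int> \<longleftrightarrow> z$i - y$i \<in> \<int>" for z i
  proof -
    have "z$i - y$i = (z$i - x$i) + (x$i - y$i)" "z$i - x$i = (z$i - y$i) - (x$i - y$i)" by simp_all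
    then show ?thesis using d Ints_add Ints_diff by metis
  qed
  then show "torus_proj x = torus_proj y" by (simp add: torus_proj_def)
qed

lemma fold1_eq_0: "fold1 t = 0 \<Longrightarrow> \<exists>k::int. t = 2 * of_int k"
proof -
  assume 0: "fold1 t = 0"
  have f: "of_int \<lfloor>t\<rfloor> \<le> t" "t \<le> of_int \<lfloor>t\<rfloor> + 1" by linarith+
  show ?thesis
  proof (cases "even \<lfloor>t\<rfloor>")
    case True
    then obtain k where "\<lfloor>t\<rfloor> = 2 * k" by blast
    then show ?thesis using fold1_on[OF f] 0 True by (intro exI[of _ k]) simp
  next
    case False
    then obtain k where "\<lfloor>t\<rfloor> + 1 = 2 * k" by (metis dvd_def even_plus_one_iff)
    then have "(of_int \<lfloor>t\<rfloor> :: real) + 1 = 2 * of_int k" by (metis of_int_1 of_int_add of_int_mult of_int_numeral)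
    then show ?thesis using fold1_on[OF f] 0 False by (intro exI[of _ k]) simp
  qed
qed

lemma fold1_eq_1: "fold1 t = 1 \<Longrightarrow> \<exists>k::int. t = 2 * of_int k + 1"
proof -
  assume 1: "fold1 t = 1"
  have f: "of_int \<lfloor>t\<rfloor> \<le> t" "t \<le> of_int \<lfloor>t\<rfloor> + 1" by linarith+
  show ?thesis
  proof (cases "even \<lfloor>t\<rfloor>")
    case True
    then obtain k where "\<lfloor>t\<rfloor> = 2 * k" by blast
    then show ?thesis using fold1_on[OF f] 1 True by (intro exI[of _ k]) simp
  next
    case False
    then obtain k where "\<lfloor>t\<rfloor> = 2 * k + 1" by (rule oddE)
    then have "(of_int \<lfloor>t\<rfloor> :: real) = 2 * of_int k + 1" by simp
    then show ?thesis using fold1_on[OF f] 1 False by (intro exI[of _ k]) simp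
  qed
qed

lemma fld_rod_line:
  "fld (rod_line 1 t) $ 2 = 0" "fld (rod_line 1 t) $ 3 = 1"
  "fld (rod_line 2 t) $ 3 = 0" "fld (rod_line 2 t) $ 1 = 1"
  "fld (rod_line 3 t) $ 1 = 0" "fld (rod_line 3 t) $ 2 = 1"
  by (simp_all add: fld_def rod_line_def fold1_id)

context
  fixes n :: nat
  assumes n: "n > 0"
begin

text \<open>On a translation by \<open>2 * (a, b, c)\<close> the map \<open>lin n\<close> takes the
  value \<open>(a, a + b, (a + b + c) / n)\<close>, which is integral exactly on the lattice; the
  witness \<open>j\<close> inverts this triangular system.\<close>

lemma cov_eq_iff: "cov n u = cov n v \<longleftrightarrow> (\<exists>j. latt n j \<and> u = v + (\<chi> i. 2 * of_int (j i)))"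
proof
  assume "cov n u = cov n v"
  then have "(u$1 - v$1) / 2 \<in> \<int>" "(u$1 + u$2) / 2 - (v$1 + v$2) / 2 \<in> \<int>"
    "(u$1 + u$2 + u$3) / (2 * real n) - (v$1 + v$2 + v$3) / (2 * real n) \<in> \<int>"
    by (simp_all add: cov_def torus_proj_eq_iff forall_3 lin_def diff_divide_distrib)
  then obtain a b c where abc: "(u$1 - v$1) / 2 = of_int a" "(u$1 + u$2) / 2 - (v$1 + v$2) / 2 = of_int b"
    "(u$1 + u$2 + u$3) / (2 * real n) - (v$1 + v$2 + v$3) / (2 * real n) = of_int c"
    by (auto elim!: Ints_cases)
  define j where "j i = (if i = 1 then a else if i = 2 then b - a else int n * c - b)" for i :: 3
  have "u$1 = v$1 + 2 * of_int a" "u$2 = v$2 + 2 * (of_int b - of_int a)"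
    using abc(1,2) by (simp_all add: field_simps)
  moreover have "(u$1 + u$2 + u$3) - (v$1 + v$2 + v$3) = 2 * (real n * of_int c)"
  proof -
    have "((u$1 + u$2 + u$3) - (v$1 + v$2 + v$3)) / (2 * real n) = of_int c"
      using abc(3) by (simp add: diff_divide_distrib)
    then show ?thesis using n by (simp add: divide_eq_eq)
  qed
  ultimately have "u = v + (\<chi> i. 2 * of_int (j i))"
    by (simp add: vec3_eq_iff j_def)
  moreover have "latt n j" by (simp add: latt_def j_def)
  ultimately show "\<exists>j. latt n j \<and> u = v + (\<chi> i. 2 * of_int (j i))" by blast
next
  assume "\<exists>j. latt n j \<and> u = v + (\<chi> i. 2 * of_int (j i))"
  then obtain j c where j: "u = v + (\<chi> i. 2 * of_int (j i))" "j 1 + j 2 + j 3 = int n * c"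
    by (auto simp: latt_def dvd_def)
  have "(of_int (j 1 + j 2 + j 3) :: real) = real n * of_int c" unfolding j(2) by simp
  moreover have "lin n u $ 3 - lin n v $ 3 = ((u$1 + u$2 + u$3) - (v$1 + v$2 + v$3)) / (2 * real n)"
    by (simp add: lin_def diff_divide_distrib)
  moreover have "(u$1 + u$2 + u$3) - (v$1 + v$2 + v$3) = 2 * of_int (j 1 + j 2 + j 3)"
    by (simp add: j(1))
  ultimately have "lin n u $ 3 - lin n v $ 3 = of_int c" using n by simp
  moreover have "lin n u $ 1 - lin n v $ 1 = of_int (j 1)" "lin n u $ 2 - lin n v $ 2 = of_int (j 1 + j 2)"
    by (simp_all add: lin_def j(1) field_simps)
  ultimately show "cov n u = cov n v"
    unfolding cov_def torus_proj_eq_iff forall_3 by (metis Ints_of_int)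
qed

lemma lin_inverse: "lin n (vector [2 * x$1, 2 * x$2 - 2 * x$1, 2 * real n * x$3 - 2 * x$2]) = x"
  using n by (simp add: lin_def vec3_eq_iff)

lemma continuous_on_lin: "continuous_on A (lin n)"
proof -
  have "continuous_on A (\<lambda>u. \<chi> i. lin n u $ i)"
  proof (rule continuous_on_vec_lambda)
    show "continuous_on A (\<lambda>u. lin n u $ i)" for i
      using exhaust_3[of i] n
      by (elim disjE; hypsubst; simp only: lin_def vector_3; intro continuous_intros) auto
  qed
  then show ?thesis by simp
qed

lemma range_cov: "range (cov n) = topspace torus3"
proof -
  have "x \<in> range (lin n)" for x using lin_inverse[of x] by (metis rangeI)
  then have "range (lin n) = UNIV" by blast
  then show ?thesis unfolding topspace_torus3 cov_def by (metis image_image)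
qed

lemma open_cov_vimage: "openin torus3 U \<Longrightarrow> open (cov n -` U)"
proof -
  assume "openin torus3 U"
  then have "open (torus_proj -` U)" by (simp add: openin_torus3)
  then have "open (lin n -` (torus_proj -` U))"
    using continuous_on_lin by (rule open_vimage)
  moreover have "lin n -` (torus_proj -` U) = cov n -` U" by (auto simp: cov_def)
  ultimately show ?thesis by simp
qed

text \<open>The preimage of the image is a union of translates of an open set, pulled back by the
  inverse \<open>g\<close> of \<open>lin n\<close>.\<close>

lemma openin_cov_image:
  assumes "open V"
  shows "openin torus3 (cov n ` V)"
proof -
  define g where "g x = (vector [2 * x$1, 2 * x$2 - 2 * x$1, 2 * real n * x$3 - 2 * x$2] :: real^3)" for x :: "real^3"
  have "continuous_on UNIV (\<lambda>x. \<chi> i. g x $ i)"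
  proof (rule continuous_on_vec_lambda)
    show "continuous_on UNIV (\<lambda>x. g x $ i)" for i
      using exhaust_3[of i]
      by (elim disjE; hypsubst; simp only: g_def vector_3; intro continuous_intros)
  qed
  then have g: "continuous_on UNIV g" by simp
  have "torus_proj -` (cov n ` V) = (\<Union>z\<in>{z. \<forall>i. z$i \<in> \<int>}. (\<lambda>x. g (x + z)) -` V)"
  proof (intro equalityI subsetI)
    fix x assume "x \<in> torus_proj -` (cov n ` V)"
    then obtain u where u: "u \<in> V" "torus_proj (lin n u) = torus_proj x" by (auto simp: cov_def)
    define z where "z = lin n u - x"
    have "\<forall>i. z$i \<in> \<int>" using u(2) by (simp add: torus_proj_eq_iff z_def)
    moreover have "g (x + z) = u" using n by (simp add: z_def g_def lin_def vec3_eq_iff field_simps)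
    ultimately show "x \<in> (\<Union>z\<in>{z. \<forall>i. z$i \<in> \<int>}. (\<lambda>x. g (x + z)) -` V)" using u(1) by blast
  next
    fix x assume "x \<in> (\<Union>z\<in>{z. \<forall>i. z$i \<in> \<int>}. (\<lambda>x. g (x + z)) -` V)"
    then obtain z where z: "\<forall>i. z$i \<in> \<int>" "g (x + z) \<in> V" by blast
    have "cov n (g (x + z)) = torus_proj (x + z)" unfolding cov_def g_def lin_inverse ..
    also have "\<dots> = torus_proj x" using z(1) by (simp add: torus_proj_eq_iff)
    finally show "x \<in> torus_proj -` (cov n ` V)" using z(2) by (metis image_eqI vimage_eq)
  qed
  moreover have "open ((\<lambda>x. g (x + z)) -` V)" for z
    by (rule open_vimage[OF assms]) (intro continuous_on_compose2[OF g] continuous_intros, auto)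
  ultimately have "open (torus_proj -` (cov n ` V))" by auto
  then show ?thesis by (auto simp: openin_torus3 cov_def)
qed

lemma fld_cov: "cov n u = cov n v \<Longrightarrow> fld u = fld v"
  using fld_add_even by (auto simp: cov_eq_iff)

lemma good_cov: "cov n u = cov n v \<Longrightarrow> good u \<longleftrightarrow> good v"
  using fld_cov[of u v] by (simp add: good_def)

lemma Union_rods: "\<Union>(rods n) = cov n ` {u. \<not> good u}"
proof (intro equalityI subsetI)
  fix x assume "x \<in> \<Union>(rods n)"
  then obtain i t where x: "x = cov n (rod_line i t)" by (auto simp: rods_def)
  have "\<not> good (rod_line i t)"
    using exhaust_3[of i] fld_rod_line[of t] by (auto simp: good_def ideal_edge_def)
  then show "x \<in> cov n ` {u. \<not> good u}" using x by blast
next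
  fix x assume "x \<in> cov n ` {u. \<not> good u}"
  then obtain u where u: "x = cov n u" "ideal_edge (fld u)" by (auto simp: good_def)
  have "\<exists>i t. cov n u = cov n (rod_line i t)"
    using u(2) unfolding ideal_edge_def fld_def vec_lambda_beta
  proof (elim disjE conjE)
    assume "fold1 (u$2) = 0" "fold1 (u$3) = 1"
    then obtain b c :: int where bc: "u$2 = 2 * of_int b" "u$3 = 2 * of_int c + 1"
      using fold1_eq_0 fold1_eq_1 by blast
    \<comment> \<open>The component along the line is chosen to make the sum 0, so that
      \<open>j\<close> is in the lattice for every \<open>n\<close>; the shift of the parameter
      undoes it. Thus all parallel lines project to the same rod.\<close>
    define j where "j i = (if i = 1 then - b - c else if i = 2 then b else c)" for i :: 3
    have "u = rod_line 1 (u$1 + 2 * of_int (b + c)) + (\<chi> i. 2 * of_int (j i))"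
      by (simp add: vec3_eq_iff rod_line_def j_def bc)
    moreover have "latt n j" by (simp add: latt_def j_def)
    ultimately show ?thesis using cov_eq_iff by blast
  next
    assume "fold1 (u$3) = 0" "fold1 (u$1) = 1"
    then obtain b c :: int where bc: "u$3 = 2 * of_int b" "u$1 = 2 * of_int c + 1"
      using fold1_eq_0 fold1_eq_1 by blast
    define j where "j i = (if i = 2 then - b - c else if i = 3 then b else c)" for i :: 3
    have "u = rod_line 2 (u$2 + 2 * of_int (b + c)) + (\<chi> i. 2 * of_int (j i))"
      by (simp add: vec3_eq_iff rod_line_def j_def bc)
    moreover have "latt n j" by (simp add: latt_def j_def)
    ultimately show ?thesis using cov_eq_iff by blast
  next
    assume "fold1 (u$1) = 0" "fold1 (u$2) = 1"
    then obtain b c :: int where bc: "u$1 = 2 * of_int b" "u$2 = 2 * of_int c + 1"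
      using fold1_eq_0 fold1_eq_1 by blast
    define j where "j i = (if i = 3 then - b - c else if i = 1 then b else c)" for i :: 3
    have "u = rod_line 3 (u$3 + 2 * of_int (b + c)) + (\<chi> i. 2 * of_int (j i))"
      by (simp add: vec3_eq_iff rod_line_def j_def bc)
    moreover have "latt n j" by (simp add: latt_def j_def)
    ultimately show ?thesis using cov_eq_iff by blast
  qed
  then show "x \<in> \<Union>(rods n)" using u(1) by (auto simp: rods_def)
qed

text \<open>Folding is constant on the fibres of \<open>cov\<close>, and any two of the lines have a
  coordinate that folds to 0 on one and to 1 on the other.\<close>

lemma rods_disjoint: "i \<noteq> k \<Longrightarrow> cov n ` range (rod_line i) \<inter> cov n ` range (rod_line k) = {}"
proof -
  assume ik: "i \<noteq> k"
  have "cov n (rod_line i s) \<noteq> cov n (rod_line k t)" for s t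
  proof
    assume "cov n (rod_line i s) = cov n (rod_line k t)"
    then have "fld (rod_line i s) = fld (rod_line k t)" by (rule fld_cov)
    then show False
      using ik exhaust_3[of i] exhaust_3[of k] fld_rod_line[of s] fld_rod_line[of t] by auto
  qed
  then show ?thesis by blast
qed

lemma disjoint_rods: "disjoint (rods n)"
  unfolding disjoint_def
proof (intro ballI impI)
  fix a b assume "a \<in> rods n" "b \<in> rods n" and ab: "a \<noteq> b"
  then obtain i k where ik: "a = cov n ` range (rod_line i)" "b = cov n ` range (rod_line k)"
    by (auto simp: rods_def)
  with ab have "i \<noteq> k" by blast
  then show "a \<inter> b = {}" unfolding ik by (rule rods_disjoint)
qed

lemma card_rods: "card (rods n) = 3"
proof -
  have "inj (\<lambda>i. cov n ` range (rod_line i))"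
  proof
    fix i k :: 3 assume eq: "cov n ` range (rod_line i) = cov n ` range (rod_line k)"
    show "i = k"
    proof (rule ccontr)
      assume "i \<noteq> k"
      then have "cov n ` range (rod_line i) = {}" using rods_disjoint[of i k] eq by simp
      then show False by simp
    qed
  qed
  then show ?thesis unfolding rods_def by (simp add: card_image)
qed

lemma rod_rods: "r \<in> rods n \<Longrightarrow> rod r"
proof -
  assume "r \<in> rods n"
  then obtain i where r: "r = cov n ` range (rod_line i)" by (auto simp: rods_def)
  define v where "v = lin n (axis i 1)"
  have line: "lin n (rod_line i t) = lin n (rod_line i 0) + t *\<^sub>R v" for t
    using exhaust_3[of i] by (auto simp: v_def lin_def rod_line_def axis_def vec3_eq_iff add_divide_distrib)
  have "r = torus_proj ` range (\<lambda>t. lin n (rod_line i 0) + t *\<^sub>R v)"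
    unfolding r cov_def image_image line[symmetric] ..
  moreover have "v \<noteq> 0" "\<forall>i. v$i \<in> \<rat>"
    using exhaust_3[of i] n by (auto simp: v_def lin_def axis_def vec3_eq_iff forall_3)
  ultimately show "rod r" unfolding rod_def by blast
qed

lemma topspace_rod_complement: "topspace (rod_complement (rods n)) = cov n ` {u. good u}"
proof -
  have "topspace torus3 - \<Union>(rods n) = cov n ` {u. good u}"
    unfolding range_cov[symmetric] Union_rods using good_cov by blast
  moreover have "cov n ` {u. good u} \<subseteq> topspace torus3" unfolding range_cov[symmetric] by blast
  ultimately show ?thesis by (simp add: rod_complement_def Int_absorb1)
qed

lemma openin_rod_complement:
  "openin (rod_complement (rods n)) U \<longleftrightarrow> openin torus3 U \<and> U \<subseteq> cov n ` {u. good u}"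
proof -
  have "topspace torus3 - \<Union>(rods n) = cov n ` {u. good u}"
    unfolding range_cov[symmetric] Union_rods using good_cov by blast
  then show ?thesis
    unfolding rod_complement_def by (simp only: openin_open_subtopology[OF openin_cov_image[OF open_good]])
qed

end

section \<open>Reflections in orthogonal mirrors\<close>

text \<open>The composite of the reflections indexed by \<open>S\<close>, restricted to
  \<open>I\<close>. For orthonormal normals these commute, so one sum expresses it without an
  order.\<close>

definition mirror :: "'i set \<Rightarrow> ('i \<Rightarrow> real^4) \<Rightarrow> 'i set \<Rightarrow> real^4 \<Rightarrow> real^4" where
  "mirror I \<nu> S P = P - (\<Sum>i\<in>I. (if i \<in> S then 2 * lor P (\<nu> i) else 0) *\<^sub>R \<nu> i)"

definition reflect :: "'i set \<Rightarrow> ('i \<Rightarrow> real^4) \<Rightarrow> 'i set \<Rightarrow> real^3 \<Rightarrow> real^3" where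
  "reflect I \<nu> S a = unhyp (mirror I \<nu> S (hyp a))"

context
  fixes I :: "'i set" and \<nu> :: "'i \<Rightarrow> real^4" and b :: "real^3"
  assumes I: "finite I" and \<nu>: "\<And>i j. i \<in> I \<Longrightarrow> j \<in> I \<Longrightarrow> lor (\<nu> i) (\<nu> j) = (if i = j then 1 else 0)"
    and b: "b \<in> H3" "\<And>i. i \<in> I \<Longrightarrow> lor (hyp b) (\<nu> i) = 0"
begin

lemma lor_mirror_normal:
  assumes j: "j \<in> I"
  shows "lor (mirror I \<nu> S P) (\<nu> j) = (if j \<in> S then - lor P (\<nu> j) else lor P (\<nu> j))"
proof -
  have "(\<Sum>i\<in>I. (if i \<in> S then 2 * lor P (\<nu> i) else 0) * lor (\<nu> i) (\<nu> j)) =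
      (\<Sum>i\<in>I. if i = j then (if j \<in> S then 2 * lor P (\<nu> j) else 0) else 0)"
    by (rule sum.cong) (use \<nu> j in auto)
  then show ?thesis
    using I j by (simp add: mirror_def lor_sum)
qed

lemma lor_mirror: "lor (mirror I \<nu> S P) (mirror I \<nu> S Q) = lor P Q"
proof -
  have "lor (mirror I \<nu> S P) (mirror I \<nu> S Q) = lor (mirror I \<nu> S P) Q
      - (\<Sum>i\<in>I. (if i \<in> S then 2 * lor Q (\<nu> i) else 0) * lor (mirror I \<nu> S P) (\<nu> i))"
    unfolding mirror_def[of I \<nu> S Q] lor_simps lor_sum ..
  also have "(\<Sum>i\<in>I. (if i \<in> S then 2 * lor Q (\<nu> i) else 0) * lor (mirror I \<nu> S P) (\<nu> i)) =
      - (\<Sum>i\<in>I. (if i \<in> S then 2 * lor P (\<nu> i) else 0) * lor (\<nu> i) Q)"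
    unfolding sum_negf[symmetric] by (rule sum.cong) (auto simp: lor_mirror_normal lor_commute[of Q])
  finally show ?thesis
    unfolding mirror_def lor_simps lor_sum by simp
qed

lemma mirror_mirror: "mirror I \<nu> S (mirror I \<nu> S P) = P"
proof -
  have "(\<Sum>i\<in>I. (if i \<in> S then 2 * lor (mirror I \<nu> S P) (\<nu> i) else 0) *\<^sub>R \<nu> i) =
      - (\<Sum>i\<in>I. (if i \<in> S then 2 * lor P (\<nu> i) else 0) *\<^sub>R \<nu> i)"
    unfolding sum_negf[symmetric] by (rule sum.cong) (auto simp: lor_mirror_normal)
  then show ?thesis by (subst mirror_def) (simp add: mirror_def)
qed

lemma mirror_base: "mirror I \<nu> S (hyp b) = hyp b"
  unfolding mirror_def by (subst sum.neutral) (auto simp: b(2))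

text \<open>The composite fixes the point \<open>b\<close> common to the mirrors and preserves
  products, so it keeps the upper sheet.\<close>

lemma hyp_reflect: "a \<in> H3 \<Longrightarrow> hyp (reflect I \<nu> S a) = mirror I \<nu> S (hyp a)" "a \<in> H3 \<Longrightarrow> reflect I \<nu> S a \<in> H3"
proof -
  assume a: "a \<in> H3"
  have 1: "lor (mirror I \<nu> S (hyp a)) (mirror I \<nu> S (hyp a)) = - 1" using a by (simp add: lor_mirror lor_hyp_self)
  have "lor (mirror I \<nu> S (hyp a)) (hyp b) < 0"
    using lor_mirror[of S "hyp a" "hyp b"] lor_hyp_le[OF a b(1)] by (simp add: mirror_base)
  then have 3: "mirror I \<nu> S (hyp a) $ 3 > 0" using future_iff[OF 1 b(1)] by simp
  show "hyp (reflect I \<nu> S a) = mirror I \<nu> S (hyp a)" "reflect I \<nu> S a \<in> H3"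
    using hyp_unhyp[OF 1 3] unhyp_in_H3[OF 3] by (simp_all add: reflect_def)
qed

lemma H3_dist_reflect: "a \<in> H3 \<Longrightarrow> c \<in> H3 \<Longrightarrow> H3_dist (reflect I \<nu> S a) (reflect I \<nu> S c) = H3_dist a c"
  by (simp add: H3_dist_eq_iff hyp_reflect lor_mirror)

lemma reflect_reflect: "a \<in> H3 \<Longrightarrow> reflect I \<nu> S (reflect I \<nu> S a) = a"
  by (subst reflect_def) (simp add: hyp_reflect mirror_mirror)

lemma reflect_base: "reflect I \<nu> S b = b"
  by (simp add: reflect_def mirror_base b)

end

text \<open>Reflecting a point in a mirror that contains it changes nothing. This makes the
  unfolding consistent on common faces.\<close>

lemma reflect_cong:
  assumes "\<And>i. i \<in> I \<Longrightarrow> lor (hyp a) (\<nu> i) \<noteq> 0 \<Longrightarrow> i \<in> S \<longleftrightarrow> i \<in> S'"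
  shows "reflect I \<nu> S a = reflect I \<nu> S' a"
proof -
  have "(\<Sum>i\<in>I. (if i \<in> S then 2 * lor (hyp a) (\<nu> i) else 0) *\<^sub>R \<nu> i) =
      (\<Sum>i\<in>I. (if i \<in> S' then 2 * lor (hyp a) (\<nu> i) else 0) *\<^sub>R \<nu> i)"
    by (rule sum.cong) (use assms in auto)
  then show ?thesis by (simp add: reflect_def mirror_def)
qed

section \<open>The rod complement as a tiled space\<close>

definition tile :: "nat \<Rightarrow> (3 \<Rightarrow> int) \<Rightarrow> (real^3) set set" where
  "tile n k = cov n ` {u \<in> box_at k. good u}"

text \<open>The choice of lift is immaterial, since \<open>fld\<close> is constant on the fibres of
  \<open>cov\<close>.\<close>

definition devel :: "nat \<Rightarrow> (real^3) set \<Rightarrow> real^3" where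
  "devel n x = of_cube (fld (SOME u. cov n u = x))"

lemma of_cube_fld: "good u \<Longrightarrow> of_cube (fld u) \<in> bipyramid"
  by (simp add: good_iff of_cube_in_bipyramid)

lemma to_cube_of_cube_fld: "good u \<Longrightarrow> to_cube (of_cube (fld u)) = fld u"
  by (simp add: good_iff to_of_cube)

lemma fld_inj_on_box: "u \<in> box_at k \<Longrightarrow> v \<in> box_at k \<Longrightarrow> fld u = fld v \<Longrightarrow> u = v"
  by (metis unfld_fld)

lemma box_at_floor: "u \<in> box_at (\<lambda>i. \<lfloor>u$i\<rfloor>)"
  by (simp add: box_at_def)

context
  fixes n :: nat
  assumes n: "n > 0"
begin

lemma devel_cov: "devel n (cov n u) = of_cube (fld u)"
proof -
  have "cov n (SOME v. cov n v = cov n u) = cov n u" by (rule someI) (rule HOL.refl)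
  from fld_cov[OF n this] show ?thesis unfolding devel_def by (rule arg_cong)
qed

lemma cov_add_latt: "latt n j \<Longrightarrow> cov n (u + (\<chi> i. 2 * of_int (j i))) = cov n u"
  using cov_eq_iff[OF n] by blast

lemma tile_lift:
  assumes "cov n w \<in> tile n k"
  obtains j where "latt n j" "w \<in> box_at (\<lambda>i. k i + 2 * j i)" "good w"
proof -
  obtain v where v: "v \<in> box_at k" "good v" "cov n w = cov n v" using assms by (auto simp: tile_def)
  then obtain j where j: "latt n j" "w = v + (\<chi> i. 2 * of_int (j i))" using cov_eq_iff[OF n] by blast
  show ?thesis
    using that[OF j(1)] good_cov[OF n v(3)] v(1,2) box_add_even[of v j k] by (simp add: j(2))
qed

lemma cov_in_tile: "w \<in> box_at k \<Longrightarrow> good w \<Longrightarrow> cov n w \<in> tile n k"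
  by (auto simp: tile_def)

lemma tile_add: "latt n j \<Longrightarrow> tile n (\<lambda>i. k i + 2 * j i) = tile n k"
proof -
  have sub: "tile n k \<subseteq> tile n (\<lambda>i. k i + 2 * j i)" if j: "latt n j" for j k
  proof
    fix x assume "x \<in> tile n k"
    then obtain u where u: "u \<in> box_at k" "good u" "x = cov n u" by (auto simp: tile_def)
    let ?u = "u + (\<chi> i. 2 * of_int (j i))"
    have "cov n ?u = x" "good ?u" using cov_add_latt[OF j, of u] good_cov[OF n cov_add_latt[OF j, of u]] u by auto
    then show "x \<in> tile n (\<lambda>i. k i + 2 * j i)"
      using cov_in_tile[of ?u] box_add_even[of u j k] u(1) by metis
  qed
  assume j: "latt n j"
  have "latt n (\<lambda>i. - j i)" using j by (simp add: latt_def) (metis dvd_minus_iff minus_add_distrib diff_conv_add_uminus)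
  from sub[OF this, of "\<lambda>i. k i + 2 * j i"] sub[OF j, of k] show ?thesis by auto
qed

lemma tile_cover: "\<Union>(range (tile n)) = topspace (rod_complement (rods n))"
  unfolding topspace_rod_complement[OF n] tile_def using box_at_floor by blast

lemma finite_tiles_n: "finite (range (tile n))"
proof -
  define K where "K = {k :: 3 \<Rightarrow> int. \<forall>i. k i \<in> {0..<2 * int n + 2}}"
  have "K = (\<Pi>\<^sub>E i\<in>UNIV. {0..<2 * int n + 2})" by (auto simp: K_def PiE_def)
  then have "finite K" by (simp add: finite_PiE)
  moreover have "range (tile n) \<subseteq> tile n ` K"
  proof
    fix T assume "T \<in> range (tile n)"
    then obtain k where T: "T = tile n k" by blast
    \<comment> \<open>The first two indices are reduced modulo 2; the lattice condition moves the
      correction \<open>- a - b\<close> into the third, which is then reduced modulo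
      \<open>2 * n\<close>.\<close>
    define a b where "a = k 1 div 2" and "b = k 2 div 2"
    define c where "c = (k 3 + 2 * a + 2 * b) div (2 * int n)"
    define j where "j i = (if i = 1 then a else if i = 2 then b else int n * c - a - b)" for i :: 3
    define k' where "k' i = (if i = 1 then k 1 mod 2 else if i = 2 then k 2 mod 2
        else (k 3 + 2 * a + 2 * b) mod (2 * int n))" for i :: 3
    have "k 3 + 2 * a + 2 * b = (2 * int n) * c + (k 3 + 2 * a + 2 * b) mod (2 * int n)"
      unfolding c_def by simp
    then have "k i = k' i + 2 * j i" for i
      using exhaust_3[of i] by (auto simp: k'_def j_def a_def b_def algebra_simps)
    then have "k = (\<lambda>i. k' i + 2 * j i)" by (rule ext)
    moreover have "latt n j" by (simp add: latt_def j_def)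
    ultimately have "T = tile n k'" using tile_add T by simp
    moreover have "k' \<in> K"
    proof -
      have m: "0 \<le> (k 3 + 2 * a + 2 * b) mod (2 * int n)" "(k 3 + 2 * a + 2 * b) mod (2 * int n) < 2 * int n"
        using n by simp_all
      have "k 1 mod 2 < 2" "k 2 mod 2 < 2" "k 1 mod 2 \<ge> 0" "k 2 mod 2 \<ge> 0" by simp_all
      then show ?thesis using m by (auto simp: K_def k'_def intro: less_trans)
    qed
    ultimately show "T \<in> tile n ` K" by blast
  qed
  ultimately show ?thesis using finite_subset by blast
qed

lemma bij_devel: "bij_betw (devel n) (tile n k) bipyramid"
  unfolding bij_betw_def
proof
  show "inj_on (devel n) (tile n k)"
  proof
    fix x y assume "x \<in> tile n k" "y \<in> tile n k" and eq: "devel n x = devel n y"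
    then obtain u v where uv: "u \<in> box_at k" "good u" "x = cov n u" "v \<in> box_at k" "good v" "y = cov n v"
      by (auto simp: tile_def)
    have "fld u = fld v" using eq uv to_cube_of_cube_fld by (metis devel_cov)
    then show "x = y" using fld_inj_on_box uv by blast
  qed
  show "devel n ` tile n k = bipyramid"
  proof
    show "devel n ` tile n k \<subseteq> bipyramid" by (auto simp: tile_def devel_cov of_cube_fld)
    show "bipyramid \<subseteq> devel n ` tile n k"
    proof
      fix b assume b: "b \<in> bipyramid"
      let ?u = "unfld k (to_cube b)"
      have c: "to_cube b \<in> cube" using to_cube_in_cube[OF b] .
      have "devel n (cov n ?u) = b" using devel_cov fld_unfld[OF c] of_to_cube[OF b] by simp
      moreover have "cov n ?u \<in> tile n k" using cov_in_tile unfld_in_box[OF c] good_unfld[OF c] by blast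
      ultimately show "b \<in> devel n ` tile n k" by force
    qed
  qed
qed

lemma inv_devel:
  assumes b: "b \<in> bipyramid"
  shows "inv_into (tile n k) (devel n) b = cov n (unfld k (to_cube b))"
proof (rule inv_into_f_eq)
  have c: "to_cube b \<in> cube" using to_cube_in_cube[OF b] .
  show "devel n (cov n (unfld k (to_cube b))) = b" using devel_cov fld_unfld[OF c] of_to_cube[OF b] by simp
  show "cov n (unfld k (to_cube b)) \<in> tile n k" using cov_in_tile unfld_in_box[OF c] good_unfld[OF c] by blast
qed (use bij_devel in \<open>simp add: bij_betw_def\<close>)

lemma continuous_sec_n:
  "continuous_map (top_of_set bipyramid) (rod_complement (rods n)) (inv_into (tile n k) (devel n))"
  unfolding continuous_map
proof (intro conjI allI impI)
  have "inv_into (tile n k) (devel n) b \<in> topspace (rod_complement (rods n))" if b: "b \<in> bipyramid" for b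
    unfolding inv_devel[OF b] topspace_rod_complement[OF n] using good_unfld[OF to_cube_in_cube[OF b]] by blast
  then show "inv_into (tile n k) (devel n) ` topspace (top_of_set bipyramid) \<subseteq> topspace (rod_complement (rods n))" by auto
  fix U assume "openin (rod_complement (rods n)) U"
  then have "open (cov n -` U)" using openin_rod_complement[OF n] open_cov_vimage[OF n] by blast
  moreover have "continuous_on bipyramid (\<lambda>b. unfld k (to_cube b))"
    by (rule continuous_on_compose2[OF continuous_on_unfld[of UNIV] continuous_on_to_cube]) simp
  ultimately have "openin (top_of_set bipyramid) (bipyramid \<inter> (\<lambda>b. unfld k (to_cube b)) -` (cov n -` U))"
    by (rule continuous_openin_preimage_gen[rotated])
  moreover have "{x \<in> topspace (top_of_set bipyramid). inv_into (tile n k) (devel n) x \<in> U} =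
      bipyramid \<inter> (\<lambda>b. unfld k (to_cube b)) -` (cov n -` U)"
    using inv_devel by auto
  ultimately show "openin (top_of_set bipyramid) {x \<in> topspace (top_of_set bipyramid). inv_into (tile n k) (devel n) x \<in> U}"
    by simp
qed

section \<open>Adjacency and number of the tiles\<close>

lemma adjacent_tiles: "tile n k \<inter> tile n (k(i := k i + 1)) \<noteq> {}"
proof -
  \<comment> \<open>The centre of the common face. Only one coordinate is an integer, while an ideal
    edge needs two.\<close>
  define u :: "real^3" where "u = (\<chi> j. of_int (k j) + (if j = i then 1 else 1 / 2))"
  have "fld u $ j \<noteq> 0" "fld u $ j \<noteq> 1" if "j \<noteq> i" for j
    using that fold1_on[of "k j" "u$j"] by (simp_all add: fld_def u_def)
  then have "good u"
    using exhaust_3[of i] by (auto simp: good_def ideal_edge_def)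
  moreover have "u \<in> box_at k" "u \<in> box_at (k(i := k i + 1))" by (auto simp: box_at_def u_def)
  ultimately show ?thesis using cov_in_tile by blast
qed

lemma connected_tiles_n:
  "(tile n k, tile n k') \<in> {(S, S'). S \<in> range (tile n) \<and> S' \<in> range (tile n) \<and> S \<inter> S' \<noteq> {}}\<^sup>*"
    (is "_ \<in> ?R\<^sup>*")
proof -
  have sym: "(S, S') \<in> ?R\<^sup>* \<Longrightarrow> (S', S) \<in> ?R\<^sup>*" for S S'
  proof -
    have "sym ?R" by (auto simp: sym_def)
    then have "sym (?R\<^sup>*)" by (rule sym_rtrancl)
    then show "(S, S') \<in> ?R\<^sup>* \<Longrightarrow> (S', S) \<in> ?R\<^sup>*" by (rule symD)
  qed
  have nat: "(tile n k, tile n (k(i := k i + int m))) \<in> ?R\<^sup>*" for k i m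
  proof (induction m)
    case (Suc m)
    let ?k = "k(i := k i + int m)"
    have eq: "?k(i := ?k i + 1) = k(i := k i + int (Suc m))" by (rule ext) simp
    have "(tile n ?k, tile n (?k(i := ?k i + 1))) \<in> ?R"
      using adjacent_tiles[of ?k i] by blast
    then have "(tile n ?k, tile n (k(i := k i + int (Suc m)))) \<in> ?R" unfolding eq .
    with Suc show ?case by (rule rtrancl_into_rtrancl)
  qed simp
  have upd: "(tile n k, tile n (k(i := c))) \<in> ?R\<^sup>*" for k i c
  proof (cases "k i \<le> c")
    case True
    then show ?thesis using nat[of k i "nat (c - k i)"] by simp
  next
    case False
    then have eq: "(k(i := c))(i := (k(i := c)) i + int (nat (k i - c))) = k" by (intro ext) simp
    show ?thesis using sym[OF nat[of "k(i := c)" i "nat (k i - c)"]] unfolding eq .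
  qed
  have "((k(1 := k' 1))(2 := k' 2))(3 := k' 3) = k'"
  proof
    show "(((k(1 := k' 1))(2 := k' 2))(3 := k' 3)) i = k' i" for i using exhaust_3[of i] by auto
  qed
  moreover have "(tile n k, tile n (((k(1 := k' 1))(2 := k' 2))(3 := k' 3))) \<in> ?R\<^sup>*"
    by (rule rtrancl_trans[OF rtrancl_trans[OF upd upd] upd])
  ultimately show ?thesis by simp
qed

text \<open>A point over \<open>core\<close> has no integral coordinate, so its lift determines the
  box by rounding down.\<close>

lemma core_tiles:
  assumes "x \<in> tile n k" "x \<in> tile n k'" "devel n x \<in> core"
  shows "tile n k = tile n k'"
proof -
  obtain u where u: "u \<in> box_at k" "good u" "x = cov n u" using assms(1) by (auto simp: tile_def)
  obtain j where j: "latt n j" "u \<in> box_at (\<lambda>i. k' i + 2 * j i)" using tile_lift assms(2) u(3) by metis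
  have f: "0 < fld u $ i" "fld u $ i < 1" for i
    using core_interior(2,3)[of "of_cube (fld u)" i] assms(3) u to_cube_of_cube_fld[OF u(2)] by (simp_all add: devel_cov)
  have fl: "\<lfloor>u$i\<rfloor> = m i" if "u \<in> box_at m" for m i
  proof -
    have b: "of_int (m i) \<le> u$i" "u$i \<le> of_int (m i) + 1" using that by (auto simp: box_at_def)
    have "u$i \<noteq> of_int (m i) + 1"
      using f[of i] fold1_on[OF b] by (auto simp: fld_def split: if_splits)
    then show ?thesis using b by (intro floor_unique) auto
  qed
  have "k = (\<lambda>i. k' i + 2 * j i)" using fl[OF u(1)] fl[OF j(2)] by (intro ext) simp
  then show ?thesis using tile_add[OF j(1)] by simp
qed

text \<open>Boxes at even heights above one another: the centre of one lies in no other box, so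
  equal tiles would make \<open>n\<close> divide the difference of two indices below
  \<open>n\<close>. This fraction of all tiles is enough for the growth.\<close>

lemma card_tiles: "card (range (tile n)) \<ge> n"
proof -
  define k :: "nat \<Rightarrow> 3 \<Rightarrow> int" where "k m i = (if i = 3 then 2 * int m else 0)" for m i
  have "inj_on (\<lambda>m. tile n (k m)) {..<n}"
  proof
    fix a b assume ab: "a \<in> {..<n}" "b \<in> {..<n}" "tile n (k a) = tile n (k b)"
    define u :: "real^3" where "u = (\<chi> i. of_int (k a i) + 1 / 2)"
    have ua: "u \<in> box_at (k a)" by (simp add: box_at_def u_def)
    have "fld u $ i \<noteq> 0" "fld u $ i \<noteq> 1" for i
      using fold1_on[of "k a i" "u$i"] by (simp_all add: fld_def u_def)
    then have "good u" by (simp add: good_def ideal_edge_def)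
    then have "cov n u \<in> tile n (k b)" using cov_in_tile[OF ua] ab(3) by simp
    then obtain j where j: "latt n j" "u \<in> box_at (\<lambda>i. k b i + 2 * j i)" using tile_lift by blast
    have "k a i = k b i + 2 * j i" for i
    proof -
      have "of_int (k b i + 2 * j i) \<le> of_int (k a i) + (1 / 2 :: real)"
        "of_int (k a i) + (1 / 2 :: real) \<le> of_int (k b i + 2 * j i) + 1"
        using j(2) by (auto simp: box_at_def u_def)
      then show ?thesis by linarith
    qed
    from this[of 1] this[of 2] this[of 3] have "j 1 = 0" "j 2 = 0" "int a - int b = j 3" by (auto simp: k_def)
    then have "int n dvd int a - int b" using j(1) by (simp add: latt_def)
    moreover have "\<bar>int a - int b\<bar> < int n" using ab by auto
    ultimately have "int a - int b = 0" by (metis dvd_imp_le_int abs_of_nat linorder_not_le)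
    then show "a = b" by simp
  qed
  then have "card ((\<lambda>m. tile n (k m)) ` {..<n}) = n" by (simp add: card_image)
  moreover have "(\<lambda>m. tile n (k m)) ` {..<n} \<subseteq> range (tile n)" by blast
  ultimately show ?thesis using card_mono[OF finite_tiles_n] by metis
qed

end

lemma fold1_Ints: "t \<in> \<int> \<longleftrightarrow> fold1 t = 0 \<or> fold1 t = 1"
proof
  assume "t \<in> \<int>"
  then obtain k :: int where "t = of_int k" by (rule Ints_cases)
  then show "fold1 t = 0 \<or> fold1 t = 1" using fold1_on[of k t] by simp
next
  assume "fold1 t = 0 \<or> fold1 t = 1"
  then obtain k :: int where "t = 2 * of_int k \<or> t = 2 * of_int k + 1" using fold1_eq_0 fold1_eq_1 by blast
  then have "t = of_int (2 * k) \<or> t = of_int (2 * k + 1)" by simp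
  then show "t \<in> \<int>" using Ints_of_int by metis
qed

lemma open_H3_ball:
  assumes "b \<in> H3" "\<rho> > 0"
  shows "open {c \<in> H3. H3_dist b c < \<rho>}"
proof -
  have "{c \<in> H3. H3_dist b c < \<rho>} = {c. 0 < c$3} \<inter> {c. (dist b c)\<^sup>2 < 2 * b$3 * c$3 * (cosh \<rho> - 1)}"
    using H3_dist_less_iff[OF assms(1)] assms(2) by (auto simp: H3_iff)
  moreover have "open \<dots>" by (intro open_Int open_Collect_less continuous_intros)
  ultimately show ?thesis by simp
qed

text \<open>Near a boundary point the inequalities of the walls not through it persist, so only its
  own mirrors remain to be considered.\<close>

lemma walls_stay_positive:
  assumes b: "b \<in> H3"
  obtains \<epsilon> where "\<epsilon> > 0" "\<And>c i e. dist b c < \<epsilon> \<Longrightarrow> lor (hyp b) (wall i e) > 0 \<Longrightarrow> lor (hyp c) (wall i e) > 0"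
proof -
  have h: "isCont hyp b" using continuous_on_hyp continuous_on_eq_continuous_at[OF open_H3] b by blast
  have "\<forall>\<^sub>F c in nhds b. lor (hyp b) (wall i e) > 0 \<longrightarrow> lor (hyp c) (wall i e) > 0" for i e
  proof (cases "lor (hyp b) (wall i e) > 0")
    case True
    have "isCont (\<lambda>c. lor (hyp c) (wall i e)) b"
      unfolding lor_def by (intro continuous_intros h) auto
    then have "((\<lambda>c. lor (hyp c) (wall i e)) \<longlongrightarrow> lor (hyp b) (wall i e)) (nhds b)"
      using isCont_def tendsto_at_iff_tendsto_nhds by blast
    then have "\<forall>\<^sub>F c in nhds b. lor (hyp c) (wall i e) > 0" using True by (rule order_tendstoD(1))
    then show ?thesis by (rule eventually_mono) simp
  qed simp
  then have "\<forall>\<^sub>F c in nhds b. \<forall>i e. lor (hyp b) (wall i e) > 0 \<longrightarrow> lor (hyp c) (wall i e) > 0"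
    by (intro eventually_all_finite) auto
  then obtain \<epsilon> where "\<epsilon> > 0" "\<And>c. dist c b < \<epsilon> \<Longrightarrow> \<forall>i e. lor (hyp b) (wall i e) > 0 \<longrightarrow> lor (hyp c) (wall i e) > 0"
    unfolding eventually_nhds_metric by blast
  then show ?thesis using that by (metis dist_commute)
qed

section \<open>Unfolding around a point of the rod complement\<close>

context
  fixes n :: nat and u\<^sub>0 :: "real^3"
  assumes n: "n > 0" and good0: "good u\<^sub>0"
begin

definition base :: "real^3" where "base = of_cube (fld u\<^sub>0)"
definition sides :: "3 set" where "sides = {i. u\<^sub>0$i \<in> \<int>}"
text \<open>Meaningful for \<open>i\<close> in \<open>sides\<close>, where the folded coordinate is
  0 or 1 and selects one of two opposite walls.\<close>

definition normal :: "3 \<Rightarrow> real^4" where "normal i = wall i (fld u\<^sub>0 $ i = 1)"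

lemma base_bip: "base \<in> bipyramid"
  using of_cube_fld[OF good0] by (simp add: base_def)

lemma base_H3: "base \<in> H3"
  using base_bip bipyramid_H3 by blast

lemma to_cube_base: "to_cube base = fld u\<^sub>0"
  using to_cube_of_cube_fld[OF good0] by (simp add: base_def)

lemma finite_sides: "finite sides"
  by simp

lemma sides_iff: "i \<in> sides \<longleftrightarrow> fld u\<^sub>0 $ i = 0 \<or> fld u\<^sub>0 $ i = 1"
  by (simp add: sides_def fold1_Ints fld_def)

lemma base_normal: "i \<in> sides \<Longrightarrow> lor (hyp base) (normal i) = 0"
  using to_cube_eq_iff(1,2)[OF base_bip, of i] sides_iff[of i] unfolding to_cube_base normal_def
  by (cases "fld u\<^sub>0 $ i = 1") auto

lemma base_other_wall: "\<not> (i \<in> sides \<and> e = (fld u\<^sub>0 $ i = 1)) \<Longrightarrow> lor (hyp base) (wall i e) > 0"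
proof -
  assume *: "\<not> (i \<in> sides \<and> e = (fld u\<^sub>0 $ i = 1))"
  have "lor (hyp base) (wall i e) \<ge> 0" using base_bip by (simp add: bipyramid_def)
  moreover have "lor (hyp base) (wall i e) \<noteq> 0"
    using * to_cube_eq_iff(1,2)[OF base_bip, of i] sides_iff[of i] unfolding to_cube_base
    by (cases e) auto
  ultimately show ?thesis by simp
qed

text \<open>Being off the ideal edges excludes exactly the tangent pairs of walls.\<close>

lemma normal_orthonormal:
  assumes "i \<in> sides" "j \<in> sides"
  shows "lor (normal i) (normal j) = (if i = j then 1 else 0)"
proof -
  have g: "\<not> ideal_edge (fld u\<^sub>0)" using good0 by (simp add: good_def)
  have s: "fld u\<^sub>0 $ i \<noteq> 1 \<Longrightarrow> fld u\<^sub>0 $ i = 0" "fld u\<^sub>0 $ j \<noteq> 1 \<Longrightarrow> fld u\<^sub>0 $ j = 0"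
    using assms by (simp_all add: sides_iff)
  have a: "lor (normal 1) (normal 2) = 0" if "1 \<in> sides" "2 \<in> sides"
    using that g unfolding normal_def by (intro lor_wall_orthogonal) (auto simp: sides_iff ideal_edge_def)
  have b: "lor (normal 2) (normal 3) = 0" if "2 \<in> sides" "3 \<in> sides"
    using that g unfolding normal_def by (intro lor_wall_orthogonal) (auto simp: sides_iff ideal_edge_def)
  have c: "lor (normal 3) (normal 1) = 0" if "3 \<in> sides" "1 \<in> sides"
    using that g unfolding normal_def by (intro lor_wall_orthogonal) (auto simp: sides_iff ideal_edge_def)
  have self: "lor (normal i) (normal i) = 1" by (simp add: normal_def lor_wall_self)
  show ?thesis
    using exhaust_3[of i] exhaust_3[of j] a b c self assms
    by (elim disjE; hypsubst; simp add: lor_commute[of "normal 2" "normal 1"]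
        lor_commute[of "normal 3" "normal 2"] lor_commute[of "normal 1" "normal 3"])
qed

lemmas reflection_facts = finite_sides normal_orthonormal base_H3 base_normal

definition near :: "real \<Rightarrow> real^3 \<Rightarrow> bool" where
  "near \<delta> u \<longleftrightarrow> (\<forall>i. \<bar>u$i - u\<^sub>0$i\<bar> < \<delta>)"

text \<open>Points within \<delta> stay in the same unit interval in each nonintegral coordinate.
  The bound 1/2 keeps integral coordinates within the two adjacent intervals and separates different
  lifts, which differ by at least 2 in some coordinate.\<close>

definition small :: "real \<Rightarrow> bool" where
  "small \<delta> \<longleftrightarrow> 0 < \<delta> \<and> \<delta> \<le> 1 / 2 \<and>
     (\<forall>i. i \<notin> sides \<longrightarrow> of_int \<lfloor>u\<^sub>0$i\<rfloor> + \<delta> < u\<^sub>0$i \<and> u\<^sub>0$i < of_int \<lfloor>u\<^sub>0$i\<rfloor> + 1 - \<delta>)"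

lemma small_exists: "\<exists>\<delta>. small \<delta>"
proof -
  define d where "d i = (if i \<in> sides then 1 / 2 else min (frac (u\<^sub>0$i)) (1 - frac (u\<^sub>0$i)) / 2)" for i
  have d: "d i > 0" "d i \<le> 1 / 2" for i
    using frac_lt_1[of "u\<^sub>0$i"] frac_ge_0[of "u\<^sub>0$i"] frac_eq_0_iff[of "u\<^sub>0$i"]
    by (auto simp: d_def sides_def min_def)
  define \<delta> where "\<delta> = Min (range d)"
  have le: "\<delta> \<le> d i" for i unfolding \<delta>_def by (rule Min_le) auto
  have "\<delta> > 0" unfolding \<delta>_def using d by (subst Min_gr_iff) auto
  moreover have "\<delta> \<le> 1 / 2" using le[of 1] d(2)[of 1] by simp
  moreover have "of_int \<lfloor>u\<^sub>0$i\<rfloor> + \<delta> < u\<^sub>0$i \<and> u\<^sub>0$i < of_int \<lfloor>u\<^sub>0$i\<rfloor> + 1 - \<delta>" if i: "i \<notin> sides" for i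
  proof -
    have "\<delta> \<le> frac (u\<^sub>0$i) / 2" "\<delta> \<le> (1 - frac (u\<^sub>0$i)) / 2"
      using le[of i] i by (auto simp: d_def min_def split: if_splits)
    moreover have "0 < frac (u\<^sub>0$i)" "frac (u\<^sub>0$i) < 1"
      using i frac_lt_1[of "u\<^sub>0$i"] frac_gt_0_iff[of "u\<^sub>0$i"] by (auto simp: sides_def)
    ultimately have "of_int \<lfloor>u\<^sub>0$i\<rfloor> + \<delta> < u\<^sub>0$i" "u\<^sub>0$i < of_int \<lfloor>u\<^sub>0$i\<rfloor> + 1 - \<delta>"
      by (simp_all add: frac_def field_simps)
    then show ?thesis by blast
  qed
  ultimately show ?thesis unfolding small_def by blast
qed

lemma common_box:
  assumes \<delta>: "small \<delta>" and u: "near \<delta> u" and v: "near \<delta> v"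
    and sep: "\<And>i. i \<in> sides \<Longrightarrow> \<not> (u$i < u\<^sub>0$i \<and> u\<^sub>0$i < v$i) \<and> \<not> (v$i < u\<^sub>0$i \<and> u\<^sub>0$i < u$i)"
  obtains m where "u\<^sub>0 \<in> box_at m" "u \<in> box_at m" "v \<in> box_at m"
proof -
  \<comment> \<open>At an integral coordinate the lower interval is taken if one of the two points
    lies below; \<open>sep\<close> ensures that the other is not above.\<close>
  define m where "m i = (if i \<in> sides \<and> (u$i < u\<^sub>0$i \<or> v$i < u\<^sub>0$i) then \<lfloor>u\<^sub>0$i\<rfloor> - 1 else \<lfloor>u\<^sub>0$i\<rfloor>)" for i
  have near: "u\<^sub>0$i - \<delta> < u$i \<and> u$i < u\<^sub>0$i + \<delta> \<and> u\<^sub>0$i - \<delta> < v$i \<and> v$i < u\<^sub>0$i + \<delta>" for i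
    using u v by (auto simp: near_def abs_less_iff dest: spec[of _ i])
  have "\<forall>w\<in>{u\<^sub>0, u, v}. of_int (m i) \<le> w$i \<and> w$i \<le> of_int (m i) + 1" for i
  proof (cases "i \<in> sides")
    case True
    then obtain z where z: "u\<^sub>0$i = of_int z" by (auto simp: sides_def elim: Ints_cases)
    have "\<delta> \<le> 1 / 2" using \<delta> by (simp add: small_def)
    then show ?thesis using near[of i] sep[OF True] True unfolding m_def by (auto simp: z)
  next
    case False
    then show ?thesis using near[of i] \<delta> by (auto simp: m_def small_def dest!: spec[of _ i])
  qed
  then show ?thesis using that[of m] by (auto simp: box_at_def)
qed

lemma near_box:
  assumes \<delta>: "small \<delta>" and u: "near \<delta> u" "u \<in> box_at m"
  shows "u\<^sub>0 \<in> box_at m"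
proof -
  have "of_int (m i) \<le> u\<^sub>0$i \<and> u\<^sub>0$i \<le> of_int (m i) + 1" for i
  proof -
    have b: "of_int (m i) \<le> u$i" "u$i \<le> of_int (m i) + 1" "u\<^sub>0$i - \<delta> < u$i" "u$i < u\<^sub>0$i + \<delta>"
      using u by (auto simp: box_at_def near_def abs_less_iff dest!: spec[of _ i])
    show ?thesis
    proof (cases "i \<in> sides")
      case True
      then obtain z where z: "u\<^sub>0$i = of_int z" by (auto simp: sides_def elim: Ints_cases)
      moreover have "\<delta> \<le> 1 / 2" using \<delta> by (simp add: small_def)
      ultimately have "m i \<le> z" "z \<le> m i + 1" using b unfolding z by linarith+
      then have "real_of_int (m i) \<le> real_of_int z" "real_of_int z \<le> real_of_int (m i + 1)"
        by (simp_all only: of_int_le_iff)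
      then show ?thesis unfolding z by simp
    next
      case False
      then have "of_int \<lfloor>u\<^sub>0$i\<rfloor> + \<delta> < u\<^sub>0$i" "u\<^sub>0$i < of_int \<lfloor>u\<^sub>0$i\<rfloor> + 1 - \<delta>" "\<delta> > 0" using \<delta> by (auto simp: small_def)
      then have "m i = \<lfloor>u\<^sub>0$i\<rfloor>" using b by linarith
      then show ?thesis by simp
    qed
  qed
  then show ?thesis by (simp add: box_at_def)
qed

lemma near_self: "\<delta> > 0 \<Longrightarrow> near \<delta> u\<^sub>0"
  by (simp add: near_def)

lemma near_unique:
  assumes \<delta>: "small \<delta>" and u: "near \<delta> u" "near \<delta> v" "cov n u = cov n v"
  shows "u = v"
proof -
  obtain j where j: "u = v + (\<chi> i. 2 * of_int (j i))" using cov_eq_iff[OF n] u(3) by blast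
  have "j i = 0" for i
  proof -
    have "\<bar>u$i - u\<^sub>0$i\<bar> < \<delta>" "\<bar>v$i - u\<^sub>0$i\<bar> < \<delta>" "\<delta> \<le> 1 / 2" using u \<delta> by (auto simp: near_def small_def)
    moreover have "u$i = v$i + 2 * of_int (j i)" by (simp add: j)
    ultimately show ?thesis by linarith
  qed
  then show ?thesis by (simp add: j vec_eq_iff)
qed

lemma open_near: "open {u. near \<delta> u}"
proof -
  have "{u. near \<delta> u} = (\<Inter>i. {u. \<bar>u$i - u\<^sub>0$i\<bar> < \<delta>})" by (auto simp: near_def)
  moreover have "open \<dots>" by (intro open_INT ballI open_Collect_less continuous_intros) auto
  ultimately show ?thesis by simp
qed

lemma wall_sign:
  assumes \<delta>: "small \<delta>" and u: "near \<delta> u" "good u" and i: "i \<in> sides"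
  shows "lor (hyp (of_cube (fld u))) (normal i) \<ge> 0"
    "lor (hyp (of_cube (fld u))) (normal i) = 0 \<longleftrightarrow> u$i = u\<^sub>0$i"
proof -
  have bip: "of_cube (fld u) \<in> bipyramid" using of_cube_fld[OF u(2)] .
  then show "lor (hyp (of_cube (fld u))) (normal i) \<ge> 0" by (simp add: bipyramid_def normal_def)
  obtain m where m: "u\<^sub>0 \<in> box_at m" "u \<in> box_at m" by (rule common_box[OF \<delta> u(1) u(1)]) auto
  have "lor (hyp (of_cube (fld u))) (normal i) = 0 \<longleftrightarrow> fld u $ i = fld u\<^sub>0 $ i"
    using to_cube_eq_iff(1,2)[OF bip, of i] i sides_iff[of i]
    unfolding to_cube_of_cube_fld[OF u(2)] normal_def by (cases "fld u\<^sub>0 $ i = 1") auto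
  also have "\<dots> \<longleftrightarrow> u$i = u\<^sub>0$i" using abs_fld[OF m(2,1), of i] by auto
  finally show "lor (hyp (of_cube (fld u))) (normal i) = 0 \<longleftrightarrow> u$i = u\<^sub>0$i" .
qed

definition lift :: "real \<Rightarrow> (real^3) set \<Rightarrow> real^3" where
  "lift \<delta> y = (SOME u. near \<delta> u \<and> cov n u = y)"

text \<open>The developed point lies in one corner of the mirrors; it is reflected in the mirrors
  whose coordinate plane the lift lies below.\<close>

definition unfolding_map :: "real \<Rightarrow> (real^3) set \<Rightarrow> real^3" where
  "unfolding_map \<delta> y = reflect sides normal {i. lift \<delta> y $ i < u\<^sub>0$i} (devel n y)"

lemma lift_cov:
  assumes "small \<delta>" "near \<delta> u"
  shows "lift \<delta> (cov n u) = u"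
proof -
  have "near \<delta> (lift \<delta> (cov n u)) \<and> cov n (lift \<delta> (cov n u)) = cov n u"
    unfolding lift_def by (rule someI[of _ u]) (simp add: assms)
  then show ?thesis using near_unique[OF assms(1) _ assms(2)] by blast
qed

text \<open>On a coordinate plane either choice of \<open>S\<close> gives the same point, so that
  one set \<open>S\<close> can serve a whole closed box.\<close>

lemma unfolding_map_cov:
  assumes \<delta>: "small \<delta>" and u: "near \<delta> u" "good u"
    and S: "\<And>i. i \<in> sides \<Longrightarrow> i \<in> S \<Longrightarrow> u$i \<le> u\<^sub>0$i" "\<And>i. i \<in> sides \<Longrightarrow> i \<notin> S \<Longrightarrow> u\<^sub>0$i \<le> u$i"
  shows "unfolding_map \<delta> (cov n u) = reflect sides normal S (of_cube (fld u))"
  unfolding unfolding_map_def lift_cov[OF \<delta> u(1)] devel_cov[OF n]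
proof (rule reflect_cong)
  fix i assume i: "i \<in> sides" and "lor (hyp (of_cube (fld u))) (normal i) \<noteq> 0"
  then have "u$i \<noteq> u\<^sub>0$i" using wall_sign(2)[OF \<delta> u i] by simp
  then show "i \<in> {i. u$i < u\<^sub>0$i} \<longleftrightarrow> i \<in> S" using S[OF i] by force
qed

lemma unfolding_map_H3:
  assumes \<delta>: "small \<delta>" and u: "near \<delta> u" "good u"
  shows "unfolding_map \<delta> (cov n u) \<in> H3"
    "i \<in> sides \<Longrightarrow> lor (hyp (unfolding_map \<delta> (cov n u))) (normal i) =
      (if u$i < u\<^sub>0$i then - 1 else 1) * lor (hyp (of_cube (fld u))) (normal i)"
proof -
  have H: "of_cube (fld u) \<in> H3" using of_cube_fld[OF u(2)] bipyramid_H3 by blast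
  have eq: "unfolding_map \<delta> (cov n u) = reflect sides normal {i. u$i < u\<^sub>0$i} (of_cube (fld u))"
    by (rule unfolding_map_cov[OF \<delta> u]) auto
  show "unfolding_map \<delta> (cov n u) \<in> H3" unfolding eq by (rule hyp_reflect(2)[OF reflection_facts H])
  show "lor (hyp (unfolding_map \<delta> (cov n u))) (normal i) =
      (if u$i < u\<^sub>0$i then - 1 else 1) * lor (hyp (of_cube (fld u))) (normal i)" if "i \<in> sides"
    by (simp add: eq hyp_reflect(1)[OF reflection_facts H] lor_mirror_normal[OF reflection_facts that])
qed

lemma unfolding_map_base:
  assumes "small \<delta>"
  shows "unfolding_map \<delta> (cov n u\<^sub>0) = base"
proof -
  have "near \<delta> u\<^sub>0" using assms by (simp add: near_self small_def)
  then have "unfolding_map \<delta> (cov n u\<^sub>0) = reflect sides normal {} (of_cube (fld u\<^sub>0))"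
    by (rule unfolding_map_cov[OF assms _ good0]) auto
  then show ?thesis using reflect_base[OF reflection_facts] by (simp add: base_def)
qed

lemma unfolding_map_isometry:
  assumes \<delta>: "small \<delta>" and u: "near \<delta> u" "good u" "u \<in> box_at m" and v: "near \<delta> v" "good v" "v \<in> box_at m"
  shows "H3_dist (unfolding_map \<delta> (cov n u)) (unfolding_map \<delta> (cov n v)) = H3_dist (of_cube (fld u)) (of_cube (fld v))"
proof -
  \<comment> \<open>The coordinates in which the box lies on the lower side of the given centre. On
    the whole box the unfolding is then one fixed reflection after development.\<close>
  define S where "S = {i. of_int (m i) < u\<^sub>0$i}"
  have u0: "u\<^sub>0 \<in> box_at m" using near_box[OF \<delta> u(1,3)] .
  have S: "w$i \<le> u\<^sub>0$i" if iw: "i \<in> sides" "i \<in> S" "w \<in> box_at m" for i w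
  proof -
    obtain z where z: "u\<^sub>0$i = of_int z" using iw(1) by (auto simp: sides_def elim: Ints_cases)
    have "of_int (m i) < u\<^sub>0$i" and wz: "w$i \<le> of_int (m i) + 1" using iw by (auto simp: S_def box_at_def)
    then have "m i + 1 \<le> z" unfolding z by linarith
    then have "real_of_int (m i + 1) \<le> real_of_int z" by (simp only: of_int_le_iff)
    then show ?thesis using wz unfolding z by simp
  qed
  have S': "u\<^sub>0$i \<le> w$i" if "i \<in> sides" "i \<notin> S" "w \<in> box_at m" for i w
  proof -
    have "u\<^sub>0$i \<le> of_int (m i)" "of_int (m i) \<le> w$i" using that by (auto simp: S_def box_at_def)
    then show ?thesis by linarith
  qed
  have "unfolding_map \<delta> (cov n u) = reflect sides normal S (of_cube (fld u))"
    "unfolding_map \<delta> (cov n v) = reflect sides normal S (of_cube (fld v))"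
    using S S' u v by (auto intro!: unfolding_map_cov[OF \<delta>])
  moreover have "of_cube (fld u) \<in> H3" "of_cube (fld v) \<in> H3" using of_cube_fld u v bipyramid_H3 by blast+
  ultimately show ?thesis using H3_dist_reflect[OF reflection_facts] by simp
qed

interpretation T: tiled "rod_complement (rods n)" "range (tile n)" "devel n" .

lemma unfolding_exists: "\<exists>r \<phi> N. T.unfolding_at (cov n u\<^sub>0) r \<phi> N"
proof -
  obtain \<delta> where \<delta>: "small \<delta>" using small_exists by blast
  then have \<delta>0: "\<delta> > 0" by (simp add: small_def)
  \<comment> \<open>Two conditions limit the radius: cube coordinates must move by less than
    \<delta>, and the walls not through \<open>base\<close> must stay positive.\<close>
  obtain \<epsilon>1 where \<epsilon>1: "\<epsilon>1 > 0" "\<And>b. b \<in> bipyramid \<Longrightarrow> dist b base < \<epsilon>1 \<Longrightarrow> dist (to_cube b) (to_cube base) < \<delta>"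
    using continuous_on_to_cube base_bip \<delta>0 unfolding continuous_on_iff by blast
  obtain \<epsilon>2 where \<epsilon>2: "\<epsilon>2 > 0"
    "\<And>c i e. dist base c < \<epsilon>2 \<Longrightarrow> lor (hyp base) (wall i e) > 0 \<Longrightarrow> lor (hyp c) (wall i e) > 0"
    using walls_stay_positive[OF base_H3] by blast
  obtain r where r: "r > 0" "\<And>c. c \<in> H3 \<Longrightarrow> H3_dist base c < r \<Longrightarrow> dist base c < min \<epsilon>1 \<epsilon>2"
    using H3_ball_small[OF base_H3, of "min \<epsilon>1 \<epsilon>2"] \<epsilon>1(1) \<epsilon>2(1) by auto
  have close: "\<bar>to_cube b $ i - fld u\<^sub>0 $ i\<bar> < \<delta>" if "b \<in> bipyramid" "H3_dist base b < r" for b i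
  proof -
    have "dist (to_cube b) (to_cube base) < \<delta>"
      using \<epsilon>1(2)[OF that(1)] r(2)[OF _ that(2)] that(1) bipyramid_H3 by (auto simp: dist_commute)
    moreover have "\<bar>to_cube b $ i - to_cube base $ i\<bar> \<le> dist (to_cube b) (to_cube base)"
      using component_le_norm_cart[of "to_cube b - to_cube base" i] by (simp add: dist_norm)
    ultimately show ?thesis by (simp add: to_cube_base)
  qed
  \<comment> \<open>The lift of the star to a neighbourhood of the centre in Euclidean space;
    openness and common tiles are checked there.\<close>
  define V where "V \<rho> = {u. near \<delta> u \<and> good u \<and> H3_dist base (of_cube (fld u)) < \<rho>}" for \<rho>
  have star: "T.star (cov n u\<^sub>0) \<rho> = cov n ` V \<rho>" if \<rho>: "\<rho> \<le> r" for \<rho>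
  proof (intro equalityI subsetI)
    fix y assume "y \<in> T.star (cov n u\<^sub>0) \<rho>"
    then obtain k where k: "cov n u\<^sub>0 \<in> tile n k" "y \<in> tile n k"
      and d: "H3_dist (devel n (cov n u\<^sub>0)) (devel n y) < \<rho>" by (auto simp: T.star_def)
    obtain j where j: "latt n j" "u\<^sub>0 \<in> box_at (\<lambda>i. k i + 2 * j i)" using tile_lift[OF n k(1)] by metis
    have "y \<in> tile n (\<lambda>i. k i + 2 * j i)" using k(2) tile_add[OF n j(1)] by simp
    then obtain u where u: "u \<in> box_at (\<lambda>i. k i + 2 * j i)" "good u" "y = cov n u" by (auto simp: tile_def)
    have d': "H3_dist base (of_cube (fld u)) < \<rho>" using d by (simp add: u(3) devel_cov[OF n] base_def)
    have "near \<delta> u"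
      unfolding near_def
    proof
      fix i
      show "\<bar>u$i - u\<^sub>0$i\<bar> < \<delta>"
        using close[OF of_cube_fld[OF u(2)], of i] d' \<rho> abs_fld[OF u(1) j(2), of i]
        by (simp add: to_cube_of_cube_fld[OF u(2)])
    qed
    then show "y \<in> cov n ` V \<rho>" using u d' by (auto simp: V_def)
  next
    fix y assume "y \<in> cov n ` V \<rho>"
    then obtain u where u: "y = cov n u" "near \<delta> u" "good u" "H3_dist base (of_cube (fld u)) < \<rho>" by (auto simp: V_def)
    obtain m where m: "u\<^sub>0 \<in> box_at m" "u \<in> box_at m" by (rule common_box[OF \<delta> u(2) u(2)]) auto
    have "cov n u\<^sub>0 \<in> tile n m" "y \<in> tile n m" using cov_in_tile[OF n] m u good0 by auto
    then show "y \<in> T.star (cov n u\<^sub>0) \<rho>"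
      using u(4) unfolding T.star_def by (auto simp: u(1) devel_cov[OF n] base_def intro!: exI[of _ m])
  qed
  let ?\<phi> = "unfolding_map \<delta>"
  have V: "near \<delta> u" "good u" if "u \<in> V r" for u using that by (auto simp: V_def)
  have lifted: "\<exists>m. u \<in> box_at m \<and> v \<in> box_at m \<and> u\<^sub>0 \<in> box_at m \<and> tile n m = tile n k"
    if uv: "u \<in> V r" "v \<in> V r" "cov n u \<in> tile n k" "cov n v \<in> tile n k" for u v k
  proof -
    obtain j where j: "latt n j" "u \<in> box_at (\<lambda>i. k i + 2 * j i)" using tile_lift[OF n uv(3)] by metis
    obtain j' where j': "latt n j'" "v \<in> box_at (\<lambda>i. k i + 2 * j' i)" using tile_lift[OF n uv(4)] by metis
    have 0: "u\<^sub>0 \<in> box_at (\<lambda>i. k i + 2 * j i)" "u\<^sub>0 \<in> box_at (\<lambda>i. k i + 2 * j' i)"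
      using near_box[OF \<delta> V(1)] j j' uv by blast+
    \<comment> \<open>The centre lies in both boxes, and unit intervals displaced by a nonzero even
      integer are disjoint.\<close>
    have "j i = j' i" for i
    proof -
      have "of_int (k i + 2 * j i) \<le> u\<^sub>0$i" "u\<^sub>0$i \<le> of_int (k i + 2 * j i) + 1"
        "of_int (k i + 2 * j' i) \<le> u\<^sub>0$i" "u\<^sub>0$i \<le> of_int (k i + 2 * j' i) + 1"
        using 0 by (auto simp: box_at_def)
      then show ?thesis by linarith
    qed
    then have "j = j'" by (rule ext)
    then show ?thesis using j j' 0 tile_add[OF n j(1)] by blast
  qed
  have "T.unfolding_at (cov n u\<^sub>0) r ?\<phi> (normal ` sides)"
    unfolding T.unfolding_at_def
  proof (intro conjI allI impI ballI)
    show "r > 0" by fact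
    fix \<rho> assume \<rho>: "0 < \<rho> \<and> \<rho> \<le> r"
    have "continuous_on {u. good u} (\<lambda>u. of_cube (fld u))"
      by (rule continuous_on_compose2[OF continuous_on_of_cube continuous_on_fld]) (auto simp: good_iff)
    then have "open ({u. good u} \<inter> (\<lambda>u. of_cube (fld u)) -` {c \<in> H3. H3_dist base c < \<rho>})"
      using open_good open_H3_ball[OF base_H3] \<rho> by (intro continuous_open_preimage) auto
    then have "open ({u. near \<delta> u} \<inter> ({u. good u} \<inter> (\<lambda>u. of_cube (fld u)) -` {c \<in> H3. H3_dist base c < \<rho>}))"
      by (rule open_Int[OF open_near])
    moreover have "{u. near \<delta> u} \<inter> ({u. good u} \<inter> (\<lambda>u. of_cube (fld u)) -` {c \<in> H3. H3_dist base c < \<rho>}) = V \<rho>"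
      using of_cube_fld bipyramid_H3 by (auto simp: V_def)
    ultimately have "openin torus3 (cov n ` V \<rho>)" using openin_cov_image[OF n] by simp
    then show "openin (rod_complement (rods n)) (T.star (cov n u\<^sub>0) \<rho>)"
      using \<rho> star[of \<rho>] openin_rod_complement[OF n] by (auto simp: V_def)
  next
    fix y T assume y: "y \<in> T.star (cov n u\<^sub>0) r" and T: "T \<in> range (tile n)" "y \<in> T"
    obtain u where u: "u \<in> V r" "y = cov n u" using y star[of r] by auto
    obtain k where k: "T = tile n k" using T by blast
    obtain m where "u\<^sub>0 \<in> box_at m" "tile n m = tile n k" using lifted[OF u(1) u(1)] T(2) u(2) k by blast
    then show "cov n u\<^sub>0 \<in> T" using cov_in_tile[OF n _ good0] k by blast
  next
    fix y assume "y \<in> T.star (cov n u\<^sub>0) r"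
    then show "?\<phi> y \<in> H3" using star[of r] unfolding_map_H3(1)[OF \<delta>] V by auto
  next
    fix T x y assume T: "T \<in> range (tile n)" and x: "x \<in> T \<inter> T.star (cov n u\<^sub>0) r" and y: "y \<in> T \<inter> T.star (cov n u\<^sub>0) r"
    obtain u where u: "u \<in> V r" "x = cov n u" using x star[of r] by auto
    obtain v where v: "v \<in> V r" "y = cov n v" using y star[of r] by auto
    obtain k where k: "T = tile n k" using T by blast
    obtain m where m: "u \<in> box_at m" "v \<in> box_at m" using lifted[OF u(1) v(1)] x y u(2) v(2) k by blast
    show "H3_dist (?\<phi> x) (?\<phi> y) = H3_dist (devel n x) (devel n y)"
      unfolding u(2) v(2) devel_cov[OF n] using unfolding_map_isometry[OF \<delta>] V u(1) v(1) m by blast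
  next
    fix c assume c: "c \<in> H3" and d: "H3_dist (?\<phi> (cov n u\<^sub>0)) c < r"
    have d: "H3_dist base c < r" using d unfolding unfolding_map_base[OF \<delta>] .
    \<comment> \<open>Reflecting in the mirrors on whose negative side \<open>c\<close> lies brings
      it into the corner. The other walls are positive by the choice of \<open>\<epsilon>2\<close>,
      so the result is in the bipyramid.\<close>
    define S where "S = {i. lor (hyp c) (normal i) < 0}"
    define b where "b = reflect sides normal S c"
    have bH: "b \<in> H3" and hb: "hyp b = mirror sides normal S (hyp c)"
      using hyp_reflect[OF reflection_facts c] by (simp_all add: b_def)
    have db: "H3_dist base b < r"
      using H3_dist_reflect[OF reflection_facts base_H3 c, of S] reflect_base[OF reflection_facts, of S] d by (simp add: b_def)
    have "lor (hyp b) (wall i e) \<ge> 0" for i e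
    proof (cases "i \<in> sides \<and> e = (fld u\<^sub>0 $ i = 1)")
      case True
      then have "wall i e = normal i" by (simp add: normal_def)
      then show ?thesis using True lor_mirror_normal[OF reflection_facts, of i S "hyp c"] by (simp add: hb S_def)
    next
      case False
      have "dist base b < \<epsilon>2" using r(2)[OF bH db] by simp
      then show ?thesis using \<epsilon>2(2) base_other_wall[OF False] by (simp add: less_imp_le)
    qed
    then have bb: "b \<in> bipyramid" using bH by (simp add: bipyramid_def)
    \<comment> \<open>The box on the lower side in the reflected coordinates, so that unfolding
      undoes the reflection.\<close>
    define m where "m i = (if i \<in> sides \<and> i \<in> S then \<lfloor>u\<^sub>0$i\<rfloor> - 1 else \<lfloor>u\<^sub>0$i\<rfloor>)" for i
    have fl: "of_int \<lfloor>u\<^sub>0$i\<rfloor> = u\<^sub>0$i" if "i \<in> sides" for i using that by (simp add: sides_def)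
    have "of_int (m i) \<le> u\<^sub>0$i \<and> u\<^sub>0$i \<le> of_int (m i) + 1" for i
      using fl[of i] by (cases "i \<in> sides \<and> i \<in> S") (auto simp: m_def)
    then have m0: "u\<^sub>0 \<in> box_at m" by (simp add: box_at_def)
    define u where "u = unfld m (to_cube b)"
    have tc: "to_cube b \<in> cube" using to_cube_in_cube[OF bb] .
    have um: "u \<in> box_at m" and fu: "fld u = to_cube b" and gu: "good u"
      using unfld_in_box[OF tc] fld_unfld[OF tc] good_unfld[OF tc] by (simp_all add: u_def)
    have nu: "near \<delta> u"
      unfolding near_def using abs_fld[OF um m0] close[OF bb db] fu by simp
    have ofu: "of_cube (fld u) = b" using fu of_to_cube[OF bb] by simp
    have "?\<phi> (cov n u) = reflect sides normal S (of_cube (fld u))"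
    proof (rule unfolding_map_cov[OF \<delta> nu gu])
      fix i assume i: "i \<in> sides"
      have b: "of_int (m i) \<le> u$i" "u$i \<le> of_int (m i) + 1" using um by (auto simp: box_at_def)
      show "i \<in> S \<Longrightarrow> u$i \<le> u\<^sub>0$i" "i \<notin> S \<Longrightarrow> u\<^sub>0$i \<le> u$i" using b fl[OF i] i by (simp_all add: m_def)
    qed
    then have "?\<phi> (cov n u) = c" using reflect_reflect[OF reflection_facts c, of S] ofu by (simp add: b_def)
    moreover have "u \<in> V r" using nu gu ofu db by (simp add: V_def)
    ultimately show "c \<in> ?\<phi> ` T.star (cov n u\<^sub>0) r" using star[of r] by force
  next
    show "finite (normal ` sides)" by simp
  next
    fix x y assume x: "x \<in> T.star (cov n u\<^sub>0) r" and y: "y \<in> T.star (cov n u\<^sub>0) r"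
      and same: "\<forall>\<nu>\<in>normal ` sides. 0 \<le> lor (hyp (?\<phi> x)) \<nu> * lor (hyp (?\<phi> y)) \<nu>"
    obtain u where u: "u \<in> V r" "x = cov n u" using x star[of r] by auto
    obtain v where v: "v \<in> V r" "y = cov n v" using y star[of r] by auto
    have "\<not> (u$i < u\<^sub>0$i \<and> u\<^sub>0$i < v$i) \<and> \<not> (v$i < u\<^sub>0$i \<and> u\<^sub>0$i < u$i)" if i: "i \<in> sides" for i
    proof -
      let ?L = "\<lambda>w. lor (hyp (of_cube (fld w))) (normal i)"
      have L: "?L w > 0" if "w \<in> V r" "w$i \<noteq> u\<^sub>0$i" for w
        using wall_sign[OF \<delta> V[OF that(1)] i] that(2) by simp
      have "0 \<le> ((if u$i < u\<^sub>0$i then - 1 else 1) * ?L u) * ((if v$i < u\<^sub>0$i then - 1 else 1) * ?L v)"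
        using same i unfolding_map_H3(2)[OF \<delta> V[OF u(1)] i] unfolding_map_H3(2)[OF \<delta> V[OF v(1)] i] u(2) v(2) by auto
      moreover have "?L u * ?L v > 0" if "u$i \<noteq> u\<^sub>0$i" "v$i \<noteq> u\<^sub>0$i" using L[OF u(1) that(1)] L[OF v(1) that(2)] by simp
      \<comment> \<open>On opposite sides of the plane the two signs would differ and the product
        would be negative, against \<open>same\<close>.\<close>
      ultimately show ?thesis by (intro conjI notI; elim conjE) (simp_all add: not_le[symmetric])
    qed
    then obtain m where m: "u \<in> box_at m" "v \<in> box_at m"
      using common_box[OF \<delta> V(1)[OF u(1)] V(1)[OF v(1)]] by metis
    show "\<exists>T\<in>range (tile n). x \<in> T \<and> y \<in> T"
      unfolding u(2) v(2)
      using cov_in_tile[OF n m(1) V(2)[OF u(1)]] cov_in_tile[OF n m(2) V(2)[OF v(1)]] by blast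
  qed
  then show ?thesis by blast
qed

end

section \<open>The sequence of hyperbolic rod complements\<close>

lemma tiling_rod_complement:
  assumes n: "n > 0"
  shows "tiling (rod_complement (rods n)) (range (tile n)) (devel n) bipyramid"
proof (unfold_locales)
  show "finite (range (tile n))" by (rule finite_tiles_n[OF n])
  show "\<Union>(range (tile n)) = topspace (rod_complement (rods n))" by (rule tile_cover[OF n])
  show "bipyramid \<subseteq> H3" by (rule bipyramid_H3)
  show "closedin (top_of_set H3) bipyramid" by (rule closedin_bipyramid)
  show "c \<in> bipyramid" if "p \<in> bipyramid" "q \<in> bipyramid" "c \<in> H3" "a \<ge> 0" "b \<ge> 0" "hyp c = a *\<^sub>R hyp p + b *\<^sub>R hyp q" for p q c a b
    using convex_bipyramid that by blast
  show "bij_betw (devel n) T bipyramid" if "T \<in> range (tile n)" for T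
    using that bij_devel[OF n] by auto
  show "continuous_map (top_of_set bipyramid) (rod_complement (rods n)) (inv_into T (devel n))" if "T \<in> range (tile n)" for T
    using that continuous_sec_n[OF n] by auto
  show "(T, T') \<in> {(S, S'). S \<in> range (tile n) \<and> S' \<in> range (tile n) \<and> S \<inter> S' \<noteq> {}}\<^sup>*"
    if "T \<in> range (tile n)" "T' \<in> range (tile n)" for T T'
    using that connected_tiles_n[OF n] by auto
  show "\<exists>r \<phi> N. tiled.unfolding_at (rod_complement (rods n)) (range (tile n)) (devel n) p r \<phi> N"
    if "p \<in> topspace (rod_complement (rods n))" for p
  proof -
    obtain u where "good u" "p = cov n u" using \<open>p \<in> topspace (rod_complement (rods n))\<close> topspace_rod_complement[OF n] by auto
    then show ?thesis using unfolding_exists[OF n] by blast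
  qed
qed

theorem corollary5p10:
  shows "\<exists>(R :: nat \<Rightarrow> (real^3) set set set)
           (d :: nat \<Rightarrow> (real^3) set \<Rightarrow> (real^3) set \<Rightarrow> real)
           (vol :: nat \<Rightarrow> real).
      (\<forall>n. card (R n) = 3 \<and> (\<forall>r\<in>R n. rod r) \<and> disjoint (R n) \<and>
           complete_hyperbolic_metric (rod_complement (R n)) (d n) \<and>
           has_finite_hyperbolic_volume (rod_complement (R n)) (d n) (vol n)) \<and>
      filterlim vol at_top sequentially"
proof -
  define d where "d n = tiled.dst (rod_complement (rods n)) (range (tile n)) (devel n)" for n
  have ch: "complete_hyperbolic_metric (rod_complement (rods n)) (d n)" if n: "n > 0" for n
    unfolding d_def by (rule tiling.complete_hyperbolic_metric_dst[OF tiling_rod_complement[OF n]])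
  have vol: "\<exists>v. has_finite_hyperbolic_volume (rod_complement (rods n)) (d n) v \<and> real n * measure H3_volume core \<le> v"
    if n: "n > 0" for n
  proof -
    have "\<exists>v. has_finite_hyperbolic_volume (rod_complement (rods n)) (d n) v \<and>
        card (range (tile n)) * measure H3_volume core \<le> v"
      unfolding d_def
    proof (rule tiling.finite_volume[OF tiling_rod_complement[OF n] finite_volume_bipyramid core_borel])
      show "core \<subseteq> bipyramid" using core_interior(1) by blast
      fix T T' x assume "T \<in> range (tile n)" "T' \<in> range (tile n)" "x \<in> T" "x \<in> T'" "devel n x \<in> core"
      then show "T = T'" using core_tiles[OF n] by blast
    qed
    moreover have "real n * measure H3_volume core \<le> card (range (tile n)) * measure H3_volume core"
      using card_tiles[OF n] by (intro mult_right_mono) auto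
    ultimately show ?thesis using order_trans by blast
  qed
  \<comment> \<open>The construction requires a positive degree, hence the shift of the
    index.\<close>
  define R where "R n = rods (Suc n)" for n
  define v where "v n = (SOME v. has_finite_hyperbolic_volume (rod_complement (rods n)) (d n) v \<and>
    real n * measure H3_volume core \<le> v)" for n
  have v: "has_finite_hyperbolic_volume (rod_complement (rods n)) (d n) (v n)" "real n * measure H3_volume core \<le> v n"
    if "n > 0" for n
    using someI_ex[OF vol[OF that]] by (simp_all add: v_def)
  have "filterlim (\<lambda>n. real n * measure H3_volume core) at_top sequentially"
    using filterlim_real_sequentially core_volume by (intro filterlim_at_top_mult_tendsto_pos[OF tendsto_const]) auto
  then have "filterlim (\<lambda>n. real (Suc n) * measure H3_volume core) at_top sequentially"
    by (subst filterlim_sequentially_Suc)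
  then have "filterlim (\<lambda>n. v (Suc n)) at_top sequentially"
    by (rule filterlim_at_top_mono) (intro always_eventually allI v(2), simp)
  moreover have "card (R n) = 3 \<and> (\<forall>r\<in>R n. rod r) \<and> disjoint (R n) \<and>
      complete_hyperbolic_metric (rod_complement (R n)) (d (Suc n)) \<and>
      has_finite_hyperbolic_volume (rod_complement (R n)) (d (Suc n)) (v (Suc n))" for n
    unfolding R_def using card_rods[of "Suc n"] rod_rods[of "Suc n"] disjoint_rods[of "Suc n"]
      ch[of "Suc n"] v(1)[of "Suc n"] by blast
  ultimately show ?thesis
    by (intro exI[of _ R] exI[of _ "\<lambda>n. d (Suc n)"] exI[of _ "\<lambda>n. v (Suc n)"]) blast
qed

end
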